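(* Let $Q$ be the quiver $a\xrightarrow{\alpha}b\xrightarrow{\beta}c\xrightarrow{\gamma}d$ and let $R$ consist of the single relation $\alpha\cdot\beta\cdot\gamma=0$. Then $$\mathrm{Hom}_{\mathrm{Adel}(\mathcal{C}(Q,R)^{\oplus})}\left((a\xrightarrow{\alpha}b\xrightarrow{\beta\cdot\gamma}d),\,(a\xrightarrow{\alpha\cdot\beta}c\xrightarrow{\gamma}d)\right)\simeq\mathbb{Z}$$ as abelian groups, with generator given by $\{\beta\}$. Moreover, among all morphisms $\partial$ in this group, exactly the generator $\{\beta\}$ and its additive inverse $-\{\beta\}$ render the sequence $$(0\to a\xrightarrow{\alpha\cdot\beta}c)\xrightarrow{\{\alpha\}}(0\to b\xrightarrow{\beta}c)\xrightarrow{\{\mathrm{id}_b\}}(a\xrightarrow{\alpha}b\xrightarrow{\beta\cdot\gamma}d)\xrightarrow{\ \partial\ }(a\xrightarrow{\alpha\cdot\beta}c\xrightarrow{\gamma}d)\xrightarrow{\{\mathrm{id}_c\}}(b\xrightarrow{\beta}c\to 0)\xrightarrow{\{\gamma\}}(b\xrightarrow{\beta\cdot\gamma}d\to 0)$$ in $\mathrm{Adel}(\mathcal{C}(Q,R)^{\oplus})$ exact (at its four inner objects).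
   Context: Composition is written in diagrammatic order: $\alpha\cdot\beta$ means first $\alpha$, then $\beta$. For a quiver $Q$ and a set $R$ of $\mathbb{Z}$-linear relations between its paths, $\mathcal{C}(Q,R)$ is the $\mathbb{Z}$-linear category whose objects are the nodes of $Q$ and whose morphisms are $\mathbb{Z}$-linear combinations of paths of $Q$ modulo the relations $R$. For a $\mathbb{Z}$-linear category $\mathbf{C}$, $\mathbf{C}^{\oplus}$ is its additive closure: objects are finite (possibly empty) tuples of objects of $\mathbf{C}$ (formal direct sums) and morphisms are matrices of morphisms of $\mathbf{C}$. The Adelman category $\mathrm{Adel}(\mathbf{A})$ of an additive category $\mathbf{A}$: its objects are composable pairs $(r_x\xrightarrow{\rho_x}x\xrightarrow{\gamma_x}c_x)$ of morphisms in $\mathbf{A}$ (no condition on $\rho_x\cdot\gamma_x$). A morphism, written $\{\varphi\}$, from $(r_x\xrightarrow{\rho_x}x\xrightarrow{\gamma_x}c_x)$ to $(r_y\xrightarrow{\rho_y}y\xrightarrow{\gamma_y}c_y)$ is given by a morphism $\varphi:x\to y$ in $\mathbf{A}$ such that there exist $\omega: r_x\to r_y$ and $\psi: c_x\to c_y$ with $\rho_x\cdot\varphi=\omega\cdot\rho_y$ and $\gamma_x\cdot\psi=\varphi\cdot\gamma_y$; two such morphisms $\{\varphi\},\{\varphi'\}$ are equal if there exist $\sigma_1: x\to r_y$ and $\sigma_2:c_x\to y$ with $\varphi-\varphi'=\sigma_1\cdot\rho_y+\gamma_x\cdot\sigma_2$. Composition and addition are induced from $\mathbf{A}$. $\mathrm{Adel}(\mathbf{A})$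 is an abelian category. *)

theory Defs
  imports
    "HOL-Algebra.Elementary_Groups"
    "HOL-Algebra.Free_Abelian_Groups"
    "Graph_Theory.Arc_Walk"
    "Jordan_Normal_Form.Matrix"
begin

section \<open>\<open>\<int>\<close>-linear categories\<close>

text \<open>
  \<open>Hom C A B\<close> is an abelian group in the sense of HOL-Algebra, that is, a commutative group
  whose \<open>mult\<close> is the addition of morphisms and whose \<open>one\<close> is the zero morphism.
  Morphisms do not store their endpoints; therefore composition takes the three objects involved
  as arguments. Composition is diagrammatic: \<open>Comp C A B D f g\<close> is first \<open>f : A \<rightarrow> B\<close>, then
  \<open>g : B \<rightarrow> D\<close>.
\<close>

record ('o, 'm) lincat =
  Ob :: "'o set"
  Hom :: "'o \<Rightarrow> 'o \<Rightarrow> 'm monoid"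
  Comp :: "'o \<Rightarrow> 'o \<Rightarrow> 'o \<Rightarrow> 'm \<Rightarrow> 'm \<Rightarrow> 'm"
  Ident :: "'o \<Rightarrow> 'm"

definition zero_mor :: "('o, 'm) lincat \<Rightarrow> 'o \<Rightarrow> 'o \<Rightarrow> 'm" where
  "zero_mor C A B = \<one>\<^bsub>Hom C A B\<^esub>"

definition is_kernel :: "('o, 'm) lincat \<Rightarrow> 'o \<Rightarrow> 'o \<Rightarrow> 'm \<Rightarrow> 'o \<Rightarrow> 'm \<Rightarrow> bool" where
  "is_kernel C A B f K k \<longleftrightarrow>
     K \<in> Ob C \<and> k \<in> carrier (Hom C K A) \<and> Comp C K A B k f = zero_mor C K B \<and>
     (\<forall>T\<in>Ob C. \<forall>t\<in>carrier (Hom C T A). Comp C T A B t f = zero_mor C T B \<longrightarrow>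
        (\<exists>!u. u \<in> carrier (Hom C T K) \<and> Comp C T K A u k = t))"

definition is_cokernel :: "('o, 'm) lincat \<Rightarrow> 'o \<Rightarrow> 'o \<Rightarrow> 'm \<Rightarrow> 'o \<Rightarrow> 'm \<Rightarrow> bool" where
  "is_cokernel C A B f Q q \<longleftrightarrow>
     Q \<in> Ob C \<and> q \<in> carrier (Hom C B Q) \<and> Comp C A B Q f q = zero_mor C A Q \<and>
     (\<forall>T\<in>Ob C. \<forall>t\<in>carrier (Hom C B T). Comp C A B T f t = zero_mor C A T \<longrightarrow>
        (\<exists>!u. u \<in> carrier (Hom C Q T) \<and> Comp C B Q T q u = t))"

text \<open>The image of a morphism of an abelian category is the kernel of its cokernel.\<close>

definition is_image :: "('o, 'm) lincat \<Rightarrow> 'o \<Rightarrow> 'o \<Rightarrow> 'm \<Rightarrow> 'o \<Rightarrow> 'm \<Rightarrow> bool" where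
  "is_image C A B f I i \<longleftrightarrow>
     (\<exists>Q q. is_cokernel C A B f Q q \<and> is_kernel C B Q q I i)"

text \<open>
  Exactness of \<open>A \<rightarrow> B \<rightarrow> D\<close> at \<open>B\<close>: the image of \<open>f\<close> and the kernel of \<open>g\<close> are the same subobject
  of \<open>B\<close>, that is, some monomorphism into \<open>B\<close> represents both.
\<close>

definition exact_at ::
    "('o, 'm) lincat \<Rightarrow> 'o \<Rightarrow> 'm \<Rightarrow> 'o \<Rightarrow> 'm \<Rightarrow> 'o \<Rightarrow> bool" where
  "exact_at C A f B g D \<longleftrightarrow>
     A \<in> Ob C \<and> B \<in> Ob C \<and> D \<in> Ob C \<and>
     f \<in> carrier (Hom C A B) \<and> g \<in> carrier (Hom C B D) \<and>
     (\<exists>I i. is_image C A B f I i \<and> is_kernel C B D g I i)"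


section \<open>The category of a quiver with relations\<close>

text \<open>
  A quiver is a directed multigraph; a path is an arc walk, i.e. the list of its arcs, the empty
  list being the trivial path. A relation is a triple \<open>(s, t, r)\<close> where \<open>r\<close> is a formal
  \<open>\<int>\<close>-linear combination of paths from \<open>s\<close> to \<open>t\<close>; it stands for the equation \<open>r = 0\<close>.
\<close>

type_synonym 'e path_comb = "'e list \<Rightarrow>\<^sub>0 int"

definition paths :: "('v, 'e) pre_digraph \<Rightarrow> 'v \<Rightarrow> 'v \<Rightarrow> 'e list set" where
  "paths Q u v = {p. pre_digraph.awalk Q u p v}"

definition path_combs :: "('v, 'e) pre_digraph \<Rightarrow> 'v \<Rightarrow> 'v \<Rightarrow> 'e path_comb monoid" where
  "path_combs Q u v = free_Abelian_group (paths Q u v)"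

text \<open>The bilinear extension of the concatenation of paths.\<close>

definition path_mult :: "'e path_comb \<Rightarrow> 'e path_comb \<Rightarrow> 'e path_comb" where
  "path_mult f g = frag_extend (\<lambda>p. frag_extend (\<lambda>q. frag_of (p @ q)) g) f"

text \<open>The component at \<open>(u, v)\<close> of the two-sided ideal generated by the relations.\<close>

definition rel_ideal ::
    "('v, 'e) pre_digraph \<Rightarrow> ('v \<times> 'v \<times> 'e path_comb) set \<Rightarrow> 'v \<Rightarrow> 'v \<Rightarrow> 'e path_comb set" where
  "rel_ideal Q R u v =
     generate (path_combs Q u v)
       {path_mult (path_mult (frag_of p) r) (frag_of q) | p q r s t.
          (s, t, r) \<in> R \<and> p \<in> paths Q u s \<and> q \<in> paths Q t v}"

definition path_class ::
    "('v, 'e) pre_digraph \<Rightarrow> ('v \<times> 'v \<times> 'e path_comb) set \<Rightarrow> 'v \<Rightarrow> 'v \<Rightarrow> 'e path_comb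
       \<Rightarrow> 'e path_comb set" where
  "path_class Q R u v f = rel_ideal Q R u v #>\<^bsub>path_combs Q u v\<^esub> f"

text \<open>
  Composition of classes is induced by representatives: all members of the union below are the
  same class.
\<close>

definition quiver_cat ::
    "('v, 'e) pre_digraph \<Rightarrow> ('v \<times> 'v \<times> 'e path_comb) set \<Rightarrow> ('v, 'e path_comb set) lincat" where
  "quiver_cat Q R =
     \<lparr>Ob = verts Q,
      Hom = (\<lambda>u v. path_combs Q u v Mod rel_ideal Q R u v),
      Comp = (\<lambda>u v w F G. \<Union>f\<in>F. \<Union>g\<in>G. path_class Q R u w (path_mult f g)),
      Ident = (\<lambda>u. path_class Q R u u (frag_of []))\<rparr>"


section \<open>The additive closure\<close>

text \<open>
  Objects are finite lists of objects. A morphism from a list of length \<open>m\<close> to a list of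
  length \<open>n\<close> is an \<open>m \<times> n\<close> matrix, so that row vectors act from the left and
  the diagrammatic composition is the matrix product in the same order.
\<close>

definition additive_closure :: "('o, 'm) lincat \<Rightarrow> ('o list, 'm mat) lincat" where
  "additive_closure C =
     \<lparr>Ob = lists (Ob C),
      Hom = (\<lambda>X Y.
        \<lparr>carrier = {M \<in> carrier_mat (length X) (length Y).
            \<forall>i<length X. \<forall>j<length Y. M $$ (i, j) \<in> carrier (Hom C (X ! i) (Y ! j))},
         monoid.mult = (\<lambda>M N. mat (length X) (length Y)
            (\<lambda>(i, j). M $$ (i, j) \<otimes>\<^bsub>Hom C (X ! i) (Y ! j)\<^esub> N $$ (i, j))),
         one = mat (length X) (length Y) (\<lambda>(i, j). zero_mor C (X ! i) (Y ! j))\<rparr>),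
      Comp = (\<lambda>X Y Z M N. mat (length X) (length Z)
        (\<lambda>(i, k). finprod (Hom C (X ! i) (Z ! k))
           (\<lambda>j. Comp C (X ! i) (Y ! j) (Z ! k) (M $$ (i, j)) (N $$ (j, k)))
           {..<length Y})),
      Ident = (\<lambda>X. mat (length X) (length X)
        (\<lambda>(i, j). if i = j then Ident C (X ! i) else zero_mor C (X ! i) (X ! j)))\<rparr>"


section \<open>The Adelman category\<close>

text \<open>\<open>Adel_Obj r \<rho> x \<gamma> c\<close> is the composable pair \<open>\<rho> : r \<rightarrow> x\<close>, \<open>\<gamma> : x \<rightarrow> c\<close>.\<close>

datatype ('o, 'm) adel_obj =
  Adel_Obj (rel_ob: 'o) (rel_mor: 'm) (mid_ob: 'o) (cor_mor: 'm) (cor_ob: 'o)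

definition adel_objects :: "('o, 'm) lincat \<Rightarrow> ('o, 'm) adel_obj set" where
  "adel_objects C =
     {X. rel_ob X \<in> Ob C \<and> mid_ob X \<in> Ob C \<and> cor_ob X \<in> Ob C \<and>
         rel_mor X \<in> carrier (Hom C (rel_ob X) (mid_ob X)) \<and>
         cor_mor X \<in> carrier (Hom C (mid_ob X) (cor_ob X))}"

definition adel_data ::
    "('o, 'm) lincat \<Rightarrow> ('o, 'm) adel_obj \<Rightarrow> ('o, 'm) adel_obj \<Rightarrow> 'm monoid" where
  "adel_data C X Y = (Hom C (mid_ob X) (mid_ob Y))
     \<lparr>carrier := {\<phi> \<in> carrier (Hom C (mid_ob X) (mid_ob Y)).
        (\<exists>\<omega>\<in>carrier (Hom C (rel_ob X) (rel_ob Y)).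
           Comp C (rel_ob X) (mid_ob X) (mid_ob Y) (rel_mor X) \<phi> =
           Comp C (rel_ob X) (rel_ob Y) (mid_ob Y) \<omega> (rel_mor Y)) \<and>
        (\<exists>\<psi>\<in>carrier (Hom C (cor_ob X) (cor_ob Y)).
           Comp C (mid_ob X) (cor_ob X) (cor_ob Y) (cor_mor X) \<psi> =
           Comp C (mid_ob X) (mid_ob Y) (cor_ob Y) \<phi> (cor_mor Y))}\<rparr>"

text \<open>
  Since \<open>\<rho> \<cdot> \<gamma>\<close> need not vanish, a morphism of the form \<open>\<sigma>\<^sub>1 \<cdot> \<rho>\<^sub>Y + \<gamma>\<^sub>X \<cdot> \<sigma>\<^sub>2\<close> need not
  satisfy the two conditions in \<open>adel_data\<close>; these have to be required separately.
\<close>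

definition adel_null ::
    "('o, 'm) lincat \<Rightarrow> ('o, 'm) adel_obj \<Rightarrow> ('o, 'm) adel_obj \<Rightarrow> 'm set" where
  "adel_null C X Y = {\<phi> \<in> carrier (adel_data C X Y).
     \<exists>\<sigma>1\<in>carrier (Hom C (mid_ob X) (rel_ob Y)). \<exists>\<sigma>2\<in>carrier (Hom C (cor_ob X) (mid_ob Y)).
       \<phi> = Comp C (mid_ob X) (rel_ob Y) (mid_ob Y) \<sigma>1 (rel_mor Y)
             \<otimes>\<^bsub>Hom C (mid_ob X) (mid_ob Y)\<^esub>
           Comp C (mid_ob X) (cor_ob X) (mid_ob Y) (cor_mor X) \<sigma>2}"

text \<open>The morphism \<open>{\<phi>} : X \<rightarrow> Y\<close>.\<close>

definition adel_class ::
    "('o, 'm) lincat \<Rightarrow> ('o, 'm) adel_obj \<Rightarrow> ('o, 'm) adel_obj \<Rightarrow> 'm \<Rightarrow> 'm set" where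
  "adel_class C X Y \<phi> = adel_null C X Y #>\<^bsub>adel_data C X Y\<^esub> \<phi>"

definition Adel :: "('o, 'm) lincat \<Rightarrow> (('o, 'm) adel_obj, 'm set) lincat" where
  "Adel C =
     \<lparr>Ob = adel_objects C,
      Hom = (\<lambda>X Y. adel_data C X Y Mod adel_null C X Y),
      Comp = (\<lambda>X Y Z F G. \<Union>\<phi>\<in>F. \<Union>\<psi>\<in>G.
        adel_class C X Z (Comp C (mid_ob X) (mid_ob Y) (mid_ob Z) \<phi> \<psi>)),
      Ident = (\<lambda>X. adel_class C X X (Ident C (mid_ob X)))\<rparr>"


section \<open>The quiver of the snake lemma\<close>

datatype snake_node = Va | Vb | Vc | Vd

datatype snake_arrow = E\<alpha> | E\<beta> | E\<gamma>

definition snake_quiver :: "(snake_node, snake_arrow) pre_digraph" where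
  "snake_quiver =
     \<lparr>verts = {Va, Vb, Vc, Vd},
      arcs = {E\<alpha>, E\<beta>, E\<gamma>},
      tail = (\<lambda>e. case e of E\<alpha> \<Rightarrow> Va | E\<beta> \<Rightarrow> Vb | E\<gamma> \<Rightarrow> Vc),
      head = (\<lambda>e. case e of E\<alpha> \<Rightarrow> Vb | E\<beta> \<Rightarrow> Vc | E\<gamma> \<Rightarrow> Vd)\<rparr>"

definition snake_relations :: "(snake_node \<times> snake_node \<times> snake_arrow path_comb) set" where
  "snake_relations = {(Va, Vd, frag_of [E\<alpha>, E\<beta>, E\<gamma>])}"

definition snake_add :: "(snake_node list, snake_arrow path_comb set mat) lincat" where
  "snake_add = additive_closure (quiver_cat snake_quiver snake_relations)"

text \<open>
  The class of the path \<open>p : u \<rightarrow> v\<close>, as a \<open>1 \<times> 1\<close> matrix: a morphism \<open>[u] \<rightarrow> [v]\<close> of the additive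
  closure. The zero object of the additive closure is the empty list.
\<close>

definition snake_mor ::
    "snake_node \<Rightarrow> snake_arrow list \<Rightarrow> snake_node \<Rightarrow> snake_arrow path_comb set mat" where
  "snake_mor u p v =
     mat 1 1 (\<lambda>_. path_class snake_quiver snake_relations u v (frag_of p))"

end

theory Submission
  imports Defs
begin

text \<open>
  An object \<open>r \<rightarrow> x \<rightarrow> c\<close> of the Adelman category behaves like the subquotient
  \<open>ker \<gamma> / (ker \<gamma> \<inter> im \<rho>)\<close> of \<open>x\<close>, and a morphism \<open>{\<phi>}\<close> like the map that \<open>\<phi>\<close> induces on such
  subquotients. Read this way, the six objects of the theorem are \<open>ker (\<alpha>\<beta>)\<close>, \<open>ker \<beta>\<close>,
  \<open>ker (\<beta>\<gamma>) / im \<alpha>\<close>, \<open>ker \<gamma> / im (\<alpha>\<beta>)\<close>, \<open>coker \<beta>\<close> and \<open>coker (\<beta>\<gamma>)\<close> up to the obvious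
  intersections, and the exactness of the sequence with \<open>\<partial> = {\<beta>}\<close> is an exercise in chasing
  elements. The proof turns this picture into an argument with generalized elements.

  The kernel and the cokernel of \<open>{\<phi>}\<close> can be written down with biproducts of the underlying
  category. From the explicit formulas one reads off which morphisms vanish on the kernel
  (\<open>adel_kernel\<close>) and, dually, which morphisms \<open>{t} : T \<rightarrow> Y\<close> are annihilated by the cokernel of
  \<open>{\<phi>} : X \<rightarrow> Y\<close>, that is, factor through the image of \<open>{\<phi>}\<close> (\<open>adel_cokernel\<close>). This is a
  condition \<open>in_image\<close> on \<open>t\<close> that mentions neither kernels nor cokernels. Exactness of
  \<open>X \<rightarrow> Y \<rightarrow> Z\<close> then says that the composite vanishes and that every generalized element of \<open>Y\<close>
  which dies in \<open>Z\<close> satisfies this condition (\<open>adel_exact_iff\<close>). With this criterion each of the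
  four exactness claims is a short computation in the underlying category (\<open>snake_exact\<close>).

  For the group of morphisms, the two homotopies that could identify multiples of \<open>\<beta>\<close> are morphisms
  \<open>b \<rightarrow> a\<close> and \<open>d \<rightarrow> c\<close>. They vanish because the quiver has no path against the direction of
  its arrows, so the group is \<open>Hom b c\<close>, which is free on \<open>\<beta>\<close>. Finally, let \<open>k\<beta>\<close> make the
  sequence exact. The morphism \<open>{\<beta>}\<close> into the fourth object dies in the fifth one, so by the
  criterion it lies in the image of \<open>{k\<beta>}\<close>, which means \<open>\<beta> = e \<cdot> k\<beta>\<close> for some endomorphism \<open>e\<close>
  of \<open>b\<close>. Since \<open>e\<close> is an integer, \<open>k\<close> is \<open>1\<close> or \<open>-1\<close> (\<open>snake_connecting_group\<close>).

  Both the category of a quiver with relations and the Adelman category are quotients of a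
  linear category by an ideal. The general facts on such quotients are therefore proved once and used
  twice.
\<close>

section \<open>Linear categories\<close>

text \<open>The axioms are relative to typed morphisms, since composition takes its objects as
  arguments. Sums are written multiplicatively, as the morphism groups are records of type \<open>monoid\<close>.\<close>

locale lin_category =
  fixes C :: "('o, 'm) lincat"
  assumes Hom_comm_group: "\<lbrakk>A \<in> Ob C; B \<in> Ob C\<rbrakk> \<Longrightarrow> comm_group (Hom C A B)"
    and Comp_closed [simp]:
      "\<lbrakk>A \<in> Ob C; B \<in> Ob C; D \<in> Ob C; f \<in> carrier (Hom C A B); g \<in> carrier (Hom C B D)\<rbrakk>
       \<Longrightarrow> Comp C A B D f g \<in> carrier (Hom C A D)"
    and Comp_assoc:
      "\<lbrakk>A \<in> Ob C; B \<in> Ob C; D \<in> Ob C; E \<in> Ob C;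
        f \<in> carrier (Hom C A B); g \<in> carrier (Hom C B D); h \<in> carrier (Hom C D E)\<rbrakk>
       \<Longrightarrow> Comp C A D E (Comp C A B D f g) h = Comp C A B E f (Comp C B D E g h)"
    and add_Comp:
      "\<lbrakk>A \<in> Ob C; B \<in> Ob C; D \<in> Ob C;
        f \<in> carrier (Hom C A B); f' \<in> carrier (Hom C A B); g \<in> carrier (Hom C B D)\<rbrakk>
       \<Longrightarrow> Comp C A B D (f \<otimes>\<^bsub>Hom C A B\<^esub> f') g =
           Comp C A B D f g \<otimes>\<^bsub>Hom C A D\<^esub> Comp C A B D f' g"
    and Comp_add:
      "\<lbrakk>A \<in> Ob C; B \<in> Ob C; D \<in> Ob C;
        f \<in> carrier (Hom C A B); g \<in> carrier (Hom C B D); g' \<in> carrier (Hom C B D)\<rbrakk>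
       \<Longrightarrow> Comp C A B D f (g \<otimes>\<^bsub>Hom C B D\<^esub> g') =
           Comp C A B D f g \<otimes>\<^bsub>Hom C A D\<^esub> Comp C A B D f g'"
    and Ident_closed [simp]: "A \<in> Ob C \<Longrightarrow> Ident C A \<in> carrier (Hom C A A)"
    and Ident_Comp [simp]:
      "\<lbrakk>A \<in> Ob C; B \<in> Ob C; f \<in> carrier (Hom C A B)\<rbrakk> \<Longrightarrow> Comp C A A B (Ident C A) f = f"
    and Comp_Ident [simp]:
      "\<lbrakk>A \<in> Ob C; B \<in> Ob C; f \<in> carrier (Hom C A B)\<rbrakk> \<Longrightarrow> Comp C A B B f (Ident C B) = f"
begin

lemma Hom_group: "\<lbrakk>A \<in> Ob C; B \<in> Ob C\<rbrakk> \<Longrightarrow> group (Hom C A B)"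
  using Hom_comm_group comm_group.axioms(2) by blast

lemma zero_closed [simp]:
  "\<lbrakk>A \<in> Ob C; B \<in> Ob C\<rbrakk> \<Longrightarrow> zero_mor C A B \<in> carrier (Hom C A B)"
  unfolding zero_mor_def using Hom_group by (simp add: group.is_monoid)

lemma add_closed [simp]:
  "\<lbrakk>A \<in> Ob C; B \<in> Ob C; f \<in> carrier (Hom C A B); g \<in> carrier (Hom C A B)\<rbrakk>
   \<Longrightarrow> f \<otimes>\<^bsub>Hom C A B\<^esub> g \<in> carrier (Hom C A B)"
  using Hom_group by (simp add: group.is_monoid monoid.m_closed)

lemma neg_closed [simp]:
  "\<lbrakk>A \<in> Ob C; B \<in> Ob C; f \<in> carrier (Hom C A B)\<rbrakk>
   \<Longrightarrow> inv\<^bsub>Hom C A B\<^esub> f \<in> carrier (Hom C A B)"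
  using Hom_group by (simp add: group.inv_closed)

lemma add_zero [simp]:
  assumes "A \<in> Ob C" "B \<in> Ob C" "f \<in> carrier (Hom C A B)"
  shows "f \<otimes>\<^bsub>Hom C A B\<^esub> zero_mor C A B = f" "zero_mor C A B \<otimes>\<^bsub>Hom C A B\<^esub> f = f"
  using assms Hom_group
  by (simp_all add: zero_mor_def group.is_monoid)

lemma add_neg [simp]:
  assumes "A \<in> Ob C" "B \<in> Ob C" "f \<in> carrier (Hom C A B)"
  shows "f \<otimes>\<^bsub>Hom C A B\<^esub> inv\<^bsub>Hom C A B\<^esub> f = zero_mor C A B"
    and "inv\<^bsub>Hom C A B\<^esub> f \<otimes>\<^bsub>Hom C A B\<^esub> f = zero_mor C A B"
    and "inv\<^bsub>Hom C A B\<^esub> (inv\<^bsub>Hom C A B\<^esub> f) = f"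
  using assms Hom_group
  by (simp_all add: zero_mor_def group.r_inv group.l_inv group.inv_inv)

lemma neg_zero [simp]:
  "\<lbrakk>A \<in> Ob C; B \<in> Ob C\<rbrakk> \<Longrightarrow> inv\<^bsub>Hom C A B\<^esub> zero_mor C A B = zero_mor C A B"
  using Hom_group by (simp add: zero_mor_def group.is_monoid monoid.inv_one)

lemma add_assoc:
  "\<lbrakk>A \<in> Ob C; B \<in> Ob C; f \<in> carrier (Hom C A B); g \<in> carrier (Hom C A B); h \<in> carrier (Hom C A B)\<rbrakk>
   \<Longrightarrow> (f \<otimes>\<^bsub>Hom C A B\<^esub> g) \<otimes>\<^bsub>Hom C A B\<^esub> h = f \<otimes>\<^bsub>Hom C A B\<^esub> (g \<otimes>\<^bsub>Hom C A B\<^esub> h)"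
  using Hom_group by (simp add: group.is_monoid monoid.m_assoc)

lemma add_comm:
  "\<lbrakk>A \<in> Ob C; B \<in> Ob C; f \<in> carrier (Hom C A B); g \<in> carrier (Hom C A B)\<rbrakk>
   \<Longrightarrow> f \<otimes>\<^bsub>Hom C A B\<^esub> g = g \<otimes>\<^bsub>Hom C A B\<^esub> f"
  by (simp add: Hom_comm_group comm_group.axioms(1) comm_monoid.m_comm)

lemma add_left_comm:
  "\<lbrakk>A \<in> Ob C; B \<in> Ob C; f \<in> carrier (Hom C A B); g \<in> carrier (Hom C A B); h \<in> carrier (Hom C A B)\<rbrakk>
   \<Longrightarrow> f \<otimes>\<^bsub>Hom C A B\<^esub> (g \<otimes>\<^bsub>Hom C A B\<^esub> h) = g \<otimes>\<^bsub>Hom C A B\<^esub> (f \<otimes>\<^bsub>Hom C A B\<^esub> h)"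
  using Hom_comm_group comm_group.axioms(1) comm_monoid.m_lcomm by metis

lemmas add_ac = add_assoc add_comm add_left_comm

lemma neg_add:
  assumes "A \<in> Ob C" "B \<in> Ob C" "f \<in> carrier (Hom C A B)" "g \<in> carrier (Hom C A B)"
  shows "inv\<^bsub>Hom C A B\<^esub> (f \<otimes>\<^bsub>Hom C A B\<^esub> g) = inv\<^bsub>Hom C A B\<^esub> f \<otimes>\<^bsub>Hom C A B\<^esub> inv\<^bsub>Hom C A B\<^esub> g"
proof -
  interpret comm_group "Hom C A B" using assms Hom_comm_group by blast
  show ?thesis using assms by (simp add: inv_mult)
qed

text \<open>Together with \<open>add_ac\<close> and right-nested compositions, the following cancellation rules let
  rewriting decide the additive identities between composites that occur below. A summand and its
  negative need not be adjacent in the ordered normal form, hence the variants with summands in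
  between.\<close>

lemma add_neg_cancel [simp]:
  assumes "A \<in> Ob C" "B \<in> Ob C" "f \<in> carrier (Hom C A B)" "g \<in> carrier (Hom C A B)"
  shows "f \<otimes>\<^bsub>Hom C A B\<^esub> (inv\<^bsub>Hom C A B\<^esub> f \<otimes>\<^bsub>Hom C A B\<^esub> g) = g"
    and "inv\<^bsub>Hom C A B\<^esub> f \<otimes>\<^bsub>Hom C A B\<^esub> (f \<otimes>\<^bsub>Hom C A B\<^esub> g) = g"
  using assms by (simp_all flip: add_assoc)

lemma add_neg_cancel_apart [simp]:
  assumes "A \<in> Ob C" "B \<in> Ob C" "f \<in> carrier (Hom C A B)" "g \<in> carrier (Hom C A B)"
  shows "f \<otimes>\<^bsub>Hom C A B\<^esub> (g \<otimes>\<^bsub>Hom C A B\<^esub> inv\<^bsub>Hom C A B\<^esub> f) = g"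
    and "inv\<^bsub>Hom C A B\<^esub> f \<otimes>\<^bsub>Hom C A B\<^esub> (g \<otimes>\<^bsub>Hom C A B\<^esub> f) = g"
  using assms by (subst add_left_comm; simp)+

lemma add_neg_cancel_apart2 [simp]:
  assumes "A \<in> Ob C" "B \<in> Ob C" "f \<in> carrier (Hom C A B)" "g \<in> carrier (Hom C A B)"
    "h \<in> carrier (Hom C A B)"
  shows "f \<otimes>\<^bsub>Hom C A B\<^esub> (g \<otimes>\<^bsub>Hom C A B\<^esub> (h \<otimes>\<^bsub>Hom C A B\<^esub> inv\<^bsub>Hom C A B\<^esub> f))
    = g \<otimes>\<^bsub>Hom C A B\<^esub> h"
  using assms by (subst add_left_comm; simp)+

lemma eq_iff_diff_zero:
  assumes "A \<in> Ob C" "B \<in> Ob C" "f \<in> carrier (Hom C A B)" "g \<in> carrier (Hom C A B)"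
  shows "f = g \<longleftrightarrow> f \<otimes>\<^bsub>Hom C A B\<^esub> inv\<^bsub>Hom C A B\<^esub> g = zero_mor C A B"
  using assms by (metis add_neg(1,2) add_assoc add_zero neg_closed)

lemma Comp_right_group_hom:
  assumes "A \<in> Ob C" "B \<in> Ob C" "D \<in> Ob C" "g \<in> carrier (Hom C B D)"
  shows "group_hom (Hom C A B) (Hom C A D) (\<lambda>f. Comp C A B D f g)"
  using assms by (auto intro!: group_hom.intro group_hom_axioms.intro homI
      simp: Hom_group add_Comp)

lemma Comp_left_group_hom:
  assumes "A \<in> Ob C" "B \<in> Ob C" "D \<in> Ob C" "f \<in> carrier (Hom C A B)"
  shows "group_hom (Hom C B D) (Hom C A D) (Comp C A B D f)"
  using assms by (auto intro!: group_hom.intro group_hom_axioms.intro homI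
      simp: Hom_group Comp_add)

lemma Comp_zero [simp]:
  assumes "A \<in> Ob C" "B \<in> Ob C" "D \<in> Ob C"
  shows "g \<in> carrier (Hom C B D) \<Longrightarrow> Comp C A B D (zero_mor C A B) g = zero_mor C A D"
    and "f \<in> carrier (Hom C A B) \<Longrightarrow> Comp C A B D f (zero_mor C B D) = zero_mor C A D"
  using group_hom.hom_one[OF Comp_right_group_hom] group_hom.hom_one[OF Comp_left_group_hom] assms
  by (auto simp: zero_mor_def)

lemma Comp_neg [simp]:
  assumes "A \<in> Ob C" "B \<in> Ob C" "D \<in> Ob C" "f \<in> carrier (Hom C A B)" "g \<in> carrier (Hom C B D)"
  shows "Comp C A B D (inv\<^bsub>Hom C A B\<^esub> f) g = inv\<^bsub>Hom C A D\<^esub> Comp C A B D f g"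
    and "Comp C A B D f (inv\<^bsub>Hom C B D\<^esub> g) = inv\<^bsub>Hom C A D\<^esub> Comp C A B D f g"
  using group_hom.hom_inv[OF Comp_right_group_hom] group_hom.hom_inv[OF Comp_left_group_hom] assms
  by auto

end

definition opposite :: "('o, 'm) lincat \<Rightarrow> ('o, 'm) lincat" where
  "opposite C = \<lparr>Ob = Ob C, Hom = (\<lambda>A B. Hom C B A),
     Comp = (\<lambda>A B D f g. Comp C D B A g f), Ident = Ident C\<rparr>"

lemma opposite_simps [simp]:
  "Ob (opposite C) = Ob C" "Hom (opposite C) A B = Hom C B A"
  "Comp (opposite C) A B D f g = Comp C D B A g f" "Ident (opposite C) = Ident C"
  "zero_mor (opposite C) A B = zero_mor C B A"
  by (simp_all add: opposite_def zero_mor_def)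

lemma (in lin_category) lin_category_opposite: "lin_category (opposite C)"
  by (rule lin_category.intro) (simp_all add: Hom_comm_group Comp_assoc add_Comp Comp_add)


subsection \<open>Biproducts\<close>

definition is_biproduct ::
    "('o, 'm) lincat \<Rightarrow> 'o \<Rightarrow> 'o \<Rightarrow> 'o \<Rightarrow> 'm \<Rightarrow> 'm \<Rightarrow> 'm \<Rightarrow> 'm \<Rightarrow> bool" where
  "is_biproduct C A B P i1 i2 p1 p2 \<longleftrightarrow>
     P \<in> Ob C \<and> i1 \<in> carrier (Hom C A P) \<and> i2 \<in> carrier (Hom C B P) \<and>
     p1 \<in> carrier (Hom C P A) \<and> p2 \<in> carrier (Hom C P B) \<and>
     Comp C A P A i1 p1 = Ident C A \<and> Comp C B P B i2 p2 = Ident C B \<and>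
     Comp C A P B i1 p2 = zero_mor C A B \<and> Comp C B P A i2 p1 = zero_mor C B A \<and>
     Comp C P A P p1 i1 \<otimes>\<^bsub>Hom C P P\<^esub> Comp C P B P p2 i2 = Ident C P"

text \<open>Binary biproducts are what kernels and cokernels in the Adelman category are built from.\<close>

locale biproduct_category = lin_category +
  assumes biproduct_exists:
    "\<lbrakk>A \<in> Ob C; B \<in> Ob C\<rbrakk> \<Longrightarrow> \<exists>P i1 i2 p1 p2. is_biproduct C A B P i1 i2 p1 p2"

text \<open>The last four equations are the defining ones with a further morphism composed on the right;
  they are the form that matches inside right-nested compositions.\<close>

lemma (in lin_category) biproduct_simps:
  assumes "is_biproduct C A B P i1 i2 p1 p2" "A \<in> Ob C" "B \<in> Ob C"
  shows "P \<in> Ob C" "i1 \<in> carrier (Hom C A P)" "i2 \<in> carrier (Hom C B P)"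
    "p1 \<in> carrier (Hom C P A)" "p2 \<in> carrier (Hom C P B)"
    "Comp C A P A i1 p1 = Ident C A" "Comp C B P B i2 p2 = Ident C B"
    "Comp C A P B i1 p2 = zero_mor C A B" "Comp C B P A i2 p1 = zero_mor C B A"
    "\<And>D z. \<lbrakk>D \<in> Ob C; z \<in> carrier (Hom C A D)\<rbrakk> \<Longrightarrow> Comp C A P D i1 (Comp C P A D p1 z) = z"
    "\<And>D z. \<lbrakk>D \<in> Ob C; z \<in> carrier (Hom C B D)\<rbrakk> \<Longrightarrow> Comp C B P D i2 (Comp C P B D p2 z) = z"
    "\<And>D z. \<lbrakk>D \<in> Ob C; z \<in> carrier (Hom C B D)\<rbrakk>
       \<Longrightarrow> Comp C A P D i1 (Comp C P B D p2 z) = zero_mor C A D"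
    "\<And>D z. \<lbrakk>D \<in> Ob C; z \<in> carrier (Hom C A D)\<rbrakk>
       \<Longrightarrow> Comp C B P D i2 (Comp C P A D p1 z) = zero_mor C B D"
  using assms unfolding is_biproduct_def by (simp_all flip: Comp_assoc)

lemma (in biproduct_category) biproduct_category_opposite: "biproduct_category (opposite C)"
proof -
  have "\<exists>P i1 i2 p1 p2. is_biproduct (opposite C) A B P i1 i2 p1 p2"
    if "A \<in> Ob C" "B \<in> Ob C" for A B
  proof -
    obtain P i1 i2 p1 p2 where "is_biproduct C A B P i1 i2 p1 p2"
      using biproduct_exists \<open>A \<in> Ob C\<close> \<open>B \<in> Ob C\<close> by blast
    then have "is_biproduct (opposite C) A B P p1 p2 i1 i2"
      using that by (simp add: is_biproduct_def)
    then show ?thesis by blast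
  qed
  then show ?thesis
    by (auto intro!: biproduct_category.intro lin_category_opposite biproduct_category_axioms.intro)
qed


section \<open>Quotients by ideals\<close>

definition quotient_cat ::
    "('o, 'm) lincat \<Rightarrow> ('o \<Rightarrow> 'o \<Rightarrow> 'm set) \<Rightarrow> ('o, 'm set) lincat" where
  "quotient_cat C N =
     \<lparr>Ob = Ob C,
      Hom = (\<lambda>A B. Hom C A B Mod N A B),
      Comp = (\<lambda>A B D F G. \<Union>f\<in>F. \<Union>g\<in>G. N A D #>\<^bsub>Hom C A D\<^esub> Comp C A B D f g),
      Ident = (\<lambda>A. N A A #>\<^bsub>Hom C A A\<^esub> Ident C A)\<rparr>"

locale lin_ideal = lin_category +
  fixes N :: "'a \<Rightarrow> 'a \<Rightarrow> 'b set"
  assumes ideal_subgroup: "\<lbrakk>A \<in> Ob C; B \<in> Ob C\<rbrakk> \<Longrightarrow> subgroup (N A B) (Hom C A B)"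
    and ideal_Comp: "\<lbrakk>A \<in> Ob C; B \<in> Ob C; D \<in> Ob C; f \<in> N A B; g \<in> carrier (Hom C B D)\<rbrakk>
      \<Longrightarrow> Comp C A B D f g \<in> N A D"
    and Comp_ideal: "\<lbrakk>A \<in> Ob C; B \<in> Ob C; D \<in> Ob C; f \<in> carrier (Hom C A B); g \<in> N B D\<rbrakk>
      \<Longrightarrow> Comp C A B D f g \<in> N A D"
begin

abbreviation cls :: "'a \<Rightarrow> 'a \<Rightarrow> 'b \<Rightarrow> 'b set" where
  "cls A B f \<equiv> N A B #>\<^bsub>Hom C A B\<^esub> f"

abbreviation quot :: "('a, 'b set) lincat" where
  "quot \<equiv> quotient_cat C N"

lemma quot_Ob [simp]: "Ob quot = Ob C"
  by (simp add: quotient_cat_def)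

lemma quot_Hom: "Hom quot A B = Hom C A B Mod N A B"
  by (simp add: quotient_cat_def)

lemma quot_Ident: "Ident quot A = cls A A (Ident C A)"
  by (simp add: quotient_cat_def)

lemma ideal_subset: "\<lbrakk>A \<in> Ob C; B \<in> Ob C; f \<in> N A B\<rbrakk> \<Longrightarrow> f \<in> carrier (Hom C A B)"
  using ideal_subgroup subgroup.subset by fastforce

lemma ideal_add:
  "\<lbrakk>A \<in> Ob C; B \<in> Ob C; f \<in> N A B; g \<in> N A B\<rbrakk> \<Longrightarrow> f \<otimes>\<^bsub>Hom C A B\<^esub> g \<in> N A B"
  using ideal_subgroup subgroup.m_closed by fastforce

lemma ideal_normal: "\<lbrakk>A \<in> Ob C; B \<in> Ob C\<rbrakk> \<Longrightarrow> N A B \<lhd> Hom C A B"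
  using ideal_subgroup Hom_comm_group comm_group.subgroup_imp_normal by blast

lemma carrier_quot_Hom: "carrier (Hom quot A B) = cls A B ` carrier (Hom C A B)"
  by (simp add: quot_Hom carrier_FactGroup)

lemma cls_closed [simp]: "f \<in> carrier (Hom C A B) \<Longrightarrow> cls A B f \<in> carrier (Hom quot A B)"
  by (simp add: carrier_quot_Hom)

lemma cls_self:
  "\<lbrakk>A \<in> Ob C; B \<in> Ob C; f \<in> carrier (Hom C A B)\<rbrakk> \<Longrightarrow> f \<in> cls A B f"
  by (simp add: Hom_group group.rcos_self ideal_subgroup)

lemma mem_cls_iff:
  assumes "A \<in> Ob C" "B \<in> Ob C" "f \<in> carrier (Hom C A B)"
  shows "g \<in> cls A B f \<longleftrightarrow> (\<exists>n\<in>N A B. g = n \<otimes>\<^bsub>Hom C A B\<^esub> f)"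
  using assms by (auto simp: r_coset_def)

lemma cls_eq_iff:
  assumes "A \<in> Ob C" "B \<in> Ob C" "f \<in> carrier (Hom C A B)" "g \<in> carrier (Hom C A B)"
  shows "cls A B f = cls A B g \<longleftrightarrow> f \<otimes>\<^bsub>Hom C A B\<^esub> inv\<^bsub>Hom C A B\<^esub> g \<in> N A B"
proof
  assume "cls A B f = cls A B g"
  then have "f \<in> cls A B g" using assms cls_self by blast
  then obtain n where "n \<in> N A B" "f = n \<otimes>\<^bsub>Hom C A B\<^esub> g"
    using assms by (auto simp: mem_cls_iff)
  then show "f \<otimes>\<^bsub>Hom C A B\<^esub> inv\<^bsub>Hom C A B\<^esub> g \<in> N A B"
    using assms ideal_subset by (simp add: add_assoc)
next
  assume n: "f \<otimes>\<^bsub>Hom C A B\<^esub> inv\<^bsub>Hom C A B\<^esub> g \<in> N A B"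
  have "f = (f \<otimes>\<^bsub>Hom C A B\<^esub> inv\<^bsub>Hom C A B\<^esub> g) \<otimes>\<^bsub>Hom C A B\<^esub> g"
    using assms by (simp add: add_assoc)
  then have "f \<in> cls A B g" using n assms mem_cls_iff by blast
  then show "cls A B f = cls A B g"
    using group.repr_independence[OF Hom_group] assms ideal_subgroup by metis
qed

lemma quot_zero: "zero_mor quot A B = N A B"
  by (simp add: zero_mor_def quot_Hom)

lemma cls_zero: "\<lbrakk>A \<in> Ob C; B \<in> Ob C\<rbrakk> \<Longrightarrow> cls A B (zero_mor C A B) = N A B"
  using Hom_group group.coset_mult_one ideal_subset unfolding zero_mor_def
  by (metis subsetI)

lemma cls_eq_zero_iff:
  assumes "A \<in> Ob C" "B \<in> Ob C" "f \<in> carrier (Hom C A B)"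
  shows "cls A B f = zero_mor quot A B \<longleftrightarrow> f \<in> N A B"
  using cls_eq_iff[of A B f "zero_mor C A B"] assms by (simp add: quot_zero cls_zero)

lemma cls_add:
  assumes "A \<in> Ob C" "B \<in> Ob C" "f \<in> carrier (Hom C A B)" "g \<in> carrier (Hom C A B)"
  shows "cls A B f \<otimes>\<^bsub>Hom quot A B\<^esub> cls A B g = cls A B (f \<otimes>\<^bsub>Hom C A B\<^esub> g)"
  using assms by (simp add: quot_Hom normal.rcos_sum ideal_normal)

lemma cls_neg:
  assumes "A \<in> Ob C" "B \<in> Ob C" "f \<in> carrier (Hom C A B)"
  shows "inv\<^bsub>Hom quot A B\<^esub> cls A B f = cls A B (inv\<^bsub>Hom C A B\<^esub> f)"
  using assms cls_closed[of f A B]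
  by (simp add: quot_Hom normal.inv_FactGroup normal.rcos_inv ideal_normal)

text \<open>Representatives \<open>m + f\<close> and \<open>n + g\<close> with \<open>m\<close>, \<open>n\<close> in the ideal compose to
  \<open>f \<cdot> g\<close> plus \<open>m \<cdot> (n + g) + f \<cdot> n\<close>, so every member of the union is the same class.\<close>

lemma cls_Comp:
  assumes "A \<in> Ob C" "B \<in> Ob C" "D \<in> Ob C" "f \<in> carrier (Hom C A B)" "g \<in> carrier (Hom C B D)"
  shows "Comp quot A B D (cls A B f) (cls B D g) = cls A D (Comp C A B D f g)"
proof -
  have "cls A D (Comp C A B D f' g') = cls A D (Comp C A B D f g)"
    if f': "f' \<in> cls A B f" and g': "g' \<in> cls B D g" for f' g'
  proof -
    obtain m n where m: "m \<in> N A B" "f' = m \<otimes>\<^bsub>Hom C A B\<^esub> f"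
      and n: "n \<in> N B D" "g' = n \<otimes>\<^bsub>Hom C B D\<^esub> g"
      using f' g' assms by (auto simp: mem_cls_iff)
    have mn: "m \<in> carrier (Hom C A B)" "n \<in> carrier (Hom C B D)"
      using m n assms ideal_subset by auto
    have g'c: "g' \<in> carrier (Hom C B D)"
      using assms mn n by simp
    have "Comp C A B D f' g' = Comp C A B D m g' \<otimes>\<^bsub>Hom C A D\<^esub> Comp C A B D f g'"
      using assms mn g'c by (simp add: m(2) add_Comp)
    also have "Comp C A B D f g' = Comp C A B D f n \<otimes>\<^bsub>Hom C A D\<^esub> Comp C A B D f g"
      using assms mn by (simp add: n(2) Comp_add)
    finally have "Comp C A B D f' g' \<otimes>\<^bsub>Hom C A D\<^esub> inv\<^bsub>Hom C A D\<^esub> Comp C A B D f g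
        = Comp C A B D m g' \<otimes>\<^bsub>Hom C A D\<^esub> Comp C A B D f n"
      using assms mn g'c by (simp add: add_assoc)
    also have "\<dots> \<in> N A D"
      using assms m(1) n(1) mn g'c by (simp add: ideal_add ideal_Comp Comp_ideal)
    finally show ?thesis using assms mn m(2) g'c by (simp add: cls_eq_iff)
  qed
  moreover have "f \<in> cls A B f" "g \<in> cls B D g" using assms cls_self by auto
  ultimately have "(\<Union>f'\<in>cls A B f. \<Union>g'\<in>cls B D g. cls A D (Comp C A B D f' g'))
      = cls A D (Comp C A B D f g)"
    by blast
  then show ?thesis by (simp add: quotient_cat_def)
qed

text \<open>Every equation between morphisms of the quotient reduces to one between representatives.\<close>

lemma quot_Hom_cases:
  assumes "F \<in> carrier (Hom quot A B)"
  obtains f where "f \<in> carrier (Hom C A B)" "F = cls A B f"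
  using assms by (auto simp: carrier_quot_Hom)

sublocale quot: lin_category quot
proof (rule lin_category.intro)
  show "comm_group (Hom quot A B)" if "A \<in> Ob quot" "B \<in> Ob quot" for A B
    using that by (simp add: quot_Hom comm_group.abelian_FactGroup Hom_comm_group ideal_subgroup)
next
  fix A B D F G
  assume "A \<in> Ob quot" "B \<in> Ob quot" "D \<in> Ob quot"
    and "F \<in> carrier (Hom quot A B)" "G \<in> carrier (Hom quot B D)"
  then show "Comp quot A B D F G \<in> carrier (Hom quot A D)"
    by (elim quot_Hom_cases) (simp add: cls_Comp)
next
  fix A B D E F G H
  assume "A \<in> Ob quot" "B \<in> Ob quot" "D \<in> Ob quot" "E \<in> Ob quot"
    and "F \<in> carrier (Hom quot A B)" "G \<in> carrier (Hom quot B D)" "H \<in> carrier (Hom quot D E)"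
  then show "Comp quot A D E (Comp quot A B D F G) H = Comp quot A B E F (Comp quot B D E G H)"
    by (elim quot_Hom_cases) (simp add: cls_Comp Comp_assoc)
next
  fix A B D F F' G
  assume "A \<in> Ob quot" "B \<in> Ob quot" "D \<in> Ob quot" "F \<in> carrier (Hom quot A B)"
    and "F' \<in> carrier (Hom quot A B)" "G \<in> carrier (Hom quot B D)"
  then show "Comp quot A B D (F \<otimes>\<^bsub>Hom quot A B\<^esub> F') G =
      Comp quot A B D F G \<otimes>\<^bsub>Hom quot A D\<^esub> Comp quot A B D F' G"
    by (elim quot_Hom_cases) (simp add: cls_Comp cls_add add_Comp)
next
  fix A B D F G G'
  assume "A \<in> Ob quot" "B \<in> Ob quot" "D \<in> Ob quot" "F \<in> carrier (Hom quot A B)"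
    and "G \<in> carrier (Hom quot B D)" "G' \<in> carrier (Hom quot B D)"
  then show "Comp quot A B D F (G \<otimes>\<^bsub>Hom quot B D\<^esub> G') =
      Comp quot A B D F G \<otimes>\<^bsub>Hom quot A D\<^esub> Comp quot A B D F G'"
    by (elim quot_Hom_cases) (simp add: cls_Comp cls_add Comp_add)
next
  fix A B F
  assume "A \<in> Ob quot" "B \<in> Ob quot" and F: "F \<in> carrier (Hom quot A B)"
  then show "Comp quot A A B (Ident quot A) F = F" "Comp quot A B B F (Ident quot B) = F"
    by (auto elim!: quot_Hom_cases simp: quot_Ident cls_Comp)
qed (simp add: quot_Ident)

end


section \<open>The Adelman category as a quotient\<close>

text \<open>The morphisms of this category are the admissible representatives \<open>\<phi>\<close> before any identification.
  The witnesses \<open>\<omega>\<close> and \<open>\<psi>\<close> are not part of a morphism, so that homotopies form a two-sided ideal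
  in an honest linear category.\<close>

definition adel_data_cat :: "('o, 'm) lincat \<Rightarrow> (('o, 'm) adel_obj, 'm) lincat" where
  "adel_data_cat C =
     \<lparr>Ob = adel_objects C, Hom = adel_data C,
      Comp = (\<lambda>X Y Z. Comp C (mid_ob X) (mid_ob Y) (mid_ob Z)),
      Ident = (\<lambda>X. Ident C (mid_ob X))\<rparr>"

lemma adel_data_cat_simps [simp]:
  "Ob (adel_data_cat C) = adel_objects C"
  "Hom (adel_data_cat C) = adel_data C"
  "Comp (adel_data_cat C) X Y Z = Comp C (mid_ob X) (mid_ob Y) (mid_ob Z)"
  "Ident (adel_data_cat C) X = Ident C (mid_ob X)"
  by (simp_all add: adel_data_cat_def)

lemma Adel_eq_quotient: "Adel C = quotient_cat (adel_data_cat C) (adel_null C)"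
  unfolding Adel_def quotient_cat_def adel_class_def by (simp add: fun_eq_iff)

lemma adel_data_ops [simp]:
  "monoid.mult (adel_data C X Y) = monoid.mult (Hom C (mid_ob X) (mid_ob Y))"
  "monoid.one (adel_data C X Y) = monoid.one (Hom C (mid_ob X) (mid_ob Y))"
  by (simp_all add: adel_data_def)

lemma mem_adel_data:
  "\<phi> \<in> carrier (adel_data C X Y) \<longleftrightarrow>
     \<phi> \<in> carrier (Hom C (mid_ob X) (mid_ob Y)) \<and>
     (\<exists>\<omega>\<in>carrier (Hom C (rel_ob X) (rel_ob Y)).
        Comp C (rel_ob X) (mid_ob X) (mid_ob Y) (rel_mor X) \<phi> =
        Comp C (rel_ob X) (rel_ob Y) (mid_ob Y) \<omega> (rel_mor Y)) \<and>
     (\<exists>\<psi>\<in>carrier (Hom C (cor_ob X) (cor_ob Y)).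
        Comp C (mid_ob X) (cor_ob X) (cor_ob Y) (cor_mor X) \<psi> =
        Comp C (mid_ob X) (mid_ob Y) (cor_ob Y) \<phi> (cor_mor Y))"
  by (simp add: adel_data_def)

lemma adel_data_closed:
  "\<phi> \<in> carrier (adel_data C X Y) \<Longrightarrow> \<phi> \<in> carrier (Hom C (mid_ob X) (mid_ob Y))"
  by (simp add: mem_adel_data)

lemma adel_dataI:
  assumes "\<phi> \<in> carrier (Hom C (mid_ob X) (mid_ob Y))"
    and "\<omega> \<in> carrier (Hom C (rel_ob X) (rel_ob Y))"
    and "Comp C (rel_ob X) (mid_ob X) (mid_ob Y) (rel_mor X) \<phi> =
         Comp C (rel_ob X) (rel_ob Y) (mid_ob Y) \<omega> (rel_mor Y)"
    and "\<psi> \<in> carrier (Hom C (cor_ob X) (cor_ob Y))"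
    and "Comp C (mid_ob X) (cor_ob X) (cor_ob Y) (cor_mor X) \<psi> =
         Comp C (mid_ob X) (mid_ob Y) (cor_ob Y) \<phi> (cor_mor Y)"
  shows "\<phi> \<in> carrier (adel_data C X Y)"
  using assms unfolding mem_adel_data by blast

lemma adel_dataE:
  assumes "\<phi> \<in> carrier (adel_data C X Y)"
  obtains \<omega> \<psi> where "\<phi> \<in> carrier (Hom C (mid_ob X) (mid_ob Y))"
    and "\<omega> \<in> carrier (Hom C (rel_ob X) (rel_ob Y))"
    and "Comp C (rel_ob X) (mid_ob X) (mid_ob Y) (rel_mor X) \<phi> =
         Comp C (rel_ob X) (rel_ob Y) (mid_ob Y) \<omega> (rel_mor Y)"
    and "\<psi> \<in> carrier (Hom C (cor_ob X) (cor_ob Y))"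
    and "Comp C (mid_ob X) (cor_ob X) (cor_ob Y) (cor_mor X) \<psi> =
         Comp C (mid_ob X) (mid_ob Y) (cor_ob Y) \<phi> (cor_mor Y)"
  using assms unfolding mem_adel_data by blast

lemma adel_objects_iff [simp]:
  "Adel_Obj r \<rho> x \<gamma> c \<in> adel_objects C \<longleftrightarrow>
     r \<in> Ob C \<and> x \<in> Ob C \<and> c \<in> Ob C \<and> \<rho> \<in> carrier (Hom C r x) \<and> \<gamma> \<in> carrier (Hom C x c)"
  by (auto simp: adel_objects_def)

lemma adel_objectsD:
  assumes "X \<in> adel_objects C"
  shows "rel_ob X \<in> Ob C" "mid_ob X \<in> Ob C" "cor_ob X \<in> Ob C"
    "rel_mor X \<in> carrier (Hom C (rel_ob X) (mid_ob X))"
    "cor_mor X \<in> carrier (Hom C (mid_ob X) (cor_ob X))"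
  using assms by (auto simp: adel_objects_def)

lemma adel_nullI:
  assumes "\<phi> \<in> carrier (adel_data C X Y)"
    and "\<sigma>1 \<in> carrier (Hom C (mid_ob X) (rel_ob Y))" "\<sigma>2 \<in> carrier (Hom C (cor_ob X) (mid_ob Y))"
    and "\<phi> = Comp C (mid_ob X) (rel_ob Y) (mid_ob Y) \<sigma>1 (rel_mor Y)
             \<otimes>\<^bsub>Hom C (mid_ob X) (mid_ob Y)\<^esub> Comp C (mid_ob X) (cor_ob X) (mid_ob Y) (cor_mor X) \<sigma>2"
  shows "\<phi> \<in> adel_null C X Y"
  using assms unfolding adel_null_def by blast

lemma adel_nullE:
  assumes "\<phi> \<in> adel_null C X Y"
  obtains \<sigma>1 \<sigma>2 where "\<phi> \<in> carrier (adel_data C X Y)"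
    "\<sigma>1 \<in> carrier (Hom C (mid_ob X) (rel_ob Y))" "\<sigma>2 \<in> carrier (Hom C (cor_ob X) (mid_ob Y))"
    "\<phi> = Comp C (mid_ob X) (rel_ob Y) (mid_ob Y) \<sigma>1 (rel_mor Y)
         \<otimes>\<^bsub>Hom C (mid_ob X) (mid_ob Y)\<^esub> Comp C (mid_ob X) (cor_ob X) (mid_ob Y) (cor_mor X) \<sigma>2"
  using assms unfolding adel_null_def by blast

context lin_category
begin

lemma adel_data_subgroup:
  assumes X: "X \<in> adel_objects C" and Y: "Y \<in> adel_objects C"
  shows "subgroup (carrier (adel_data C X Y)) (Hom C (mid_ob X) (mid_ob Y))"
proof -
  note [simp] = adel_objectsD[OF X] adel_objectsD[OF Y]
  show ?thesis
  proof (rule group.subgroupI)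
    show "group (Hom C (mid_ob X) (mid_ob Y))" by (simp add: Hom_group)
    show "carrier (adel_data C X Y) \<subseteq> carrier (Hom C (mid_ob X) (mid_ob Y))"
      by (auto dest: adel_data_closed)
    have "zero_mor C (mid_ob X) (mid_ob Y) \<in> carrier (adel_data C X Y)"
      by (rule adel_dataI[where \<omega> = "zero_mor C (rel_ob X) (rel_ob Y)"
            and \<psi> = "zero_mor C (cor_ob X) (cor_ob Y)"]) simp_all
    then show "carrier (adel_data C X Y) \<noteq> {}" by blast
  next
    fix f assume "f \<in> carrier (adel_data C X Y)"
    then obtain \<omega> \<psi> where [simp]: "f \<in> carrier (Hom C (mid_ob X) (mid_ob Y))"
      "\<omega> \<in> carrier (Hom C (rel_ob X) (rel_ob Y))"
      "Comp C (rel_ob X) (mid_ob X) (mid_ob Y) (rel_mor X) f =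
         Comp C (rel_ob X) (rel_ob Y) (mid_ob Y) \<omega> (rel_mor Y)"
      "\<psi> \<in> carrier (Hom C (cor_ob X) (cor_ob Y))"
      "Comp C (mid_ob X) (cor_ob X) (cor_ob Y) (cor_mor X) \<psi> =
         Comp C (mid_ob X) (mid_ob Y) (cor_ob Y) f (cor_mor Y)"
      by (rule adel_dataE)
    show "inv\<^bsub>Hom C (mid_ob X) (mid_ob Y)\<^esub> f \<in> carrier (adel_data C X Y)"
      by (rule adel_dataI[where \<omega> = "inv\<^bsub>Hom C (rel_ob X) (rel_ob Y)\<^esub> \<omega>"
            and \<psi> = "inv\<^bsub>Hom C (cor_ob X) (cor_ob Y)\<^esub> \<psi>"]) simp_all
    fix g assume "g \<in> carrier (adel_data C X Y)"
    then obtain \<omega>' \<psi>' where [simp]: "g \<in> carrier (Hom C (mid_ob X) (mid_ob Y))"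
      "\<omega>' \<in> carrier (Hom C (rel_ob X) (rel_ob Y))"
      "Comp C (rel_ob X) (mid_ob X) (mid_ob Y) (rel_mor X) g =
         Comp C (rel_ob X) (rel_ob Y) (mid_ob Y) \<omega>' (rel_mor Y)"
      "\<psi>' \<in> carrier (Hom C (cor_ob X) (cor_ob Y))"
      "Comp C (mid_ob X) (cor_ob X) (cor_ob Y) (cor_mor X) \<psi>' =
         Comp C (mid_ob X) (mid_ob Y) (cor_ob Y) g (cor_mor Y)"
      by (rule adel_dataE)
    show "f \<otimes>\<^bsub>Hom C (mid_ob X) (mid_ob Y)\<^esub> g \<in> carrier (adel_data C X Y)"
      by (rule adel_dataI[where \<omega> = "\<omega> \<otimes>\<^bsub>Hom C (rel_ob X) (rel_ob Y)\<^esub> \<omega>'"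
            and \<psi> = "\<psi> \<otimes>\<^bsub>Hom C (cor_ob X) (cor_ob Y)\<^esub> \<psi>'"]) (simp_all add: add_Comp Comp_add)
  qed
qed

lemma adel_data_comm_group:
  assumes X: "X \<in> adel_objects C" and Y: "Y \<in> adel_objects C"
  shows "comm_group (adel_data C X Y)"
proof (rule group.group_comm_groupI)
  note [simp] = adel_objectsD[OF X] adel_objectsD[OF Y]
  have "group (Hom C (mid_ob X) (mid_ob Y)\<lparr>carrier := carrier (adel_data C X Y)\<rparr>)"
    by (rule subgroup.subgroup_is_group[OF adel_data_subgroup[OF X Y]]) (simp add: Hom_group)
  then show "group (adel_data C X Y)" by (simp add: adel_data_def)
  show "f \<otimes>\<^bsub>adel_data C X Y\<^esub> g = g \<otimes>\<^bsub>adel_data C X Y\<^esub> f"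
    if "f \<in> carrier (adel_data C X Y)" "g \<in> carrier (adel_data C X Y)" for f g
    using that by (simp add: adel_data_closed add_comm)
qed

lemma adel_data_inv [simp]:
  assumes X: "X \<in> adel_objects C" and Y: "Y \<in> adel_objects C" and f: "f \<in> carrier (adel_data C X Y)"
  shows "inv\<^bsub>adel_data C X Y\<^esub> f = inv\<^bsub>Hom C (mid_ob X) (mid_ob Y)\<^esub> f"
proof -
  have "inv\<^bsub>Hom C (mid_ob X) (mid_ob Y)\<lparr>carrier := carrier (adel_data C X Y)\<rparr>\<^esub> f
      = inv\<^bsub>Hom C (mid_ob X) (mid_ob Y)\<^esub> f"
    using assms by (intro group.m_inv_consistent adel_data_subgroup Hom_group adel_objectsD) auto
  then show ?thesis by (simp add: adel_data_def)
qed

lemma adel_data_Comp: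
  assumes X: "X \<in> adel_objects C" and Y: "Y \<in> adel_objects C" and Z: "Z \<in> adel_objects C"
    and "f \<in> carrier (adel_data C X Y)" "g \<in> carrier (adel_data C Y Z)"
  shows "Comp C (mid_ob X) (mid_ob Y) (mid_ob Z) f g \<in> carrier (adel_data C X Z)"
proof -
  note [simp] = adel_objectsD[OF X] adel_objectsD[OF Y] adel_objectsD[OF Z]
  obtain \<omega> \<psi> where f: "f \<in> carrier (Hom C (mid_ob X) (mid_ob Y))"
    "\<omega> \<in> carrier (Hom C (rel_ob X) (rel_ob Y))"
    "\<psi> \<in> carrier (Hom C (cor_ob X) (cor_ob Y))"
    and f\<omega>: "Comp C (rel_ob X) (mid_ob X) (mid_ob Y) (rel_mor X) f =
      Comp C (rel_ob X) (rel_ob Y) (mid_ob Y) \<omega> (rel_mor Y)"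
    and f\<psi>: "Comp C (mid_ob X) (cor_ob X) (cor_ob Y) (cor_mor X) \<psi> =
      Comp C (mid_ob X) (mid_ob Y) (cor_ob Y) f (cor_mor Y)"
    using assms by (elim adel_dataE)
  obtain \<omega>' \<psi>' where g: "g \<in> carrier (Hom C (mid_ob Y) (mid_ob Z))"
    "\<omega>' \<in> carrier (Hom C (rel_ob Y) (rel_ob Z))"
    "\<psi>' \<in> carrier (Hom C (cor_ob Y) (cor_ob Z))"
    and g\<omega>: "Comp C (rel_ob Y) (mid_ob Y) (mid_ob Z) (rel_mor Y) g =
      Comp C (rel_ob Y) (rel_ob Z) (mid_ob Z) \<omega>' (rel_mor Z)"
    and g\<psi>: "Comp C (mid_ob Y) (cor_ob Y) (cor_ob Z) (cor_mor Y) \<psi>' =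
      Comp C (mid_ob Y) (mid_ob Z) (cor_ob Z) g (cor_mor Z)"
    using assms by (elim adel_dataE)
  show ?thesis
  proof (rule adel_dataI)
    show "Comp C (mid_ob X) (mid_ob Y) (mid_ob Z) f g \<in> carrier (Hom C (mid_ob X) (mid_ob Z))"
      "Comp C (rel_ob X) (rel_ob Y) (rel_ob Z) \<omega> \<omega>' \<in> carrier (Hom C (rel_ob X) (rel_ob Z))"
      "Comp C (cor_ob X) (cor_ob Y) (cor_ob Z) \<psi> \<psi>' \<in> carrier (Hom C (cor_ob X) (cor_ob Z))"
      using f g by simp_all
    show "Comp C (rel_ob X) (mid_ob X) (mid_ob Z) (rel_mor X) (Comp C (mid_ob X) (mid_ob Y) (mid_ob Z) f g)
      = Comp C (rel_ob X) (rel_ob Z) (mid_ob Z) (Comp C (rel_ob X) (rel_ob Y) (rel_ob Z) \<omega> \<omega>') (rel_mor Z)"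
      using f g by (simp add: Comp_assoc f\<omega> g\<omega> flip: Comp_assoc[of "rel_ob X" "mid_ob X" "mid_ob Y" "mid_ob Z"])
    show "Comp C (mid_ob X) (cor_ob X) (cor_ob Z) (cor_mor X) (Comp C (cor_ob X) (cor_ob Y) (cor_ob Z) \<psi> \<psi>')
      = Comp C (mid_ob X) (mid_ob Z) (cor_ob Z) (Comp C (mid_ob X) (mid_ob Y) (mid_ob Z) f g) (cor_mor Z)"
      using f g Comp_assoc[of "mid_ob X" "cor_ob X" "cor_ob Y" "cor_ob Z" "cor_mor X" \<psi> \<psi>']
        Comp_assoc[of "mid_ob X" "mid_ob Y" "cor_ob Y" "cor_ob Z" f "cor_mor Y" \<psi>']
      by (simp add: Comp_assoc f\<psi> g\<psi>)
  qed
qed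

lemma lin_category_adel_data: "lin_category (adel_data_cat C)"
proof (rule lin_category.intro)
  show "Ident (adel_data_cat C) X \<in> carrier (Hom (adel_data_cat C) X X)"
    if "X \<in> Ob (adel_data_cat C)" for X
    using that
    by (simp, intro adel_dataI[where \<omega> = "Ident C (rel_ob X)" and \<psi> = "Ident C (cor_ob X)"])
       (simp_all add: adel_objectsD)
qed (simp_all add: adel_data_comm_group adel_data_Comp adel_data_closed adel_objectsD
       Comp_assoc add_Comp Comp_add)

text \<open>A null morphism consists of two summands, one factoring through the relations of the target
  and one through the corelations of the source; sums and negatives are taken summand by summand.\<close>

lemma adel_null_subgroup:
  assumes X: "X \<in> adel_objects C" and Y: "Y \<in> adel_objects C"
  shows "subgroup (adel_null C X Y) (adel_data C X Y)"
proof -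
  interpret D: lin_category "adel_data_cat C" by (rule lin_category_adel_data)
  note [simp] = adel_objectsD[OF X] adel_objectsD[OF Y]
  show ?thesis
  proof (rule group.subgroupI)
    show "group (adel_data C X Y)" using D.Hom_group X Y by simp
    show "adel_null C X Y \<subseteq> carrier (adel_data C X Y)" by (auto simp: adel_null_def)
    have "zero_mor C (mid_ob X) (mid_ob Y) \<in> carrier (adel_data C X Y)"
      using D.zero_closed[of X Y] X Y by (simp add: zero_mor_def)
    then have "zero_mor C (mid_ob X) (mid_ob Y) \<in> adel_null C X Y"
      by (rule adel_nullI[where ?\<sigma>1.0 = "zero_mor C (mid_ob X) (rel_ob Y)"
            and ?\<sigma>2.0 = "zero_mor C (cor_ob X) (mid_ob Y)"]) simp_all
    then show "adel_null C X Y \<noteq> {}" by blast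
  next
    fix f assume "f \<in> adel_null C X Y"
    then obtain \<sigma>1 \<sigma>2 where f: "f \<in> carrier (adel_data C X Y)"
      and s: "\<sigma>1 \<in> carrier (Hom C (mid_ob X) (rel_ob Y))" "\<sigma>2 \<in> carrier (Hom C (cor_ob X) (mid_ob Y))"
      and fs: "f = Comp C (mid_ob X) (rel_ob Y) (mid_ob Y) \<sigma>1 (rel_mor Y)
         \<otimes>\<^bsub>Hom C (mid_ob X) (mid_ob Y)\<^esub> Comp C (mid_ob X) (cor_ob X) (mid_ob Y) (cor_mor X) \<sigma>2"
      by (rule adel_nullE)
    have "inv\<^bsub>adel_data C X Y\<^esub> f \<in> carrier (adel_data C X Y)"
      using D.neg_closed[of X Y f] X Y f by simp
    then show "inv\<^bsub>adel_data C X Y\<^esub> f \<in> adel_null C X Y"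
      by (rule adel_nullI[where ?\<sigma>1.0 = "inv\<^bsub>Hom C (mid_ob X) (rel_ob Y)\<^esub> \<sigma>1"
            and ?\<sigma>2.0 = "inv\<^bsub>Hom C (cor_ob X) (mid_ob Y)\<^esub> \<sigma>2"])
         (use f s X Y in \<open>simp_all add: fs neg_add\<close>)
    fix g assume "g \<in> adel_null C X Y"
    then obtain \<tau>1 \<tau>2 where g: "g \<in> carrier (adel_data C X Y)"
      and t: "\<tau>1 \<in> carrier (Hom C (mid_ob X) (rel_ob Y))" "\<tau>2 \<in> carrier (Hom C (cor_ob X) (mid_ob Y))"
      and gt: "g = Comp C (mid_ob X) (rel_ob Y) (mid_ob Y) \<tau>1 (rel_mor Y)
         \<otimes>\<^bsub>Hom C (mid_ob X) (mid_ob Y)\<^esub> Comp C (mid_ob X) (cor_ob X) (mid_ob Y) (cor_mor X) \<tau>2"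
      by (rule adel_nullE)
    have "f \<otimes>\<^bsub>adel_data C X Y\<^esub> g \<in> carrier (adel_data C X Y)"
      using D.add_closed[of X Y f g] X Y f g by simp
    then show "f \<otimes>\<^bsub>adel_data C X Y\<^esub> g \<in> adel_null C X Y"
      by (rule adel_nullI[where ?\<sigma>1.0 = "\<sigma>1 \<otimes>\<^bsub>Hom C (mid_ob X) (rel_ob Y)\<^esub> \<tau>1"
            and ?\<sigma>2.0 = "\<sigma>2 \<otimes>\<^bsub>Hom C (cor_ob X) (mid_ob Y)\<^esub> \<tau>2"])
         (use s t in \<open>simp_all add: fs gt add_Comp Comp_add add_ac\<close>)
  qed
qed

text \<open>Composing \<open>\<sigma>\<^sub>1 \<cdot> \<rho> + \<gamma> \<cdot> \<sigma>\<^sub>2\<close> with an admissible morphism keeps this shape: on the right the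
  witness \<open>\<omega>\<close> moves past \<open>\<rho>\<close>, on the left the witness \<open>\<psi>\<close> moves past \<open>\<gamma>\<close>.\<close>

lemma adel_null_ideal: "lin_ideal (adel_data_cat C) (adel_null C)"
proof -
  interpret D: lin_category "adel_data_cat C" by (rule lin_category_adel_data)
  show ?thesis
  proof (intro lin_ideal.intro lin_ideal_axioms.intro)
    show "lin_category (adel_data_cat C)" by (rule lin_category_adel_data)
    show "subgroup (adel_null C X Y) (Hom (adel_data_cat C) X Y)"
      if "X \<in> Ob (adel_data_cat C)" "Y \<in> Ob (adel_data_cat C)" for X Y
      using that adel_null_subgroup by simp
  next
    fix X Y Z f g
    assume "X \<in> Ob (adel_data_cat C)" "Y \<in> Ob (adel_data_cat C)" "Z \<in> Ob (adel_data_cat C)"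
    then have X: "X \<in> adel_objects C" and Y: "Y \<in> adel_objects C" and Z: "Z \<in> adel_objects C"
      by simp_all
    note [simp] = adel_objectsD[OF X] adel_objectsD[OF Y] adel_objectsD[OF Z]
    {
      assume "f \<in> adel_null C X Y" and "g \<in> carrier (Hom (adel_data_cat C) Y Z)"
      then have gd: "g \<in> carrier (adel_data C Y Z)" by simp
      obtain \<sigma>1 \<sigma>2 where f: "f \<in> carrier (adel_data C X Y)"
        and s: "\<sigma>1 \<in> carrier (Hom C (mid_ob X) (rel_ob Y))" "\<sigma>2 \<in> carrier (Hom C (cor_ob X) (mid_ob Y))"
        and fs: "f = Comp C (mid_ob X) (rel_ob Y) (mid_ob Y) \<sigma>1 (rel_mor Y)
           \<otimes>\<^bsub>Hom C (mid_ob X) (mid_ob Y)\<^esub> Comp C (mid_ob X) (cor_ob X) (mid_ob Y) (cor_mor X) \<sigma>2"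
        using \<open>f \<in> adel_null C X Y\<close> by (rule adel_nullE)
      obtain \<omega> where g: "g \<in> carrier (Hom C (mid_ob Y) (mid_ob Z))"
        "\<omega> \<in> carrier (Hom C (rel_ob Y) (rel_ob Z))"
        "Comp C (rel_ob Y) (mid_ob Y) (mid_ob Z) (rel_mor Y) g =
         Comp C (rel_ob Y) (rel_ob Z) (mid_ob Z) \<omega> (rel_mor Z)"
        using gd by (rule adel_dataE)
      have "Comp C (mid_ob X) (mid_ob Y) (mid_ob Z) f g \<in> carrier (adel_data C X Z)"
        using X Y Z f gd by (rule adel_data_Comp)
      then have "Comp C (mid_ob X) (mid_ob Y) (mid_ob Z) f g \<in> adel_null C X Z"
        by (rule adel_nullI[where ?\<sigma>1.0 = "Comp C (mid_ob X) (rel_ob Y) (rel_ob Z) \<sigma>1 \<omega>"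
              and ?\<sigma>2.0 = "Comp C (cor_ob X) (mid_ob Y) (mid_ob Z) \<sigma>2 g"])
           (use s g in \<open>simp_all add: fs add_Comp Comp_assoc\<close>)
      then show "Comp (adel_data_cat C) X Y Z f g \<in> adel_null C X Z" by simp
    }
    {
      assume "f \<in> carrier (Hom (adel_data_cat C) X Y)" and "g \<in> adel_null C Y Z"
      then have fd: "f \<in> carrier (adel_data C X Y)" by simp
      obtain \<sigma>1 \<sigma>2 where g: "g \<in> carrier (adel_data C Y Z)"
        and s: "\<sigma>1 \<in> carrier (Hom C (mid_ob Y) (rel_ob Z))" "\<sigma>2 \<in> carrier (Hom C (cor_ob Y) (mid_ob Z))"
        and gs: "g = Comp C (mid_ob Y) (rel_ob Z) (mid_ob Z) \<sigma>1 (rel_mor Z)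
           \<otimes>\<^bsub>Hom C (mid_ob Y) (mid_ob Z)\<^esub> Comp C (mid_ob Y) (cor_ob Y) (mid_ob Z) (cor_mor Y) \<sigma>2"
        using \<open>g \<in> adel_null C Y Z\<close> by (rule adel_nullE)
      obtain \<psi> where f: "f \<in> carrier (Hom C (mid_ob X) (mid_ob Y))"
        "\<psi> \<in> carrier (Hom C (cor_ob X) (cor_ob Y))"
        "Comp C (mid_ob X) (cor_ob X) (cor_ob Y) (cor_mor X) \<psi> =
         Comp C (mid_ob X) (mid_ob Y) (cor_ob Y) f (cor_mor Y)"
        using fd by (rule adel_dataE)
      have "Comp C (mid_ob X) (mid_ob Y) (mid_ob Z) f g \<in> carrier (adel_data C X Z)"
        using X Y Z fd g by (rule adel_data_Comp)
      then have "Comp C (mid_ob X) (mid_ob Y) (mid_ob Z) f g \<in> adel_null C X Z"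
        by (rule adel_nullI[where ?\<sigma>1.0 = "Comp C (mid_ob X) (mid_ob Y) (rel_ob Z) f \<sigma>1"
              and ?\<sigma>2.0 = "Comp C (cor_ob X) (cor_ob Y) (mid_ob Z) \<psi> \<sigma>2"])
           (use s f in \<open>simp_all add: gs Comp_add flip: Comp_assoc\<close>)
      then show "Comp (adel_data_cat C) X Y Z f g \<in> adel_null C X Z" by simp
    }
  qed
qed

lemma lin_category_Adel: "lin_category (Adel C)"
proof -
  interpret D: lin_ideal "adel_data_cat C" "adel_null C" by (rule adel_null_ideal)
  show ?thesis using D.quot.lin_category_axioms by (simp add: Adel_eq_quotient)
qed

lemma Adel_Ob [simp]: "Ob (Adel C) = adel_objects C"
  by (simp add: Adel_def)

lemma adel_class_closed:
  "\<phi> \<in> carrier (adel_data C X Y) \<Longrightarrow> adel_class C X Y \<phi> \<in> carrier (Hom (Adel C) X Y)"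
  by (simp add: Adel_def adel_class_def carrier_FactGroup)

lemma Adel_Hom_cases:
  assumes "F \<in> carrier (Hom (Adel C) X Y)"
  obtains \<phi> where "\<phi> \<in> carrier (adel_data C X Y)" "F = adel_class C X Y \<phi>"
  using assms by (auto simp: Adel_def adel_class_def carrier_FactGroup)

lemma adel_class_Comp:
  assumes "X \<in> adel_objects C" "Y \<in> adel_objects C" "Z \<in> adel_objects C"
    and "\<phi> \<in> carrier (adel_data C X Y)" "\<psi> \<in> carrier (adel_data C Y Z)"
  shows "Comp (Adel C) X Y Z (adel_class C X Y \<phi>) (adel_class C Y Z \<psi>)
    = adel_class C X Z (Comp C (mid_ob X) (mid_ob Y) (mid_ob Z) \<phi> \<psi>)"
  using lin_ideal.cls_Comp[OF adel_null_ideal] assms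
  by (simp add: Adel_eq_quotient adel_class_def)

lemma adel_class_eq_zero_iff:
  assumes "X \<in> adel_objects C" "Y \<in> adel_objects C" "\<phi> \<in> carrier (adel_data C X Y)"
  shows "adel_class C X Y \<phi> = zero_mor (Adel C) X Y \<longleftrightarrow> \<phi> \<in> adel_null C X Y"
  using lin_ideal.cls_eq_zero_iff[OF adel_null_ideal, of X Y \<phi>] assms
  by (simp add: Adel_eq_quotient adel_class_def)

lemma adel_class_eq_iff:
  assumes "X \<in> adel_objects C" "Y \<in> adel_objects C"
    and "\<phi> \<in> carrier (adel_data C X Y)" "\<psi> \<in> carrier (adel_data C X Y)"
  shows "adel_class C X Y \<phi> = adel_class C X Y \<psi> \<longleftrightarrow>
    \<phi> \<otimes>\<^bsub>Hom C (mid_ob X) (mid_ob Y)\<^esub> inv\<^bsub>Hom C (mid_ob X) (mid_ob Y)\<^esub> \<psi> \<in> adel_null C X Y"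
  using lin_ideal.cls_eq_iff[OF adel_null_ideal, of X Y \<phi> \<psi>] assms
  by (simp add: Adel_eq_quotient adel_class_def)

lemma adel_class_neg:
  assumes "X \<in> adel_objects C" "Y \<in> adel_objects C" "\<phi> \<in> carrier (adel_data C X Y)"
  shows "inv\<^bsub>Hom (Adel C) X Y\<^esub> adel_class C X Y \<phi>
    = adel_class C X Y (inv\<^bsub>Hom C (mid_ob X) (mid_ob Y)\<^esub> \<phi>)"
  using lin_ideal.cls_neg[OF adel_null_ideal, of X Y \<phi>] assms
  by (simp add: Adel_eq_quotient adel_class_def)

lemma adel_data_neg:
  assumes "X \<in> adel_objects C" "Y \<in> adel_objects C" "\<phi> \<in> carrier (adel_data C X Y)"
  shows "inv\<^bsub>Hom C (mid_ob X) (mid_ob Y)\<^esub> \<phi> \<in> carrier (adel_data C X Y)"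
  using adel_data_subgroup assms subgroup.m_inv_closed by metis

lemma adel_null_neg:
  assumes "X \<in> adel_objects C" "Y \<in> adel_objects C" "\<phi> \<in> adel_null C X Y"
  shows "inv\<^bsub>Hom C (mid_ob X) (mid_ob Y)\<^esub> \<phi> \<in> adel_null C X Y"
  using subgroup.m_inv_closed[OF adel_null_subgroup] assms
  by (metis adel_data_inv adel_nullE)

end


section \<open>Duality\<close>

text \<open>Reversing all arrows exchanges the roles of relations and corelations.\<close>

definition flip_adel :: "('o, 'm) adel_obj \<Rightarrow> ('o, 'm) adel_obj" where
  "flip_adel X = Adel_Obj (cor_ob X) (cor_mor X) (mid_ob X) (rel_mor X) (rel_ob X)"

lemma flip_adel_simps [simp]:
  "rel_ob (flip_adel X) = cor_ob X" "rel_mor (flip_adel X) = cor_mor X"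
  "mid_ob (flip_adel X) = mid_ob X" "cor_mor (flip_adel X) = rel_mor X"
  "cor_ob (flip_adel X) = rel_ob X" "flip_adel (flip_adel X) = X"
  by (simp_all add: flip_adel_def)

lemma adel_objects_opposite: "flip_adel X \<in> adel_objects (opposite C) \<longleftrightarrow> X \<in> adel_objects C"
  by (auto simp: adel_objects_def)

lemma adel_data_opposite: "adel_data (opposite C) (flip_adel X) (flip_adel Y) = adel_data C Y X"
proof -
  have "carrier (adel_data (opposite C) (flip_adel X) (flip_adel Y)) = carrier (adel_data C Y X)"
    unfolding set_eq_iff mem_adel_data by (auto simp: eq_commute)
  then show ?thesis by (simp add: adel_data_def)
qed

context lin_category
begin

lemma adel_null_opposite:
  assumes X: "X \<in> adel_objects C" and Y: "Y \<in> adel_objects C"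
  shows "adel_null (opposite C) (flip_adel X) (flip_adel Y) = adel_null C Y X"
proof -
  note [simp] = adel_objectsD[OF X] adel_objectsD[OF Y]
  show ?thesis
    unfolding adel_null_def adel_data_opposite
    by (auto simp: add_comm intro!: bexI)
qed

lemma adel_class_opposite:
  assumes X: "X \<in> adel_objects C" and Y: "Y \<in> adel_objects C"
  shows "adel_class (opposite C) (flip_adel X) (flip_adel Y) = adel_class C Y X"
  using assms by (simp add: fun_eq_iff adel_class_def adel_null_opposite adel_data_opposite)

text \<open>The Adelman construction commutes with passing to the opposite category, so cokernels are
  kernels of the opposite category.\<close>

lemma is_cokernel_Adel_if_kernel_opposite:
  assumes X: "X \<in> adel_objects C" and Y: "Y \<in> adel_objects C" and Q: "Q \<in> adel_objects C"
    and ker: "is_kernel (Adel (opposite C)) (flip_adel Y) (flip_adel X) f (flip_adel Q) q"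
  shows "is_cokernel (Adel C) X Y f Q q"
proof -
  have Hom: "Hom (Adel (opposite C)) (flip_adel S) (flip_adel T) = Hom (Adel C) T S"
    if "S \<in> adel_objects C" "T \<in> adel_objects C" for S T
    using that by (simp add: Adel_def adel_data_opposite adel_null_opposite)
  have Comp: "Comp (Adel (opposite C)) (flip_adel S) (flip_adel T) (flip_adel U) g h
      = Comp (Adel C) U T S h g"
    if "S \<in> adel_objects C" "T \<in> adel_objects C" "U \<in> adel_objects C" for S T U g h
    using that by (auto simp: Adel_def adel_class_opposite)
  show ?thesis
    unfolding is_cokernel_def
  proof (intro conjI ballI impI)
    show "Q \<in> Ob (Adel C)" "q \<in> carrier (Hom (Adel C) Y Q)"
      "Comp (Adel C) X Y Q f q = zero_mor (Adel C) X Q"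
      using ker X Y Q by (simp_all add: is_kernel_def Hom Comp zero_mor_def)
    fix T t
    assume "T \<in> Ob (Adel C)" and t: "t \<in> carrier (Hom (Adel C) Y T)"
      "Comp (Adel C) X Y T f t = zero_mor (Adel C) X T"
    then have T: "T \<in> adel_objects C" by simp
    have "flip_adel T \<in> Ob (Adel (opposite C))"
      using T by (simp add: Adel_def adel_objects_opposite)
    moreover have "t \<in> carrier (Hom (Adel (opposite C)) (flip_adel T) (flip_adel Y))"
      "Comp (Adel (opposite C)) (flip_adel T) (flip_adel Y) (flip_adel X) t f
        = zero_mor (Adel (opposite C)) (flip_adel T) (flip_adel X)"
      using X Y T t by (simp_all add: Hom Comp zero_mor_def)
    ultimately have "\<exists>!u. u \<in> carrier (Hom (Adel (opposite C)) (flip_adel T) (flip_adel Q)) \<and>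
        Comp (Adel (opposite C)) (flip_adel T) (flip_adel Q) (flip_adel Y) u q = t"
      using ker unfolding is_kernel_def by blast
    then show "\<exists>!u. u \<in> carrier (Hom (Adel C) Q T) \<and> Comp (Adel C) Y Q T q u = t"
      using X Y Q T by (simp add: Hom Comp)
  qed
qed

end


section \<open>Kernels and cokernels in the Adelman category\<close>

context biproduct_category
begin

text \<open>In terms of elements, the kernel of \<open>{\<phi>}\<close> consists of the pairs \<open>(x, r)\<close> with \<open>\<gamma> x = 0\<close> and
  \<open>\<phi> x + \<rho> r = 0\<close>, modulo the pairs \<open>(\<rho> r', r)\<close>. So it is carried by the biproduct of the middle
  object of \<open>X\<close> and the relation object of \<open>Y\<close>.

  The last clause describes the morphisms \<open>t\<close> that vanish on the kernel. A null homotopy of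
  \<open>p\<^sub>1 \<cdot> t\<close> splits along the biproduct: its restriction to the first summand expresses \<open>t\<close>, and its
  restriction to the second summand, on which \<open>p\<^sub>1 \<cdot> t\<close> is zero, gives the relation on \<open>e\<close>. The
  resulting condition does not mention the kernel object, so it can be applied to concrete sequences.\<close>

lemma adel_kernel:
  assumes X: "X \<in> adel_objects C" and Y: "Y \<in> adel_objects C"
    and \<phi>: "\<phi> \<in> carrier (adel_data C X Y)"
  obtains K \<kappa> where "K \<in> adel_objects C" "\<kappa> \<in> carrier (adel_data C K X)"
    "is_kernel (Adel C) X Y (adel_class C X Y \<phi>) K (adel_class C K X \<kappa>)"
    "\<And>T t. \<lbrakk>T \<in> adel_objects C; t \<in> carrier (adel_data C X T);
        Comp C (mid_ob K) (mid_ob X) (mid_ob T) \<kappa> t \<in> adel_null C K T\<rbrakk>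
      \<Longrightarrow> \<exists>a\<in>carrier (Hom C (mid_ob X) (rel_ob T)). \<exists>b\<in>carrier (Hom C (cor_ob X) (mid_ob T)).
          \<exists>e\<in>carrier (Hom C (mid_ob Y) (mid_ob T)). \<exists>h\<in>carrier (Hom C (rel_ob Y) (rel_ob T)).
            t = (Comp C (mid_ob X) (rel_ob T) (mid_ob T) a (rel_mor T)
                  \<otimes>\<^bsub>Hom C (mid_ob X) (mid_ob T)\<^esub>
                 Comp C (mid_ob X) (cor_ob X) (mid_ob T) (cor_mor X) b)
                  \<otimes>\<^bsub>Hom C (mid_ob X) (mid_ob T)\<^esub>
                 Comp C (mid_ob X) (mid_ob Y) (mid_ob T) \<phi> e \<and>
            Comp C (rel_ob Y) (mid_ob Y) (mid_ob T) (rel_mor Y) e =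
            Comp C (rel_ob Y) (rel_ob T) (mid_ob T) h (rel_mor T)"
proof -
  obtain rx \<rho>x x \<gamma>x cx where Xe: "X = Adel_Obj rx \<rho>x x \<gamma>x cx" by (cases X)
  obtain ry \<rho>y y \<gamma>y cy where Ye: "Y = Adel_Obj ry \<rho>y y \<gamma>y cy" by (cases Y)
  have XY [simp]: "rx \<in> Ob C" "x \<in> Ob C" "cx \<in> Ob C" "\<rho>x \<in> carrier (Hom C rx x)"
    "\<gamma>x \<in> carrier (Hom C x cx)" "ry \<in> Ob C" "y \<in> Ob C" "cy \<in> Ob C"
    "\<rho>y \<in> carrier (Hom C ry y)" "\<gamma>y \<in> carrier (Hom C y cy)"
    using X Y by (simp_all add: Xe Ye)
  have \<phi>c [simp]: "\<phi> \<in> carrier (Hom C x y)" using adel_data_closed[OF \<phi>] by (simp add: Xe Ye)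
  obtain R ii1 ii2 pp1 pp2 where R: "is_biproduct C rx ry R ii1 ii2 pp1 pp2"
    using biproduct_exists[of rx ry] by auto
  obtain P i1 i2 p1 p2 where P: "is_biproduct C x ry P i1 i2 p1 p2"
    using biproduct_exists[of x ry] by auto
  obtain Q j1 j2 q1 q2 where Q: "is_biproduct C cx y Q j1 j2 q1 q2"
    using biproduct_exists[of cx y] by auto
  note [simp] = biproduct_simps[OF R] biproduct_simps[OF P] biproduct_simps[OF Q]
  define \<rho>k where "\<rho>k = Comp C R rx P pp1 (Comp C rx x P \<rho>x i1) \<otimes>\<^bsub>Hom C R P\<^esub> Comp C R ry P pp2 i2"
  define \<gamma>k where "\<gamma>k = Comp C P x Q p1 (Comp C x cx Q \<gamma>x j1) \<otimes>\<^bsub>Hom C P Q\<^esub>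
    (Comp C P x Q p1 (Comp C x y Q \<phi> j2) \<otimes>\<^bsub>Hom C P Q\<^esub> Comp C P ry Q p2 (Comp C ry y Q \<rho>y j2))"
  have \<rho>k [simp]: "\<rho>k \<in> carrier (Hom C R P)" by (simp add: \<rho>k_def)
  have \<gamma>k [simp]: "\<gamma>k \<in> carrier (Hom C P Q)" by (simp add: \<gamma>k_def)
  have i\<rho>k: "Comp C rx R P ii1 \<rho>k = Comp C rx x P \<rho>x i1" "Comp C ry R P ii2 \<rho>k = i2"
    by (simp_all add: \<rho>k_def Comp_add)
  have \<rho>kp: "Comp C R P x \<rho>k p1 = Comp C R rx x pp1 \<rho>x"
    by (simp add: \<rho>k_def add_Comp Comp_assoc)
  have i\<gamma>k: "Comp C x P Q i1 \<gamma>k = Comp C x cx Q \<gamma>x j1 \<otimes>\<^bsub>Hom C x Q\<^esub> Comp C x y Q \<phi> j2"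
    "Comp C ry P Q i2 \<gamma>k = Comp C ry y Q \<rho>y j2"
    by (simp_all add: \<gamma>k_def Comp_add)
  have \<gamma>kq: "Comp C P Q cx \<gamma>k q1 = Comp C P x cx p1 \<gamma>x"
    "Comp C P Q y \<gamma>k q2 = Comp C P x y p1 \<phi> \<otimes>\<^bsub>Hom C P y\<^esub> Comp C P ry y p2 \<rho>y"
    by (simp_all add: \<gamma>k_def add_Comp Comp_assoc)
  define K where "K = Adel_Obj R \<rho>k P \<gamma>k Q"
  have K: "K \<in> adel_objects C" by (simp add: K_def)
  have p1: "p1 \<in> carrier (adel_data C K X)"
    by (rule adel_dataI[where \<omega> = pp1 and \<psi> = q1]) (simp_all add: K_def Xe \<rho>kp \<gamma>kq)
  have p1\<phi>: "Comp C P x y p1 \<phi> \<in> adel_null C K Y"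
  proof (rule adel_nullI[where ?\<sigma>1.0 = "inv\<^bsub>Hom C P ry\<^esub> p2" and ?\<sigma>2.0 = q2])
    show "Comp C P x y p1 \<phi> \<in> carrier (adel_data C K Y)"
      using adel_data_Comp[OF K X Y p1 \<phi>] by (simp add: K_def Xe Ye)
  qed (simp_all add: K_def Xe Ye \<gamma>kq add_ac)
  \<comment> \<open>The embedding of the kernel is a monomorphism: the second component of \<open>v\<close> is absorbed by
    the identity on the second summand of the relation object.\<close>
  have mono: "v \<in> adel_null C T K"
    if T: "T \<in> adel_objects C" and v: "v \<in> carrier (adel_data C T K)"
      and vp: "Comp C (mid_ob T) P x v p1 \<in> adel_null C T X" for T v
  proof -
    note [simp] = adel_objectsD[OF T]
    have [simp]: "v \<in> carrier (Hom C (mid_ob T) P)" using adel_data_closed[OF v] by (simp add: K_def)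
    obtain s1 s2 where s: "s1 \<in> carrier (Hom C (mid_ob T) rx)" "s2 \<in> carrier (Hom C (cor_ob T) x)"
      and vs: "Comp C (mid_ob T) P x v p1 = Comp C (mid_ob T) rx x s1 \<rho>x
        \<otimes>\<^bsub>Hom C (mid_ob T) x\<^esub> Comp C (mid_ob T) (cor_ob T) x (cor_mor T) s2"
      using vp by (elim adel_nullE) (auto simp: Xe)
    have "v = Comp C (mid_ob T) P P v (Comp C P x P p1 i1 \<otimes>\<^bsub>Hom C P P\<^esub> Comp C P ry P p2 i2)"
      using P by (simp add: is_biproduct_def)
    also have "\<dots> = Comp C (mid_ob T) x P (Comp C (mid_ob T) P x v p1) i1
        \<otimes>\<^bsub>Hom C (mid_ob T) P\<^esub> Comp C (mid_ob T) ry P (Comp C (mid_ob T) P ry v p2) i2"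
      by (simp add: Comp_add Comp_assoc)
    finally have v': "v = \<dots>" .
    show ?thesis
      by (rule adel_nullI[where ?\<sigma>1.0 = "Comp C (mid_ob T) rx R s1 ii1 \<otimes>\<^bsub>Hom C (mid_ob T) R\<^esub>
              Comp C (mid_ob T) ry R (Comp C (mid_ob T) P ry v p2) ii2"
            and ?\<sigma>2.0 = "Comp C (cor_ob T) x P s2 i1"])
         (use v s in \<open>simp_all add: K_def, subst v', simp add: vs add_Comp Comp_assoc i\<rho>k add_ac\<close>)
  qed
  \<comment> \<open>A homotopy that annihilates \<open>t \<cdot> \<phi>\<close> has a component into the relation object of \<open>Y\<close>; with
    the opposite sign it is the second coordinate of the lift of \<open>t\<close>.\<close>
  have lift: "\<exists>u\<in>carrier (adel_data C T K). Comp C (mid_ob T) P x u p1 = t"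
    if T: "T \<in> adel_objects C" and t: "t \<in> carrier (adel_data C T X)"
      and t\<phi>: "Comp C (mid_ob T) x y t \<phi> \<in> adel_null C T Y" for T t
  proof -
    note [simp] = adel_objectsD[OF T]
    obtain \<omega> \<psi> where w: "t \<in> carrier (Hom C (mid_ob T) x)"
      "\<omega> \<in> carrier (Hom C (rel_ob T) rx)" "\<psi> \<in> carrier (Hom C (cor_ob T) cx)"
      and t\<rho>: "Comp C (rel_ob T) (mid_ob T) x (rel_mor T) t = Comp C (rel_ob T) rx x \<omega> \<rho>x"
      and t\<gamma>: "Comp C (mid_ob T) (cor_ob T) cx (cor_mor T) \<psi> = Comp C (mid_ob T) x cx t \<gamma>x"
      using t by (elim adel_dataE) (auto simp: Xe)
    obtain s1 s2 where s: "s1 \<in> carrier (Hom C (mid_ob T) ry)" "s2 \<in> carrier (Hom C (cor_ob T) y)"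
      and ts: "Comp C (mid_ob T) x y t \<phi> = Comp C (mid_ob T) ry y s1 \<rho>y
        \<otimes>\<^bsub>Hom C (mid_ob T) y\<^esub> Comp C (mid_ob T) (cor_ob T) y (cor_mor T) s2"
      using t\<phi> by (elim adel_nullE) (auto simp: Ye)
    define u where "u = Comp C (mid_ob T) x P t i1 \<otimes>\<^bsub>Hom C (mid_ob T) P\<^esub>
      inv\<^bsub>Hom C (mid_ob T) P\<^esub> Comp C (mid_ob T) ry P s1 i2"
    have [simp]: "u \<in> carrier (Hom C (mid_ob T) P)" using w s by (simp add: u_def)
    have up: "Comp C (mid_ob T) P x u p1 = t"
      using w s by (simp add: u_def add_Comp Comp_assoc)
    have "u \<in> carrier (adel_data C T K)"
    proof (rule adel_dataI)
      show "Comp C (rel_ob T) rx R \<omega> ii1 \<otimes>\<^bsub>Hom C (rel_ob T) R\<^esub>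
          inv\<^bsub>Hom C (rel_ob T) R\<^esub> Comp C (rel_ob T) ry R (Comp C (rel_ob T) (mid_ob T) ry (rel_mor T) s1) ii2
          \<in> carrier (Hom C (rel_ob T) (rel_ob K))"
        "Comp C (cor_ob T) cx Q \<psi> j1 \<otimes>\<^bsub>Hom C (cor_ob T) Q\<^esub> Comp C (cor_ob T) y Q s2 j2
          \<in> carrier (Hom C (cor_ob T) (cor_ob K))"
        using w s by (simp_all add: K_def)
      show "Comp C (rel_ob T) (mid_ob T) (mid_ob K) (rel_mor T) u =
        Comp C (rel_ob T) (rel_ob K) (mid_ob K) (Comp C (rel_ob T) rx R \<omega> ii1 \<otimes>\<^bsub>Hom C (rel_ob T) R\<^esub>
          inv\<^bsub>Hom C (rel_ob T) R\<^esub> Comp C (rel_ob T) ry R (Comp C (rel_ob T) (mid_ob T) ry (rel_mor T) s1) ii2)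
        (rel_mor K)"
      proof -
        have "Comp C (rel_ob T) (mid_ob T) P (rel_mor T) (Comp C (mid_ob T) x P t i1)
          = Comp C (rel_ob T) rx P \<omega> (Comp C rx x P \<rho>x i1)"
          using w by (simp add: t\<rho> flip: Comp_assoc)
        then show ?thesis
          using w s by (simp add: K_def u_def Comp_add add_Comp Comp_assoc i\<rho>k)
      qed
      show "Comp C (mid_ob T) (cor_ob T) (cor_ob K) (cor_mor T)
          (Comp C (cor_ob T) cx Q \<psi> j1 \<otimes>\<^bsub>Hom C (cor_ob T) Q\<^esub> Comp C (cor_ob T) y Q s2 j2)
        = Comp C (mid_ob T) (mid_ob K) (cor_ob K) u (cor_mor K)"
      proof -
        have a: "Comp C (mid_ob T) (cor_ob T) Q (cor_mor T) (Comp C (cor_ob T) cx Q \<psi> j1)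
          = Comp C (mid_ob T) x Q t (Comp C x cx Q \<gamma>x j1)"
          using w by (simp add: t\<gamma> flip: Comp_assoc)
        have b: "Comp C (mid_ob T) x Q t (Comp C x y Q \<phi> j2)
          = Comp C (mid_ob T) ry Q s1 (Comp C ry y Q \<rho>y j2) \<otimes>\<^bsub>Hom C (mid_ob T) Q\<^esub>
            Comp C (mid_ob T) (cor_ob T) Q (cor_mor T) (Comp C (cor_ob T) y Q s2 j2)"
          using w s Comp_assoc[of "mid_ob T" x y Q t \<phi> j2]
          by (simp add: ts add_Comp Comp_assoc)
        have "Comp C (mid_ob T) P Q u \<gamma>k =
          Comp C (mid_ob T) x Q t (Comp C x cx Q \<gamma>x j1) \<otimes>\<^bsub>Hom C (mid_ob T) Q\<^esub>
            (Comp C (mid_ob T) x Q t (Comp C x y Q \<phi> j2)) \<otimes>\<^bsub>Hom C (mid_ob T) Q\<^esub>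
            inv\<^bsub>Hom C (mid_ob T) Q\<^esub> Comp C (mid_ob T) ry Q s1 (Comp C ry y Q \<rho>y j2)"
          using w s by (simp add: u_def Comp_add add_Comp Comp_assoc i\<gamma>k)
        then show ?thesis
          using w s by (simp add: K_def Comp_add a b add_ac)
      qed
    qed (simp add: K_def)
    with up show ?thesis by blast
  qed
  have mid: "mid_ob K = P" "mid_ob X = x" "mid_ob Y = y" by (simp_all add: K_def Xe Ye)
  show ?thesis
  proof (rule that[OF K p1])
    show "is_kernel (Adel C) X Y (adel_class C X Y \<phi>) K (adel_class C K X p1)"
      unfolding is_kernel_def
    proof (intro conjI ballI impI)
      show "K \<in> Ob (Adel C)" using K by simp
      show "adel_class C K X p1 \<in> carrier (Hom (Adel C) K X)"
        using p1 by (rule adel_class_closed)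
      show "Comp (Adel C) K X Y (adel_class C K X p1) (adel_class C X Y \<phi>) = zero_mor (Adel C) K Y"
        using p1\<phi> K X Y p1 \<phi> adel_data_Comp[OF K X Y p1 \<phi>]
        by (simp add: adel_class_Comp adel_class_eq_zero_iff mid)
      fix T t
      assume "T \<in> Ob (Adel C)" and "t \<in> carrier (Hom (Adel C) T X)"
        and t0: "Comp (Adel C) T X Y t (adel_class C X Y \<phi>) = zero_mor (Adel C) T Y"
      then have T: "T \<in> adel_objects C" by simp
      obtain t' where t': "t' \<in> carrier (adel_data C T X)" "t = adel_class C T X t'"
        using \<open>t \<in> carrier (Hom (Adel C) T X)\<close> by (rule Adel_Hom_cases)
      have "Comp C (mid_ob T) x y t' \<phi> \<in> adel_null C T Y"
        using t0 t' T X Y \<phi> adel_data_Comp[OF T X Y t'(1) \<phi>]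
        by (simp add: adel_class_Comp adel_class_eq_zero_iff mid)
      then obtain u' where u': "u' \<in> carrier (adel_data C T K)" "Comp C (mid_ob T) P x u' p1 = t'"
        using lift[OF T t'(1)] by blast
      show "\<exists>!u. u \<in> carrier (Hom (Adel C) T K) \<and> Comp (Adel C) T K X u (adel_class C K X p1) = t"
      proof (rule ex1I[where a = "adel_class C T K u'"])
        show "adel_class C T K u' \<in> carrier (Hom (Adel C) T K) \<and>
            Comp (Adel C) T K X (adel_class C T K u') (adel_class C K X p1) = t"
          using u' t' T K X p1 by (simp add: adel_class_closed adel_class_Comp mid)
        fix v assume v: "v \<in> carrier (Hom (Adel C) T K) \<and> Comp (Adel C) T K X v (adel_class C K X p1) = t"
        then obtain v' where v': "v' \<in> carrier (adel_data C T K)" "v = adel_class C T K v'"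
          by (auto elim: Adel_Hom_cases)
        define w where "w = v' \<otimes>\<^bsub>Hom C (mid_ob T) P\<^esub> inv\<^bsub>Hom C (mid_ob T) P\<^esub> u'"
        have w: "w \<in> carrier (adel_data C T K)"
          using subgroup.m_closed[OF adel_data_subgroup[OF T K]]
            adel_data_neg[OF T K u'(1)] v' by (simp add: w_def mid)
        have cl: "v' \<in> carrier (Hom C (mid_ob T) P)" "u' \<in> carrier (Hom C (mid_ob T) P)"
          using adel_data_closed[OF v'(1)] adel_data_closed[OF u'(1)] by (simp_all add: K_def)
        have "adel_class C T X (Comp C (mid_ob T) P x v' p1) = adel_class C T X t'"
          using v v' t' T K X p1 by (simp add: adel_class_Comp mid)
        then have "Comp C (mid_ob T) P x w p1 \<in> adel_null C T X"
          using T X K adel_data_Comp[OF T K X v'(1) p1] t'(1) u'(2) cl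
          by (simp add: adel_class_eq_iff mid w_def add_Comp adel_objectsD)
        then have "w \<in> adel_null C T K" by (rule mono[OF T w])
        then show "v = adel_class C T K u'"
          using T K v' u' by (simp add: adel_class_eq_iff w_def mid)
      qed
    qed
  next
    fix T t
    assume T: "T \<in> adel_objects C" and t: "t \<in> carrier (adel_data C X T)"
      and "Comp C (mid_ob K) (mid_ob X) (mid_ob T) p1 t \<in> adel_null C K T"
    then have n: "Comp C P x (mid_ob T) p1 t \<in> adel_null C K T" by (simp add: mid)
    note [simp] = adel_objectsD[OF T]
    have [simp]: "t \<in> carrier (Hom C x (mid_ob T))" using adel_data_closed[OF t] by (simp add: mid)
    obtain s1 s2 where s [simp]: "s1 \<in> carrier (Hom C P (rel_ob T))" "s2 \<in> carrier (Hom C Q (mid_ob T))"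
      and ts: "Comp C P x (mid_ob T) p1 t = Comp C P (rel_ob T) (mid_ob T) s1 (rel_mor T)
        \<otimes>\<^bsub>Hom C P (mid_ob T)\<^esub> Comp C P Q (mid_ob T) \<gamma>k s2"
      using n by (elim adel_nullE) (auto simp: K_def)
    have "t = Comp C x P (mid_ob T) i1 (Comp C P x (mid_ob T) p1 t)" by simp
    also have "\<dots> = Comp C x (rel_ob T) (mid_ob T) (Comp C x P (rel_ob T) i1 s1) (rel_mor T)
      \<otimes>\<^bsub>Hom C x (mid_ob T)\<^esub> Comp C x Q (mid_ob T) (Comp C x P Q i1 \<gamma>k) s2"
      by (simp only: ts) (simp add: Comp_add Comp_assoc)
    also have "\<dots> = (Comp C x (rel_ob T) (mid_ob T) (Comp C x P (rel_ob T) i1 s1) (rel_mor T)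
        \<otimes>\<^bsub>Hom C x (mid_ob T)\<^esub> Comp C x cx (mid_ob T) \<gamma>x (Comp C cx Q (mid_ob T) j1 s2))
        \<otimes>\<^bsub>Hom C x (mid_ob T)\<^esub> Comp C x y (mid_ob T) \<phi> (Comp C y Q (mid_ob T) j2 s2)"
      by (simp add: i\<gamma>k add_Comp Comp_assoc add_assoc)
    finally have t1: "t = \<dots>" .
    have "zero_mor C ry (mid_ob T) = Comp C ry P (mid_ob T) i2 (Comp C P x (mid_ob T) p1 t)" by simp
    also have "\<dots> = Comp C ry (rel_ob T) (mid_ob T) (Comp C ry P (rel_ob T) i2 s1) (rel_mor T)
      \<otimes>\<^bsub>Hom C ry (mid_ob T)\<^esub> Comp C ry Q (mid_ob T) (Comp C ry P Q i2 \<gamma>k) s2"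
      by (simp only: ts) (simp add: Comp_add Comp_assoc)
    also have "\<dots> = Comp C ry (rel_ob T) (mid_ob T) (Comp C ry P (rel_ob T) i2 s1) (rel_mor T)
      \<otimes>\<^bsub>Hom C ry (mid_ob T)\<^esub> Comp C ry y (mid_ob T) \<rho>y (Comp C y Q (mid_ob T) j2 s2)"
      by (simp add: i\<gamma>k Comp_assoc)
    finally have t0: "zero_mor C ry (mid_ob T) = \<dots>" .
    have "Comp C ry y (mid_ob T) \<rho>y (Comp C y Q (mid_ob T) j2 s2)
      = inv\<^bsub>Hom C ry (mid_ob T)\<^esub> Comp C ry (rel_ob T) (mid_ob T) (Comp C ry P (rel_ob T) i2 s1) (rel_mor T)
        \<otimes>\<^bsub>Hom C ry (mid_ob T)\<^esub>
        (Comp C ry (rel_ob T) (mid_ob T) (Comp C ry P (rel_ob T) i2 s1) (rel_mor T)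
        \<otimes>\<^bsub>Hom C ry (mid_ob T)\<^esub> Comp C ry y (mid_ob T) \<rho>y (Comp C y Q (mid_ob T) j2 s2))"
      by simp
    then have t2: "Comp C ry y (mid_ob T) \<rho>y (Comp C y Q (mid_ob T) j2 s2)
      = Comp C ry (rel_ob T) (mid_ob T) (inv\<^bsub>Hom C ry (rel_ob T)\<^esub> Comp C ry P (rel_ob T) i2 s1) (rel_mor T)"
      by (simp only: t0[symmetric]) simp
    show "\<exists>a\<in>carrier (Hom C (mid_ob X) (rel_ob T)). \<exists>b\<in>carrier (Hom C (cor_ob X) (mid_ob T)).
          \<exists>e\<in>carrier (Hom C (mid_ob Y) (mid_ob T)). \<exists>h\<in>carrier (Hom C (rel_ob Y) (rel_ob T)).
            t = (Comp C (mid_ob X) (rel_ob T) (mid_ob T) a (rel_mor T)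
                  \<otimes>\<^bsub>Hom C (mid_ob X) (mid_ob T)\<^esub>
                 Comp C (mid_ob X) (cor_ob X) (mid_ob T) (cor_mor X) b)
                  \<otimes>\<^bsub>Hom C (mid_ob X) (mid_ob T)\<^esub>
                 Comp C (mid_ob X) (mid_ob Y) (mid_ob T) \<phi> e \<and>
            Comp C (rel_ob Y) (mid_ob Y) (mid_ob T) (rel_mor Y) e =
            Comp C (rel_ob Y) (rel_ob T) (mid_ob T) h (rel_mor T)"
      using t1 t2
      by (intro bexI[where x = "Comp C x P (rel_ob T) i1 s1"] bexI[where x = "Comp C cx Q (mid_ob T) j1 s2"]
          bexI[where x = "Comp C y Q (mid_ob T) j2 s2"]
          bexI[where x = "inv\<^bsub>Hom C ry (rel_ob T)\<^esub> Comp C ry P (rel_ob T) i2 s1"])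
         (simp_all add: Xe Ye)
  qed
qed

end


text \<open>The generalized element \<open>t : T \<rightarrow> Y\<close> is congruent to \<open>e \<cdot> \<phi>\<close> where \<open>e\<close> maps the kernel of the
  corelation of \<open>T\<close> to the kernel of the corelation of \<open>X\<close>. The morphism \<open>e\<close> itself need not be a
  morphism \<open>T \<rightarrow> X\<close>, since it may fail to respect the relations; this is the difference between
  factoring through the image of \<open>{\<phi>}\<close> and factoring through \<open>{\<phi>}\<close>.\<close>

definition in_image ::
    "('o, 'm) lincat \<Rightarrow> ('o, 'm) adel_obj \<Rightarrow> 'm \<Rightarrow> ('o, 'm) adel_obj \<Rightarrow> ('o, 'm) adel_obj \<Rightarrow> 'm \<Rightarrow> bool" where
  "in_image C X \<phi> Y T t \<longleftrightarrow>
     (\<exists>a\<in>carrier (Hom C (mid_ob T) (rel_ob Y)). \<exists>b\<in>carrier (Hom C (cor_ob T) (mid_ob Y)).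
      \<exists>e\<in>carrier (Hom C (mid_ob T) (mid_ob X)). \<exists>h\<in>carrier (Hom C (cor_ob T) (cor_ob X)).
        t = (Comp C (mid_ob T) (rel_ob Y) (mid_ob Y) a (rel_mor Y)
              \<otimes>\<^bsub>Hom C (mid_ob T) (mid_ob Y)\<^esub>
             Comp C (mid_ob T) (cor_ob T) (mid_ob Y) (cor_mor T) b)
              \<otimes>\<^bsub>Hom C (mid_ob T) (mid_ob Y)\<^esub>
             Comp C (mid_ob T) (mid_ob X) (mid_ob Y) e \<phi> \<and>
        Comp C (mid_ob T) (mid_ob X) (cor_ob X) e (cor_mor X) =
        Comp C (mid_ob T) (cor_ob T) (cor_ob X) (cor_mor T) h)"

lemma in_imageI:
  assumes "a \<in> carrier (Hom C (mid_ob T) (rel_ob Y))" "b \<in> carrier (Hom C (cor_ob T) (mid_ob Y))"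
    "e \<in> carrier (Hom C (mid_ob T) (mid_ob X))" "h \<in> carrier (Hom C (cor_ob T) (cor_ob X))"
    "t = (Comp C (mid_ob T) (rel_ob Y) (mid_ob Y) a (rel_mor Y)
              \<otimes>\<^bsub>Hom C (mid_ob T) (mid_ob Y)\<^esub>
             Comp C (mid_ob T) (cor_ob T) (mid_ob Y) (cor_mor T) b)
              \<otimes>\<^bsub>Hom C (mid_ob T) (mid_ob Y)\<^esub>
             Comp C (mid_ob T) (mid_ob X) (mid_ob Y) e \<phi>"
    "Comp C (mid_ob T) (mid_ob X) (cor_ob X) e (cor_mor X) =
     Comp C (mid_ob T) (cor_ob T) (cor_ob X) (cor_mor T) h"
  shows "in_image C X \<phi> Y T t"
  using assms unfolding in_image_def by blast

context biproduct_category
begin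

text \<open>This is \<open>adel_kernel\<close> in the opposite category.\<close>

lemma adel_cokernel:
  assumes X: "X \<in> adel_objects C" and Y: "Y \<in> adel_objects C"
    and \<phi>: "\<phi> \<in> carrier (adel_data C X Y)"
  obtains Q q where "Q \<in> adel_objects C" "q \<in> carrier (adel_data C Y Q)"
    "is_cokernel (Adel C) X Y (adel_class C X Y \<phi>) Q (adel_class C Y Q q)"
    "\<And>T t. \<lbrakk>T \<in> adel_objects C; t \<in> carrier (adel_data C T Y);
        Comp C (mid_ob T) (mid_ob Y) (mid_ob Q) t q \<in> adel_null C T Q\<rbrakk>
      \<Longrightarrow> in_image C X \<phi> Y T t"
proof -
  interpret op: biproduct_category "opposite C" by (rule biproduct_category_opposite)
  have "flip_adel Y \<in> adel_objects (opposite C)" "flip_adel X \<in> adel_objects (opposite C)"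
    "\<phi> \<in> carrier (adel_data (opposite C) (flip_adel Y) (flip_adel X))"
    using X Y \<phi> by (simp_all add: adel_objects_opposite adel_data_opposite)
  then obtain K q where K: "K \<in> adel_objects (opposite C)"
    and q: "q \<in> carrier (adel_data (opposite C) K (flip_adel Y))"
    and ker: "is_kernel (Adel (opposite C)) (flip_adel Y) (flip_adel X)
      (adel_class (opposite C) (flip_adel Y) (flip_adel X) \<phi>) K (adel_class (opposite C) K (flip_adel Y) q)"
    and im: "\<And>T t. \<lbrakk>T \<in> adel_objects (opposite C); t \<in> carrier (adel_data (opposite C) (flip_adel Y) T);
        Comp (opposite C) (mid_ob K) (mid_ob (flip_adel Y)) (mid_ob T) q t \<in> adel_null (opposite C) K T\<rbrakk>
      \<Longrightarrow> \<exists>a\<in>carrier (Hom (opposite C) (mid_ob (flip_adel Y)) (rel_ob T)).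
          \<exists>b\<in>carrier (Hom (opposite C) (cor_ob (flip_adel Y)) (mid_ob T)).
          \<exists>e\<in>carrier (Hom (opposite C) (mid_ob (flip_adel X)) (mid_ob T)).
          \<exists>h\<in>carrier (Hom (opposite C) (rel_ob (flip_adel X)) (rel_ob T)).
            t = (Comp (opposite C) (mid_ob (flip_adel Y)) (rel_ob T) (mid_ob T) a (rel_mor T)
                  \<otimes>\<^bsub>Hom (opposite C) (mid_ob (flip_adel Y)) (mid_ob T)\<^esub>
                 Comp (opposite C) (mid_ob (flip_adel Y)) (cor_ob (flip_adel Y)) (mid_ob T)
                   (cor_mor (flip_adel Y)) b)
                  \<otimes>\<^bsub>Hom (opposite C) (mid_ob (flip_adel Y)) (mid_ob T)\<^esub>
                 Comp (opposite C) (mid_ob (flip_adel Y)) (mid_ob (flip_adel X)) (mid_ob T) \<phi> e \<and>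
            Comp (opposite C) (rel_ob (flip_adel X)) (mid_ob (flip_adel X)) (mid_ob T)
              (rel_mor (flip_adel X)) e =
            Comp (opposite C) (rel_ob (flip_adel X)) (rel_ob T) (mid_ob T) h (rel_mor T)"
    by (rule op.adel_kernel) blast
  define Q where "Q = flip_adel K"
  have K_eq: "K = flip_adel Q" by (simp add: Q_def)
  have Q: "Q \<in> adel_objects C" using K by (simp add: K_eq adel_objects_opposite)
  have q': "q \<in> carrier (adel_data C Y Q)" using q by (simp add: K_eq adel_data_opposite)
  show ?thesis
  proof (rule that[OF Q q'])
    show "is_cokernel (Adel C) X Y (adel_class C X Y \<phi>) Q (adel_class C Y Q q)"
      using ker X Y Q by (intro is_cokernel_Adel_if_kernel_opposite) (simp_all add: K_eq adel_class_opposite)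
    fix T t
    assume T: "T \<in> adel_objects C" and t: "t \<in> carrier (adel_data C T Y)"
      and tq: "Comp C (mid_ob T) (mid_ob Y) (mid_ob Q) t q \<in> adel_null C T Q"
    note [simp] = adel_objectsD[OF T] adel_objectsD[OF X] adel_objectsD[OF Y]
      adel_data_closed[OF \<phi>]
    obtain a b e h where
      "a \<in> carrier (Hom C (cor_ob T) (mid_ob Y))" "b \<in> carrier (Hom C (mid_ob T) (rel_ob Y))"
      "e \<in> carrier (Hom C (mid_ob T) (mid_ob X))" "h \<in> carrier (Hom C (cor_ob T) (cor_ob X))"
      "t = (Comp C (mid_ob T) (cor_ob T) (mid_ob Y) (cor_mor T) a
              \<otimes>\<^bsub>Hom C (mid_ob T) (mid_ob Y)\<^esub>
             Comp C (mid_ob T) (rel_ob Y) (mid_ob Y) b (rel_mor Y))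
              \<otimes>\<^bsub>Hom C (mid_ob T) (mid_ob Y)\<^esub>
             Comp C (mid_ob T) (mid_ob X) (mid_ob Y) e \<phi>"
      "Comp C (mid_ob T) (mid_ob X) (cor_ob X) e (cor_mor X) =
       Comp C (mid_ob T) (cor_ob T) (cor_ob X) (cor_mor T) h"
      using im[of "flip_adel T" t] T t tq Q Y
      by (auto simp: K_eq adel_objects_opposite adel_data_opposite adel_null_opposite)
    then show "in_image C X \<phi> Y T t"
      by (intro in_imageI[where a = b and b = a and e = e and h = h]) (simp_all add: add_comm)
  qed
qed

text \<open>Let \<open>q\<close> be the cokernel of \<open>{\<phi>}\<close>. Then \<open>in_image\<close> holds for \<open>t\<close> precisely if \<open>t \<cdot> q\<close> is zero, so
  the right-hand side says that \<open>q\<close> and \<open>{\<chi>}\<close> have the same annihilators on the left. This makes any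
  kernel of \<open>q\<close> a kernel of \<open>{\<chi>}\<close>. Conversely, if one object is a kernel of both \<open>{\<chi>}\<close> and some
  cokernel of \<open>{\<phi>}\<close>, then a morphism annihilated by \<open>{\<chi>}\<close> factors through that object and is
  annihilated by every cokernel, in particular by \<open>q\<close>.\<close>

lemma adel_exact_iff:
  assumes X: "X \<in> adel_objects C" and Y: "Y \<in> adel_objects C" and Z: "Z \<in> adel_objects C"
    and \<phi>: "\<phi> \<in> carrier (adel_data C X Y)" and \<chi>: "\<chi> \<in> carrier (adel_data C Y Z)"
  shows "exact_at (Adel C) X (adel_class C X Y \<phi>) Y (adel_class C Y Z \<chi>) Z \<longleftrightarrow>
    Comp C (mid_ob X) (mid_ob Y) (mid_ob Z) \<phi> \<chi> \<in> adel_null C X Z \<and>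
    (\<forall>T\<in>adel_objects C. \<forall>t\<in>carrier (adel_data C T Y).
      Comp C (mid_ob T) (mid_ob Y) (mid_ob Z) t \<chi> \<in> adel_null C T Z \<longrightarrow> in_image C X \<phi> Y T t)"
    (is "?exact \<longleftrightarrow> ?null \<and> ?im")
proof -
  interpret A: lin_category "Adel C" by (rule lin_category_Adel)
  let ?f = "adel_class C X Y \<phi>" and ?g = "adel_class C Y Z \<chi>"
  have f: "?f \<in> carrier (Hom (Adel C) X Y)" and g: "?g \<in> carrier (Hom (Adel C) Y Z)"
    using \<phi> \<chi> by (simp_all add: adel_class_closed)
  have comp_zero_iff: "Comp (Adel C) S T U (adel_class C S T s) (adel_class C T U t) = zero_mor (Adel C) S U
      \<longleftrightarrow> Comp C (mid_ob S) (mid_ob T) (mid_ob U) s t \<in> adel_null C S U"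
    if "S \<in> adel_objects C" "T \<in> adel_objects C" "U \<in> adel_objects C"
      "s \<in> carrier (adel_data C S T)" "t \<in> carrier (adel_data C T U)" for S T U s t
    using that by (simp add: adel_class_Comp adel_class_eq_zero_iff adel_data_Comp)
  obtain Q q where Q: "Q \<in> adel_objects C" and q: "q \<in> carrier (adel_data C Y Q)"
    and coker: "is_cokernel (Adel C) X Y ?f Q (adel_class C Y Q q)"
    and im_if: "\<And>T t. \<lbrakk>T \<in> adel_objects C; t \<in> carrier (adel_data C T Y);
        Comp C (mid_ob T) (mid_ob Y) (mid_ob Q) t q \<in> adel_null C T Q\<rbrakk> \<Longrightarrow> in_image C X \<phi> Y T t"
    using adel_cokernel[OF X Y \<phi>] by blast
  have q_cls: "adel_class C Y Q q \<in> carrier (Hom (Adel C) Y Q)"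
    using q by (rule adel_class_closed)
  have fq: "Comp (Adel C) X Y Q ?f (adel_class C Y Q q) = zero_mor (Adel C) X Q"
    using coker by (simp add: is_cokernel_def)
  have if_im: "Comp C (mid_ob T) (mid_ob Y) (mid_ob Q) t q \<in> adel_null C T Q"
    if T: "T \<in> adel_objects C" and t: "t \<in> carrier (adel_data C T Y)" and im: "in_image C X \<phi> Y T t"
    for T t
  proof -
    note [simp] = adel_objectsD[OF T] adel_objectsD[OF X] adel_objectsD[OF Y] adel_objectsD[OF Q]
      adel_data_closed[OF \<phi>]
    obtain a b e h where [simp]: "a \<in> carrier (Hom C (mid_ob T) (rel_ob Y))"
      "b \<in> carrier (Hom C (cor_ob T) (mid_ob Y))"
      "e \<in> carrier (Hom C (mid_ob T) (mid_ob X))" "h \<in> carrier (Hom C (cor_ob T) (cor_ob X))"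
      and t_eq: "t = (Comp C (mid_ob T) (rel_ob Y) (mid_ob Y) a (rel_mor Y)
              \<otimes>\<^bsub>Hom C (mid_ob T) (mid_ob Y)\<^esub>
             Comp C (mid_ob T) (cor_ob T) (mid_ob Y) (cor_mor T) b)
              \<otimes>\<^bsub>Hom C (mid_ob T) (mid_ob Y)\<^esub>
             Comp C (mid_ob T) (mid_ob X) (mid_ob Y) e \<phi>"
      and eh: "Comp C (mid_ob T) (mid_ob X) (cor_ob X) e (cor_mor X) =
        Comp C (mid_ob T) (cor_ob T) (cor_ob X) (cor_mor T) h"
      using im unfolding in_image_def by blast
    obtain \<omega> where [simp]: "q \<in> carrier (Hom C (mid_ob Y) (mid_ob Q))"
      "\<omega> \<in> carrier (Hom C (rel_ob Y) (rel_ob Q))"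
      and q\<rho>: "Comp C (rel_ob Y) (mid_ob Y) (mid_ob Q) (rel_mor Y) q =
         Comp C (rel_ob Y) (rel_ob Q) (mid_ob Q) \<omega> (rel_mor Q)"
      using q by (elim adel_dataE)
    have "Comp C (mid_ob X) (mid_ob Y) (mid_ob Q) \<phi> q \<in> adel_null C X Q"
      using fq comp_zero_iff[OF X Y Q \<phi> q] by simp
    then obtain s1 s2 where [simp]: "s1 \<in> carrier (Hom C (mid_ob X) (rel_ob Q))"
      "s2 \<in> carrier (Hom C (cor_ob X) (mid_ob Q))"
      and \<phi>q: "Comp C (mid_ob X) (mid_ob Y) (mid_ob Q) \<phi> q =
        Comp C (mid_ob X) (rel_ob Q) (mid_ob Q) s1 (rel_mor Q) \<otimes>\<^bsub>Hom C (mid_ob X) (mid_ob Q)\<^esub>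
        Comp C (mid_ob X) (cor_ob X) (mid_ob Q) (cor_mor X) s2"
      by (rule adel_nullE)
    have eh': "Comp C (mid_ob T) (mid_ob X) (mid_ob Q) e (Comp C (mid_ob X) (cor_ob X) (mid_ob Q) (cor_mor X) s2)
      = Comp C (mid_ob T) (cor_ob T) (mid_ob Q) (cor_mor T) (Comp C (cor_ob T) (cor_ob X) (mid_ob Q) h s2)"
      by (simp add: eh flip: Comp_assoc)
    show ?thesis
      by (rule adel_nullI[OF adel_data_Comp[OF T Y Q t q],
            where ?\<sigma>1.0 = "Comp C (mid_ob T) (rel_ob Y) (rel_ob Q) a \<omega> \<otimes>\<^bsub>Hom C (mid_ob T) (rel_ob Q)\<^esub>
              Comp C (mid_ob T) (mid_ob X) (rel_ob Q) e s1"
            and ?\<sigma>2.0 = "Comp C (cor_ob T) (mid_ob Y) (mid_ob Q) b q \<otimes>\<^bsub>Hom C (cor_ob T) (mid_ob Q)\<^esub>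
              Comp C (cor_ob T) (cor_ob X) (mid_ob Q) h s2"])
         (simp_all add: t_eq add_Comp Comp_add Comp_assoc q\<rho> \<phi>q eh' add_ac)
  qed
  show ?thesis
  proof
    assume ?exact
    then obtain I i where "is_image (Adel C) X Y ?f I i" and ker: "is_kernel (Adel C) Y Z ?g I i"
      by (auto simp: exact_at_def)
    then obtain Q' q' where coker': "is_cokernel (Adel C) X Y ?f Q' q'" and ker': "is_kernel (Adel C) Y Q' q' I i"
      by (auto simp: is_image_def)
    have I: "I \<in> adel_objects C" "i \<in> carrier (Hom (Adel C) I Y)"
      and Q': "Q' \<in> adel_objects C" "q' \<in> carrier (Hom (Adel C) Y Q')"
      using ker coker' by (simp_all add: is_kernel_def is_cokernel_def)
    have "\<exists>u. u \<in> carrier (Hom (Adel C) X I) \<and> Comp (Adel C) X I Y u i = ?f"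
      using ker' coker' X f unfolding is_kernel_def is_cokernel_def by (metis Adel_Ob)
    then obtain u where u: "u \<in> carrier (Hom (Adel C) X I)" "Comp (Adel C) X I Y u i = ?f" by blast
    have "Comp (Adel C) X Y Z ?f ?g = zero_mor (Adel C) X Z"
      using u I X Y Z g ker A.Comp_assoc[of X I Y Z u i ?g] by (simp add: is_kernel_def)
    then have ?null using comp_zero_iff[OF X Y Z \<phi> \<chi>] by simp
    moreover have ?im
    proof (intro ballI impI)
      fix T t
      assume T: "T \<in> adel_objects C" and t: "t \<in> carrier (adel_data C T Y)"
        and "Comp C (mid_ob T) (mid_ob Y) (mid_ob Z) t \<chi> \<in> adel_null C T Z"
      then have tg: "Comp (Adel C) T Y Z (adel_class C T Y t) ?g = zero_mor (Adel C) T Z"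
        using comp_zero_iff[OF T Y Z t \<chi>] by simp
      have tc: "adel_class C T Y t \<in> carrier (Hom (Adel C) T Y)" using t by (rule adel_class_closed)
      then have "\<exists>v. v \<in> carrier (Hom (Adel C) T I) \<and> Comp (Adel C) T I Y v i = adel_class C T Y t"
        using ker T tg unfolding is_kernel_def by (metis Adel_Ob)
      then obtain v where v: "v \<in> carrier (Hom (Adel C) T I)" "Comp (Adel C) T I Y v i = adel_class C T Y t"
        by blast
      have "\<exists>w. w \<in> carrier (Hom (Adel C) Q' Q) \<and> Comp (Adel C) Y Q' Q q' w = adel_class C Y Q q"
        using coker' Q q_cls fq unfolding is_cokernel_def by (metis Adel_Ob)
      then obtain w where w: "w \<in> carrier (Hom (Adel C) Q' Q)" "Comp (Adel C) Y Q' Q q' w = adel_class C Y Q q"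
        by blast
      have "Comp (Adel C) T Y Q' (adel_class C T Y t) q' = zero_mor (Adel C) T Q'"
        using v I T Y Q' ker' A.Comp_assoc[of T I Y Q' v i q'] by (simp add: is_kernel_def)
      then have "Comp (Adel C) T Y Q (adel_class C T Y t) (adel_class C Y Q q) = zero_mor (Adel C) T Q"
        using A.Comp_assoc[of T Y Q' Q "adel_class C T Y t" q' w] T Y Q Q' tc w by simp
      then show "in_image C X \<phi> Y T t"
        using comp_zero_iff[OF T Y Q t q] im_if[OF T t] by simp
    qed
    ultimately show "?null \<and> ?im" ..
  next
    assume as: "?null \<and> ?im"
    obtain I i where I: "I \<in> adel_objects C" "i \<in> carrier (adel_data C I Y)"
      and ker: "is_kernel (Adel C) Y Q (adel_class C Y Q q) I (adel_class C I Y i)"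
      using adel_kernel[OF Y Q q] by metis
    have ic: "adel_class C I Y i \<in> carrier (Hom (Adel C) I Y)" using I(2) by (rule adel_class_closed)
    have "Comp (Adel C) X Y Z ?f ?g = zero_mor (Adel C) X Z"
      using as comp_zero_iff[OF X Y Z \<phi> \<chi>] by simp
    then have "\<exists>u. u \<in> carrier (Hom (Adel C) Q Z) \<and> Comp (Adel C) Y Q Z (adel_class C Y Q q) u = ?g"
      using coker Z g unfolding is_cokernel_def by (metis Adel_Ob)
    then obtain u where u: "u \<in> carrier (Hom (Adel C) Q Z)"
      "Comp (Adel C) Y Q Z (adel_class C Y Q q) u = ?g" by blast
    have ker_g: "is_kernel (Adel C) Y Z ?g I (adel_class C I Y i)"
      unfolding is_kernel_def
    proof (intro conjI ballI impI)
      show "I \<in> Ob (Adel C)" "adel_class C I Y i \<in> carrier (Hom (Adel C) I Y)" using I ic by simp_all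
      have "Comp (Adel C) I Y Q (adel_class C I Y i) (adel_class C Y Q q) = zero_mor (Adel C) I Q"
        using ker by (simp add: is_kernel_def)
      then show "Comp (Adel C) I Y Z (adel_class C I Y i) ?g = zero_mor (Adel C) I Z"
        using A.Comp_assoc[of I Y Q Z "adel_class C I Y i" "adel_class C Y Q q" u] u I ic Y Q Z q_cls by simp
      fix T t
      assume "T \<in> Ob (Adel C)" and t: "t \<in> carrier (Hom (Adel C) T Y)"
        and tg: "Comp (Adel C) T Y Z t ?g = zero_mor (Adel C) T Z"
      then have T: "T \<in> adel_objects C" by simp
      obtain t' where t': "t' \<in> carrier (adel_data C T Y)" "t = adel_class C T Y t'"
        using t by (rule Adel_Hom_cases)
      have "in_image C X \<phi> Y T t'"
        using as tg t' T comp_zero_iff[OF T Y Z t'(1) \<chi>] by simp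
      then have "Comp (Adel C) T Y Q t (adel_class C Y Q q) = zero_mor (Adel C) T Q"
        using if_im[OF T t'(1)] comp_zero_iff[OF T Y Q t'(1) q] t'(2) by simp
      then show "\<exists>!u. u \<in> carrier (Hom (Adel C) T I) \<and> Comp (Adel C) T I Y u (adel_class C I Y i) = t"
        using ker T t unfolding is_kernel_def by simp
    qed
    show ?exact
      unfolding exact_at_def is_image_def using X Y Z f g coker ker ker_g by auto
  qed
qed

end


text \<open>Annihilators and images are not affected by a change of sign, so a sequence remains exact when
  one of its morphisms is replaced by its negative.\<close>

lemma (in biproduct_category) adel_exact_neg:
  assumes X: "X \<in> adel_objects C" and Y: "Y \<in> adel_objects C" and Z: "Z \<in> adel_objects C"
    and \<phi>: "\<phi> \<in> carrier (adel_data C X Y)" and \<chi>: "\<chi> \<in> carrier (adel_data C Y Z)"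
    and exact: "exact_at (Adel C) X (adel_class C X Y \<phi>) Y (adel_class C Y Z \<chi>) Z"
  shows "exact_at (Adel C) X (adel_class C X Y (inv\<^bsub>Hom C (mid_ob X) (mid_ob Y)\<^esub> \<phi>)) Y (adel_class C Y Z \<chi>) Z"
    and "exact_at (Adel C) X (adel_class C X Y \<phi>) Y (adel_class C Y Z (inv\<^bsub>Hom C (mid_ob Y) (mid_ob Z)\<^esub> \<chi>)) Z"
proof -
  note [simp] = adel_objectsD[OF X] adel_objectsD[OF Y] adel_objectsD[OF Z]
    adel_data_closed[OF \<phi>] adel_data_closed[OF \<chi>]
  note ex = exact[unfolded adel_exact_iff[OF X Y Z \<phi> \<chi>]]
  have neg_im: "in_image C X (inv\<^bsub>Hom C (mid_ob X) (mid_ob Y)\<^esub> \<phi>) Y T t"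
    if T: "T \<in> adel_objects C" and im: "in_image C X \<phi> Y T t" for T t
  proof -
    note [simp] = adel_objectsD[OF T]
    obtain a b e h where
      "a \<in> carrier (Hom C (mid_ob T) (rel_ob Y))" "b \<in> carrier (Hom C (cor_ob T) (mid_ob Y))"
      "e \<in> carrier (Hom C (mid_ob T) (mid_ob X))" "h \<in> carrier (Hom C (cor_ob T) (cor_ob X))"
      "t = (Comp C (mid_ob T) (rel_ob Y) (mid_ob Y) a (rel_mor Y)
              \<otimes>\<^bsub>Hom C (mid_ob T) (mid_ob Y)\<^esub>
             Comp C (mid_ob T) (cor_ob T) (mid_ob Y) (cor_mor T) b)
              \<otimes>\<^bsub>Hom C (mid_ob T) (mid_ob Y)\<^esub>
             Comp C (mid_ob T) (mid_ob X) (mid_ob Y) e \<phi>"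
      "Comp C (mid_ob T) (mid_ob X) (cor_ob X) e (cor_mor X) =
       Comp C (mid_ob T) (cor_ob T) (cor_ob X) (cor_mor T) h"
      using im unfolding in_image_def by blast
    then show ?thesis
      by (intro in_imageI[where a = a and b = b and e = "inv\<^bsub>Hom C (mid_ob T) (mid_ob X)\<^esub> e"
            and h = "inv\<^bsub>Hom C (cor_ob T) (cor_ob X)\<^esub> h"]) simp_all
  qed
  show "exact_at (Adel C) X (adel_class C X Y (inv\<^bsub>Hom C (mid_ob X) (mid_ob Y)\<^esub> \<phi>)) Y (adel_class C Y Z \<chi>) Z"
    using ex neg_im adel_null_neg[OF X Z]
    by (simp add: adel_exact_iff[OF X Y Z adel_data_neg[OF X Y \<phi>] \<chi>])
  have "Comp C (mid_ob T) (mid_ob Y) (mid_ob Z) t \<chi> \<in> adel_null C T Z"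
    if T: "T \<in> adel_objects C" and t: "t \<in> carrier (adel_data C T Y)"
      and n: "Comp C (mid_ob T) (mid_ob Y) (mid_ob Z) t (inv\<^bsub>Hom C (mid_ob Y) (mid_ob Z)\<^esub> \<chi>) \<in> adel_null C T Z"
    for T t
    using adel_null_neg[OF T Z n] adel_objectsD[OF T] adel_data_closed[OF t] by simp
  then show "exact_at (Adel C) X (adel_class C X Y \<phi>) Y (adel_class C Y Z (inv\<^bsub>Hom C (mid_ob Y) (mid_ob Z)\<^esub> \<chi>)) Z"
    using ex adel_null_neg[OF X Z]
    by (simp add: adel_exact_iff[OF X Y Z \<phi> adel_data_neg[OF Y Z \<chi>]])
qed


section \<open>The snake sequence of three composable morphisms\<close>

text \<open>The snake sequence is defined for any three composable morphisms \<open>a \<rightarrow> b \<rightarrow> c \<rightarrow> d\<close>. The object \<open>z\<close>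
  is the other end of the zero morphisms in the outer objects; in the theorem it is the zero object.\<close>

locale adel_snake = biproduct_category C for C :: "('o, 'm) lincat" +
  fixes z a b c d :: 'o and \<alpha> \<beta> \<gamma> :: 'm
  assumes snake_ob [simp]: "z \<in> Ob C" "a \<in> Ob C" "b \<in> Ob C" "c \<in> Ob C" "d \<in> Ob C"
    and snake_mor [simp]:
      "\<alpha> \<in> carrier (Hom C a b)" "\<beta> \<in> carrier (Hom C b c)" "\<gamma> \<in> carrier (Hom C c d)"
begin

definition X1 where "X1 = Adel_Obj z (zero_mor C z a) a (Comp C a b c \<alpha> \<beta>) c"
definition X2 where "X2 = Adel_Obj z (zero_mor C z b) b \<beta> c"
definition X3 where "X3 = Adel_Obj a \<alpha> b (Comp C b c d \<beta> \<gamma>) d"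
definition X4 where "X4 = Adel_Obj a (Comp C a b c \<alpha> \<beta>) c \<gamma> d"
definition X5 where "X5 = Adel_Obj b \<beta> c (zero_mor C c z) z"
definition X6 where "X6 = Adel_Obj b (Comp C b c d \<beta> \<gamma>) d (zero_mor C d z) z"

lemmas X_defs = X1_def X2_def X3_def X4_def X5_def X6_def

lemma X_objects [simp]:
  "X1 \<in> adel_objects C" "X2 \<in> adel_objects C" "X3 \<in> adel_objects C"
  "X4 \<in> adel_objects C" "X5 \<in> adel_objects C" "X6 \<in> adel_objects C"
  by (simp_all add: X_defs)

lemma snake_data:
  "\<alpha> \<in> carrier (adel_data C X1 X2)" "Ident C b \<in> carrier (adel_data C X2 X3)"
  "\<beta> \<in> carrier (adel_data C X3 X4)"
  "Ident C c \<in> carrier (adel_data C X4 X5)" "\<gamma> \<in> carrier (adel_data C X5 X6)"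
proof -
  show "\<alpha> \<in> carrier (adel_data C X1 X2)"
    by (rule adel_dataI[where \<omega> = "zero_mor C z z" and \<psi> = "Ident C c"]) (simp_all add: X_defs)
  show "Ident C b \<in> carrier (adel_data C X2 X3)"
    by (rule adel_dataI[where \<omega> = "zero_mor C z a" and \<psi> = \<gamma>]) (simp_all add: X_defs)
  show "\<beta> \<in> carrier (adel_data C X3 X4)"
    by (rule adel_dataI[where \<omega> = "Ident C a" and \<psi> = "Ident C d"]) (simp_all add: X_defs)
  show "Ident C c \<in> carrier (adel_data C X4 X5)"
    by (rule adel_dataI[where \<omega> = \<alpha> and \<psi> = "zero_mor C d z"]) (simp_all add: X_defs)
  show "\<gamma> \<in> carrier (adel_data C X5 X6)"
    by (rule adel_dataI[where \<omega> = "Ident C b" and \<psi> = "zero_mor C z z"]) (simp_all add: X_defs)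
qed

text \<open>In each case \<open>adel_exact_iff\<close> provides a homotopy \<open>s\<^sub>1 \<cdot> \<rho> + \<gamma> \<cdot> s\<^sub>2\<close> for the image of a generalized
  element \<open>t\<close> in the third object, and the task is to find the preimage \<open>e\<close>. At \<open>X2\<close> and \<open>X4\<close> the
  second map is represented by an identity and \<open>e = s\<^sub>1\<close> works. At \<open>X3\<close> and \<open>X5\<close> the first map is
  represented by an identity and \<open>e\<close> is \<open>t\<close> corrected by the part of \<open>t\<close> that comes from \<open>s\<^sub>1\<close>.\<close>

lemma snake_exact:
  "exact_at (Adel C) X1 (adel_class C X1 X2 \<alpha>) X2 (adel_class C X2 X3 (Ident C b)) X3"
  "exact_at (Adel C) X2 (adel_class C X2 X3 (Ident C b)) X3 (adel_class C X3 X4 \<beta>) X4"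
  "exact_at (Adel C) X3 (adel_class C X3 X4 \<beta>) X4 (adel_class C X4 X5 (Ident C c)) X5"
  "exact_at (Adel C) X4 (adel_class C X4 X5 (Ident C c)) X5 (adel_class C X5 X6 \<gamma>) X6"
proof -
  have mid: "mid_ob X1 = a" "mid_ob X2 = b" "mid_ob X3 = b" "mid_ob X4 = c" "mid_ob X5 = c" "mid_ob X6 = d"
    by (simp_all add: X_defs)
  show "exact_at (Adel C) X1 (adel_class C X1 X2 \<alpha>) X2 (adel_class C X2 X3 (Ident C b)) X3"
  proof (subst adel_exact_iff, simp_all only: X_objects snake_data, intro conjI ballI impI)
    have "Comp C a b b \<alpha> (Ident C b) \<in> carrier (adel_data C X1 X3)"
      using adel_data_Comp[OF _ _ _ snake_data(1,2)] by (simp add: mid)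
    then show "Comp C (mid_ob X1) (mid_ob X2) (mid_ob X3) \<alpha> (Ident C b) \<in> adel_null C X1 X3"
      unfolding mid
      by (rule adel_nullI[where ?\<sigma>1.0 = "Ident C a" and ?\<sigma>2.0 = "zero_mor C c b"]) (simp_all add: X_defs)
    fix T t
    assume T: "T \<in> adel_objects C" and t: "t \<in> carrier (adel_data C T X2)"
      and n: "Comp C (mid_ob T) (mid_ob X2) (mid_ob X3) t (Ident C b) \<in> adel_null C T X3"
    note [simp] = adel_objectsD[OF T]
    obtain \<psi> where [simp]: "t \<in> carrier (Hom C (mid_ob T) b)" "\<psi> \<in> carrier (Hom C (cor_ob T) c)"
      and t\<psi>: "Comp C (mid_ob T) b c t \<beta> = Comp C (mid_ob T) (cor_ob T) c (cor_mor T) \<psi>"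
      using t by (elim adel_dataE) (auto simp: X2_def)
    obtain s1 s2 where s [simp]: "s1 \<in> carrier (Hom C (mid_ob T) a)" "s2 \<in> carrier (Hom C (cor_ob T) b)"
      and ts: "t = Comp C (mid_ob T) a b s1 \<alpha> \<otimes>\<^bsub>Hom C (mid_ob T) b\<^esub>
        Comp C (mid_ob T) (cor_ob T) b (cor_mor T) s2"
      using n by (elim adel_nullE) (auto simp: X2_def X3_def)
    have "Comp C (mid_ob T) b c t \<beta> = Comp C (mid_ob T) a c s1 (Comp C a b c \<alpha> \<beta>)
      \<otimes>\<^bsub>Hom C (mid_ob T) c\<^esub> Comp C (mid_ob T) (cor_ob T) c (cor_mor T) (Comp C (cor_ob T) b c s2 \<beta>)"
      by (simp add: ts add_Comp Comp_assoc)
    then have "Comp C (mid_ob T) a c s1 (Comp C a b c \<alpha> \<beta>) =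
      Comp C (mid_ob T) (cor_ob T) c (cor_mor T) \<psi> \<otimes>\<^bsub>Hom C (mid_ob T) c\<^esub>
      inv\<^bsub>Hom C (mid_ob T) c\<^esub> Comp C (mid_ob T) (cor_ob T) c (cor_mor T) (Comp C (cor_ob T) b c s2 \<beta>)"
      by (simp add: t\<psi>[symmetric] add_assoc)
    then show "in_image C X1 \<alpha> X2 T t"
      by (intro in_imageI[where a = "zero_mor C (mid_ob T) z" and b = s2 and e = s1
            and h = "\<psi> \<otimes>\<^bsub>Hom C (cor_ob T) c\<^esub> inv\<^bsub>Hom C (cor_ob T) c\<^esub> Comp C (cor_ob T) b c s2 \<beta>"])
         (simp_all add: X1_def X2_def Comp_add, simp add: ts add_comm)
  qed
  show "exact_at (Adel C) X2 (adel_class C X2 X3 (Ident C b)) X3 (adel_class C X3 X4 \<beta>) X4"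
  proof (subst adel_exact_iff, simp_all only: X_objects snake_data, intro conjI ballI impI)
    have "Comp C b b c (Ident C b) \<beta> \<in> carrier (adel_data C X2 X4)"
      using adel_data_Comp[OF _ _ _ snake_data(2,3)] by (simp add: mid)
    then show "Comp C (mid_ob X2) (mid_ob X3) (mid_ob X4) (Ident C b) \<beta> \<in> adel_null C X2 X4"
      unfolding mid
      by (rule adel_nullI[where ?\<sigma>1.0 = "zero_mor C b a" and ?\<sigma>2.0 = "Ident C c"]) (simp_all add: X_defs)
    fix T t
    assume T: "T \<in> adel_objects C" and t: "t \<in> carrier (adel_data C T X3)"
      and n: "Comp C (mid_ob T) (mid_ob X3) (mid_ob X4) t \<beta> \<in> adel_null C T X4"
    note [simp] = adel_objectsD[OF T]
    have [simp]: "t \<in> carrier (Hom C (mid_ob T) b)" using adel_data_closed[OF t] by (simp add: mid)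
    obtain s1 s2 where s [simp]: "s1 \<in> carrier (Hom C (mid_ob T) a)" "s2 \<in> carrier (Hom C (cor_ob T) c)"
      and ts: "Comp C (mid_ob T) b c t \<beta> = Comp C (mid_ob T) a c s1 (Comp C a b c \<alpha> \<beta>)
        \<otimes>\<^bsub>Hom C (mid_ob T) c\<^esub> Comp C (mid_ob T) (cor_ob T) c (cor_mor T) s2"
      using n by (elim adel_nullE) (auto simp: X3_def X4_def)
    show "in_image C X2 (Ident C b) X3 T t"
      by (intro in_imageI[where a = s1 and b = "zero_mor C (cor_ob T) b" and h = s2
            and e = "t \<otimes>\<^bsub>Hom C (mid_ob T) b\<^esub> inv\<^bsub>Hom C (mid_ob T) b\<^esub> Comp C (mid_ob T) a b s1 \<alpha>"])
         (simp_all add: X2_def X3_def add_Comp ts Comp_assoc add_assoc)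
  qed
  show "exact_at (Adel C) X3 (adel_class C X3 X4 \<beta>) X4 (adel_class C X4 X5 (Ident C c)) X5"
  proof (subst adel_exact_iff, simp_all only: X_objects snake_data, intro conjI ballI impI)
    have "Comp C b c c \<beta> (Ident C c) \<in> carrier (adel_data C X3 X5)"
      using adel_data_Comp[OF _ _ _ snake_data(3,4)] by (simp add: mid)
    then show "Comp C (mid_ob X3) (mid_ob X4) (mid_ob X5) \<beta> (Ident C c) \<in> adel_null C X3 X5"
      unfolding mid
      by (rule adel_nullI[where ?\<sigma>1.0 = "Ident C b" and ?\<sigma>2.0 = "zero_mor C d c"]) (simp_all add: X_defs)
    fix T t
    assume T: "T \<in> adel_objects C" and t: "t \<in> carrier (adel_data C T X4)"
      and n: "Comp C (mid_ob T) (mid_ob X4) (mid_ob X5) t (Ident C c) \<in> adel_null C T X5"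
    note [simp] = adel_objectsD[OF T]
    obtain \<psi> where [simp]: "t \<in> carrier (Hom C (mid_ob T) c)" "\<psi> \<in> carrier (Hom C (cor_ob T) d)"
      and t\<psi>: "Comp C (mid_ob T) c d t \<gamma> = Comp C (mid_ob T) (cor_ob T) d (cor_mor T) \<psi>"
      using t by (elim adel_dataE) (auto simp: X4_def)
    obtain s1 s2 where s [simp]: "s1 \<in> carrier (Hom C (mid_ob T) b)" "s2 \<in> carrier (Hom C (cor_ob T) c)"
      and ts: "t = Comp C (mid_ob T) b c s1 \<beta> \<otimes>\<^bsub>Hom C (mid_ob T) c\<^esub>
        Comp C (mid_ob T) (cor_ob T) c (cor_mor T) s2"
      using n by (elim adel_nullE) (auto simp: X4_def X5_def)
    have "Comp C (mid_ob T) c d t \<gamma> = Comp C (mid_ob T) b d s1 (Comp C b c d \<beta> \<gamma>)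
      \<otimes>\<^bsub>Hom C (mid_ob T) d\<^esub> Comp C (mid_ob T) (cor_ob T) d (cor_mor T) (Comp C (cor_ob T) c d s2 \<gamma>)"
      by (simp add: ts add_Comp Comp_assoc)
    then have "Comp C (mid_ob T) b d s1 (Comp C b c d \<beta> \<gamma>) =
      Comp C (mid_ob T) (cor_ob T) d (cor_mor T) \<psi> \<otimes>\<^bsub>Hom C (mid_ob T) d\<^esub>
      inv\<^bsub>Hom C (mid_ob T) d\<^esub> Comp C (mid_ob T) (cor_ob T) d (cor_mor T) (Comp C (cor_ob T) c d s2 \<gamma>)"
      by (simp add: t\<psi>[symmetric] add_assoc)
    then show "in_image C X3 \<beta> X4 T t"
      by (intro in_imageI[where a = "zero_mor C (mid_ob T) a" and b = s2 and e = s1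
            and h = "\<psi> \<otimes>\<^bsub>Hom C (cor_ob T) d\<^esub> inv\<^bsub>Hom C (cor_ob T) d\<^esub> Comp C (cor_ob T) c d s2 \<gamma>"])
         (simp_all add: X3_def X4_def Comp_add, simp add: ts add_comm)
  qed
  show "exact_at (Adel C) X4 (adel_class C X4 X5 (Ident C c)) X5 (adel_class C X5 X6 \<gamma>) X6"
  proof (subst adel_exact_iff, simp_all only: X_objects snake_data, intro conjI ballI impI)
    have "Comp C c c d (Ident C c) \<gamma> \<in> carrier (adel_data C X4 X6)"
      using adel_data_Comp[OF _ _ _ snake_data(4,5)] by (simp add: mid)
    then show "Comp C (mid_ob X4) (mid_ob X5) (mid_ob X6) (Ident C c) \<gamma> \<in> adel_null C X4 X6"
      unfolding mid
      by (rule adel_nullI[where ?\<sigma>1.0 = "zero_mor C c b" and ?\<sigma>2.0 = "Ident C d"]) (simp_all add: X_defs)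
    fix T t
    assume T: "T \<in> adel_objects C" and t: "t \<in> carrier (adel_data C T X5)"
      and n: "Comp C (mid_ob T) (mid_ob X5) (mid_ob X6) t \<gamma> \<in> adel_null C T X6"
    note [simp] = adel_objectsD[OF T]
    have [simp]: "t \<in> carrier (Hom C (mid_ob T) c)" using adel_data_closed[OF t] by (simp add: mid)
    obtain s1 s2 where s [simp]: "s1 \<in> carrier (Hom C (mid_ob T) b)" "s2 \<in> carrier (Hom C (cor_ob T) d)"
      and ts: "Comp C (mid_ob T) c d t \<gamma> = Comp C (mid_ob T) b d s1 (Comp C b c d \<beta> \<gamma>)
        \<otimes>\<^bsub>Hom C (mid_ob T) d\<^esub> Comp C (mid_ob T) (cor_ob T) d (cor_mor T) s2"
      using n by (elim adel_nullE) (auto simp: X5_def X6_def)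
    show "in_image C X4 (Ident C c) X5 T t"
      by (intro in_imageI[where a = s1 and b = "zero_mor C (cor_ob T) c" and h = s2
            and e = "t \<otimes>\<^bsub>Hom C (mid_ob T) c\<^esub> inv\<^bsub>Hom C (mid_ob T) c\<^esub> Comp C (mid_ob T) b c s1 \<beta>"])
         (simp_all add: X4_def X5_def add_Comp ts Comp_assoc add_assoc)
  qed
qed

text \<open>Without morphisms \<open>b \<rightarrow> a\<close> and \<open>d \<rightarrow> c\<close> every homotopy from \<open>X3\<close> to \<open>X4\<close> is zero, so the group
  inherits the basis \<open>\<beta>\<close> of \<open>Hom b c\<close>. The cyclic endomorphism group of \<open>b\<close> is what turns
  exactness at \<open>X4\<close> into a divisibility statement between integers.\<close>

lemma snake_connecting_group:
  assumes ba: "carrier (Hom C b a) = {zero_mor C b a}" and dc: "carrier (Hom C d c) = {zero_mor C d c}"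
    and bb: "carrier (Hom C b b) = range (\<lambda>k::int. Ident C b [^]\<^bsub>Hom C b b\<^esub> k)"
    and bc: "carrier (Hom C b c) = range (\<lambda>k::int. \<beta> [^]\<^bsub>Hom C b c\<^esub> k)"
    and inj: "inj (\<lambda>k::int. \<beta> [^]\<^bsub>Hom C b c\<^esub> k)"
  defines "H \<equiv> Hom (Adel C) X3 X4" and "\<delta> \<equiv> adel_class C X3 X4 \<beta>"
  shows "H \<cong> integer_group" "\<delta> \<in> carrier H" "generate H {\<delta>} = carrier H"
    "\<forall>D\<in>carrier H.
      exact_at (Adel C) X1 (adel_class C X1 X2 \<alpha>) X2 (adel_class C X2 X3 (Ident C b)) X3 \<and>
      exact_at (Adel C) X2 (adel_class C X2 X3 (Ident C b)) X3 D X4 \<and>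
      exact_at (Adel C) X3 D X4 (adel_class C X4 X5 (Ident C c)) X5 \<and>
      exact_at (Adel C) X4 (adel_class C X4 X5 (Ident C c)) X5 (adel_class C X5 X6 \<gamma>) X6
      \<longleftrightarrow> D = \<delta> \<or> D = inv\<^bsub>H\<^esub> \<delta>"
proof -
  interpret A: lin_category "Adel C" by (rule lin_category_Adel)
  interpret H: group H unfolding H_def by (rule A.Hom_group) simp_all
  interpret G: group "Hom C b c" by (rule Hom_group) simp_all
  interpret B: group "Hom C b b" by (rule Hom_group) simp_all
  have mid: "mid_ob X3 = b" "mid_ob X4 = c" by (simp_all add: X_defs)
  have \<delta>: "\<delta> \<in> carrier H"
    unfolding \<delta>_def H_def using snake_data(3) by (rule adel_class_closed)
  then show "\<delta> \<in> carrier H" .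

  have sub: "subgroup (carrier (adel_data C X3 X4)) (Hom C b c)"
    using adel_data_subgroup[of X3 X4] by (simp add: mid)
  have pow_data: "\<beta> [^]\<^bsub>Hom C b c\<^esub> k = \<beta> [^]\<^bsub>adel_data C X3 X4\<^esub> k" for k :: int
    using G.int_pow_consistent[OF sub snake_data(3)] by (simp add: adel_data_def mid)
  have normal: "adel_null C X3 X4 \<lhd> adel_data C X3 X4"
    using adel_data_comm_group adel_null_subgroup comm_group.subgroup_imp_normal X_objects by blast
  have pow_class: "\<delta> [^]\<^bsub>H\<^esub> k = adel_class C X3 X4 (\<beta> [^]\<^bsub>Hom C b c\<^esub> k)" for k :: int
    unfolding pow_data using normal.FactGroup_int_pow[OF normal snake_data(3)]
    by (simp add: H_def \<delta>_def Adel_def adel_class_def)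
  have pow_in: "\<beta> [^]\<^bsub>Hom C b c\<^esub> k \<in> carrier (adel_data C X3 X4)" for k :: int
    using G.subgroup_int_pow_closed[OF sub snake_data(3)] by simp
  \<comment> \<open>Both homotopies run against the direction of the arrows.\<close>
  have null: "\<phi> = zero_mor C b c" if "\<phi> \<in> adel_null C X3 X4" for \<phi>
    using that by (elim adel_nullE) (auto simp: X3_def X4_def ba dc)

  have inj_\<delta>: "inj (\<lambda>k::int. \<delta> [^]\<^bsub>H\<^esub> k)"
  proof (rule injI)
    fix k l :: int
    assume "\<delta> [^]\<^bsub>H\<^esub> k = \<delta> [^]\<^bsub>H\<^esub> l"
    then have "\<beta> [^]\<^bsub>Hom C b c\<^esub> k \<otimes>\<^bsub>Hom C b c\<^esub> inv\<^bsub>Hom C b c\<^esub> (\<beta> [^]\<^bsub>Hom C b c\<^esub> l) = zero_mor C b c"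
      using null by (simp add: pow_class adel_class_eq_iff pow_in mid)
    then have "\<beta> [^]\<^bsub>Hom C b c\<^esub> k = \<beta> [^]\<^bsub>Hom C b c\<^esub> l"
      using eq_iff_diff_zero[of b c "\<beta> [^]\<^bsub>Hom C b c\<^esub> k" "\<beta> [^]\<^bsub>Hom C b c\<^esub> l"] by simp
    then show "k = l" using inj by (simp add: inj_eq)
  qed
  have surj_\<delta>: "range (\<lambda>k::int. \<delta> [^]\<^bsub>H\<^esub> k) = carrier H"
  proof
    show "range (\<lambda>k::int. \<delta> [^]\<^bsub>H\<^esub> k) \<subseteq> carrier H" using \<delta> by auto
    show "carrier H \<subseteq> range (\<lambda>k::int. \<delta> [^]\<^bsub>H\<^esub> k)"
    proof
      fix D assume "D \<in> carrier H"
      then obtain \<phi> where "\<phi> \<in> carrier (adel_data C X3 X4)" "D = adel_class C X3 X4 \<phi>"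
        unfolding H_def by (rule Adel_Hom_cases)
      moreover from this have "\<phi> \<in> carrier (Hom C b c)" using adel_data_closed by (fastforce simp: mid)
      ultimately show "D \<in> range (\<lambda>k::int. \<delta> [^]\<^bsub>H\<^esub> k)" using bc by (auto simp: pow_class)
    qed
  qed
  show "generate H {\<delta>} = carrier H"
    unfolding H.generate_pow[OF \<delta>] surj_\<delta>[symmetric] by auto
  have "(\<lambda>k. \<delta> [^]\<^bsub>H\<^esub> k) \<in> iso integer_group H"
    using H.hom_integer_group_pow[OF \<delta>] inj_\<delta> surj_\<delta> by (simp add: iso_def bij_betw_def)
  then show "H \<cong> integer_group"
    using group.iso_sym[OF group_integer_group] is_isoI by blast

  have inv_\<delta>: "inv\<^bsub>H\<^esub> \<delta> = adel_class C X3 X4 (inv\<^bsub>Hom C b c\<^esub> \<beta>)"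
    unfolding H_def \<delta>_def using adel_class_neg[of X3 X4 \<beta>] snake_data(3) by (simp add: mid)
  \<comment> \<open>The generalized element \<open>\<beta>\<close> of \<open>X4\<close>, defined on \<open>X3\<close>, dies in \<open>X5\<close>. Exactness at \<open>X4\<close> makes it
    a multiple of \<open>\<beta>\<^sup>k\<close> by an endomorphism of \<open>b\<close>, and endomorphisms of \<open>b\<close> are integers.\<close>
  have only_if: "D = \<delta> \<or> D = inv\<^bsub>H\<^esub> \<delta>"
    if D: "D \<in> carrier H" and exact: "exact_at (Adel C) X3 D X4 (adel_class C X4 X5 (Ident C c)) X5" for D
  proof -
    obtain k :: int where k: "D = \<delta> [^]\<^bsub>H\<^esub> k" using D surj_\<delta> by auto
    have "Comp C b c c \<beta> (Ident C c) \<in> adel_null C X3 X5"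
    proof -
      have "Comp C b c c \<beta> (Ident C c) \<in> carrier (adel_data C X3 X5)"
        using adel_data_Comp[OF _ _ _ snake_data(3,4)] by (simp add: X_defs)
      then show ?thesis
        by (rule adel_nullI[where ?\<sigma>1.0 = "Ident C b" and ?\<sigma>2.0 = "zero_mor C d c"])
           (simp_all add: X_defs)
    qed
    then have "in_image C X3 (\<beta> [^]\<^bsub>Hom C b c\<^esub> k) X4 X3 \<beta>"
      using exact[unfolded k pow_class] adel_exact_iff[of X3 X4 X5 "\<beta> [^]\<^bsub>Hom C b c\<^esub> k" "Ident C c"]
        snake_data(3,4) pow_in
      by (simp add: X_defs)
    then obtain e where e: "e \<in> carrier (Hom C b b)"
      and \<beta>e: "\<beta> = Comp C b b c e (\<beta> [^]\<^bsub>Hom C b c\<^esub> k)"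
      by (auto simp: in_image_def X3_def X4_def ba dc)
    obtain m :: int where m: "e = Ident C b [^]\<^bsub>Hom C b b\<^esub> m" using e bb by auto
    interpret R: group_hom "Hom C b b" "Hom C b c" "\<lambda>f. Comp C b b c f (\<beta> [^]\<^bsub>Hom C b c\<^esub> k)"
      by (rule Comp_right_group_hom) simp_all
    have "\<beta> [^]\<^bsub>Hom C b c\<^esub> (1::int) = (\<beta> [^]\<^bsub>Hom C b c\<^esub> k) [^]\<^bsub>Hom C b c\<^esub> m"
      using \<beta>e R.hom_int_pow[of "Ident C b" m] by (simp add: m)
    also have "\<dots> = \<beta> [^]\<^bsub>Hom C b c\<^esub> (k * m)" by (simp add: G.int_pow_pow)
    finally have "k * m = 1" using inj by (metis injD)
    then have "k = 1 \<or> k = - 1" by (auto simp: zmult_eq_1_iff)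
    then show ?thesis using \<delta> by (auto simp: k H.int_pow_neg)
  qed
  have neg: "exact_at (Adel C) X2 (adel_class C X2 X3 (Ident C b)) X3 (inv\<^bsub>H\<^esub> \<delta>) X4"
    "exact_at (Adel C) X3 (inv\<^bsub>H\<^esub> \<delta>) X4 (adel_class C X4 X5 (Ident C c)) X5"
    using adel_exact_neg(2)[OF _ _ _ snake_data(2,3) snake_exact(2)]
      adel_exact_neg(1)[OF _ _ _ snake_data(3,4) snake_exact(3)]
    by (simp_all add: inv_\<delta> mid)
  show "\<forall>D\<in>carrier H.
      exact_at (Adel C) X1 (adel_class C X1 X2 \<alpha>) X2 (adel_class C X2 X3 (Ident C b)) X3 \<and>
      exact_at (Adel C) X2 (adel_class C X2 X3 (Ident C b)) X3 D X4 \<and>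
      exact_at (Adel C) X3 D X4 (adel_class C X4 X5 (Ident C c)) X5 \<and>
      exact_at (Adel C) X4 (adel_class C X4 X5 (Ident C c)) X5 (adel_class C X5 X6 \<gamma>) X6
      \<longleftrightarrow> D = \<delta> \<or> D = inv\<^bsub>H\<^esub> \<delta>"
    using only_if neg snake_exact by (auto simp: \<delta>_def)
qed

end


section \<open>The additive closure\<close>

lemma (in comm_monoid) finprod_swap:
  assumes "finite I" "finite J" "\<And>i j. \<lbrakk>i \<in> I; j \<in> J\<rbrakk> \<Longrightarrow> f i j \<in> carrier G"
  shows "finprod G (\<lambda>i. finprod G (\<lambda>j. f i j) J) I = finprod G (\<lambda>j. finprod G (\<lambda>i. f i j) I) J"
  using assms(1,3)
proof (induction I rule: finite_induct)
  case (insert i I)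
  have "finprod G (\<lambda>j. finprod G (\<lambda>i. f i j) (insert i I)) J
    = finprod G (\<lambda>j. f i j \<otimes> finprod G (\<lambda>i. f i j) I) J"
    using insert by (intro finprod_cong') (auto intro!: finprod_insert)
  also have "\<dots> = finprod G (\<lambda>j. f i j) J \<otimes> finprod G (\<lambda>j. finprod G (\<lambda>i. f i j) I) J"
    using insert by (intro finprod_multf) auto
  finally show ?case using insert by simp
qed simp

context lin_category
begin

lemma hom_sum_closed [simp]:
  "\<lbrakk>A \<in> Ob C; B \<in> Ob C; \<And>i. i \<in> I \<Longrightarrow> f i \<in> carrier (Hom C A B)\<rbrakk>
    \<Longrightarrow> finprod (Hom C A B) f I \<in> carrier (Hom C A B)"
  by (rule comm_monoid.finprod_closed) (auto simp: Hom_comm_group comm_group.axioms(1))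

lemma hom_sum_cong:
  assumes "A \<in> Ob C" "B \<in> Ob C" "\<And>i. i \<in> I \<Longrightarrow> f i = g i" "\<And>i. i \<in> I \<Longrightarrow> g i \<in> carrier (Hom C A B)"
  shows "finprod (Hom C A B) f I = finprod (Hom C A B) g I"
proof -
  interpret comm_group "Hom C A B" using assms by (rule_tac Hom_comm_group)
  show ?thesis using assms by (intro finprod_cong') auto
qed

lemma hom_sum_zero:
  assumes "A \<in> Ob C" "B \<in> Ob C" "\<And>i. i \<in> I \<Longrightarrow> f i = zero_mor C A B"
  shows "finprod (Hom C A B) f I = zero_mor C A B"
proof -
  interpret comm_group "Hom C A B" using assms by (rule_tac Hom_comm_group)
  show ?thesis using assms by (simp add: finprod_one_eqI zero_mor_def)
qed

lemma hom_sum_single: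
  assumes "A \<in> Ob C" "B \<in> Ob C" "finite I" "k \<in> I" "f k \<in> carrier (Hom C A B)"
    and "\<And>i. \<lbrakk>i \<in> I; i \<noteq> k\<rbrakk> \<Longrightarrow> f i = zero_mor C A B"
  shows "finprod (Hom C A B) f I = f k"
proof -
  interpret comm_group "Hom C A B" using assms by (rule_tac Hom_comm_group)
  have "finprod (Hom C A B) f I = finprod (Hom C A B) (\<lambda>i. if i = k then f k else \<one>\<^bsub>Hom C A B\<^esub>) I"
    using assms by (intro finprod_cong') (auto simp: zero_mor_def)
  then show ?thesis using assms finprod_singleton_swap[of k I "\<lambda>_. f k"] by simp
qed

lemma hom_sum_add:
  assumes "A \<in> Ob C" "B \<in> Ob C" "\<And>i. i \<in> I \<Longrightarrow> f i \<in> carrier (Hom C A B)"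
    "\<And>i. i \<in> I \<Longrightarrow> g i \<in> carrier (Hom C A B)"
  shows "finprod (Hom C A B) (\<lambda>i. f i \<otimes>\<^bsub>Hom C A B\<^esub> g i) I
    = finprod (Hom C A B) f I \<otimes>\<^bsub>Hom C A B\<^esub> finprod (Hom C A B) g I"
proof -
  interpret comm_group "Hom C A B" using assms by (rule_tac Hom_comm_group)
  show ?thesis using assms by (intro finprod_multf) auto
qed

lemma hom_sum_Comp:
  assumes "A \<in> Ob C" "B \<in> Ob C" "D \<in> Ob C" "finite I"
    "\<And>i. i \<in> I \<Longrightarrow> f i \<in> carrier (Hom C A B)" "g \<in> carrier (Hom C B D)"
  shows "Comp C A B D (finprod (Hom C A B) f I) g = finprod (Hom C A D) (\<lambda>i. Comp C A B D (f i) g) I"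
proof -
  interpret G: comm_group "Hom C A B" using assms by (rule_tac Hom_comm_group)
  interpret H: comm_group "Hom C A D" using assms by (rule_tac Hom_comm_group)
  show ?thesis using assms(4,5)
  proof (induction I rule: finite_induct)
    case empty
    then show ?case using Comp_zero(1)[of A B D g] assms by (simp add: zero_mor_def)
  next
    case (insert i I)
    then have "finprod (Hom C A B) f (insert i I) = f i \<otimes>\<^bsub>Hom C A B\<^esub> finprod (Hom C A B) f I"
      "finprod (Hom C A D) (\<lambda>i. Comp C A B D (f i) g) (insert i I) =
        Comp C A B D (f i) g \<otimes>\<^bsub>Hom C A D\<^esub> finprod (Hom C A D) (\<lambda>i. Comp C A B D (f i) g) I"
      using assms by (auto intro!: G.finprod_insert H.finprod_insert)
    then show ?case using insert assms by (simp add: add_Comp)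
  qed
qed

lemma Comp_hom_sum:
  assumes "A \<in> Ob C" "B \<in> Ob C" "D \<in> Ob C" "finite I"
    "\<And>i. i \<in> I \<Longrightarrow> g i \<in> carrier (Hom C B D)" "f \<in> carrier (Hom C A B)"
  shows "Comp C A B D f (finprod (Hom C B D) g I) = finprod (Hom C A D) (\<lambda>i. Comp C A B D f (g i)) I"
  using lin_category.hom_sum_Comp[OF lin_category_opposite, of D B A I g f] assms by simp

abbreviation addcl where "addcl \<equiv> additive_closure C"

lemma closure_Ob [simp]: "Ob addcl = lists (Ob C)"
  by (simp add: additive_closure_def)

lemma lists_nth: "\<lbrakk>X \<in> lists (Ob C); i < length X\<rbrakk> \<Longrightarrow> X ! i \<in> Ob C"
  by (auto simp: lists_eq_set)

lemma mem_closure_Hom: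
  "M \<in> carrier (Hom addcl X Y) \<longleftrightarrow> M \<in> carrier_mat (length X) (length Y) \<and>
     (\<forall>i<length X. \<forall>j<length Y. M $$ (i, j) \<in> carrier (Hom C (X ! i) (Y ! j)))"
  by (simp add: additive_closure_def)

lemma closure_HomI:
  assumes "\<And>i j. \<lbrakk>i < length X; j < length Y\<rbrakk> \<Longrightarrow> f (i, j) \<in> carrier (Hom C (X ! i) (Y ! j))"
  shows "mat (length X) (length Y) f \<in> carrier (Hom addcl X Y)"
  using assms by (simp add: mem_closure_Hom)

lemma closure_entry:
  "\<lbrakk>M \<in> carrier (Hom addcl X Y); i < length X; j < length Y\<rbrakk>
    \<Longrightarrow> M $$ (i, j) \<in> carrier (Hom C (X ! i) (Y ! j))"
  by (simp add: mem_closure_Hom)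

lemma closure_eqI:
  assumes "M \<in> carrier (Hom addcl X Y)" "N \<in> carrier (Hom addcl X Y)"
    and "\<And>i j. \<lbrakk>i < length X; j < length Y\<rbrakk> \<Longrightarrow> M $$ (i, j) = N $$ (i, j)"
  shows "M = N"
  using assms by (intro eq_matI) (auto simp: mem_closure_Hom)

lemma closure_add: "M \<otimes>\<^bsub>Hom addcl X Y\<^esub> N = mat (length X) (length Y)
    (\<lambda>(i, j). M $$ (i, j) \<otimes>\<^bsub>Hom C (X ! i) (Y ! j)\<^esub> N $$ (i, j))"
  by (simp add: additive_closure_def)

lemma closure_add_entry:
  "\<lbrakk>i < length X; j < length Y\<rbrakk> \<Longrightarrow> (M \<otimes>\<^bsub>Hom addcl X Y\<^esub> N) $$ (i, j)
    = M $$ (i, j) \<otimes>\<^bsub>Hom C (X ! i) (Y ! j)\<^esub> N $$ (i, j)"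
  by (simp add: closure_add)

lemma closure_zero: "zero_mor addcl X Y = mat (length X) (length Y) (\<lambda>(i, j). zero_mor C (X ! i) (Y ! j))"
  by (simp add: additive_closure_def zero_mor_def)

lemma closure_Comp: "Comp addcl X Y Z M N = mat (length X) (length Z)
    (\<lambda>(i, k). finprod (Hom C (X ! i) (Z ! k))
      (\<lambda>j. Comp C (X ! i) (Y ! j) (Z ! k) (M $$ (i, j)) (N $$ (j, k))) {..<length Y})"
  by (simp add: additive_closure_def)

lemma closure_Ident: "Ident addcl X = mat (length X) (length X)
    (\<lambda>(i, j). if i = j then Ident C (X ! i) else zero_mor C (X ! i) (X ! j))"
  by (simp add: additive_closure_def)

lemma closure_comm_group:
  assumes X: "X \<in> lists (Ob C)" and Y: "Y \<in> lists (Ob C)"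
  shows "comm_group (Hom addcl X Y)"
proof -
  note [simp] = lists_nth[OF X] lists_nth[OF Y] closure_entry
  have zero: "zero_mor addcl X Y \<in> carrier (Hom addcl X Y)"
    unfolding closure_zero by (rule closure_HomI) simp
  have add: "M \<otimes>\<^bsub>Hom addcl X Y\<^esub> N \<in> carrier (Hom addcl X Y)"
    if "M \<in> carrier (Hom addcl X Y)" "N \<in> carrier (Hom addcl X Y)" for M N
    unfolding closure_add using that by (intro closure_HomI) simp
  have one: "\<one>\<^bsub>Hom addcl X Y\<^esub> = zero_mor addcl X Y" by (simp add: zero_mor_def)
  show ?thesis
  proof (rule comm_groupI, unfold one)
    fix M assume M: "M \<in> carrier (Hom addcl X Y)"
    show "zero_mor addcl X Y \<otimes>\<^bsub>Hom addcl X Y\<^esub> M = M"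
      using M zero add by (intro closure_eqI[of _ X Y]) (simp_all add: closure_add closure_zero)
    let ?N = "mat (length X) (length Y) (\<lambda>(i, j). inv\<^bsub>Hom C (X ! i) (Y ! j)\<^esub> (M $$ (i, j)))"
    have "?N \<in> carrier (Hom addcl X Y)" using M by (intro closure_HomI) simp
    moreover from this have "?N \<otimes>\<^bsub>Hom addcl X Y\<^esub> M = zero_mor addcl X Y"
      using M zero add by (intro closure_eqI[of _ X Y]) (simp_all add: closure_add closure_zero)
    ultimately show "\<exists>N\<in>carrier (Hom addcl X Y). N \<otimes>\<^bsub>Hom addcl X Y\<^esub> M = zero_mor addcl X Y" ..
    fix N assume N: "N \<in> carrier (Hom addcl X Y)"
    show "M \<otimes>\<^bsub>Hom addcl X Y\<^esub> N = N \<otimes>\<^bsub>Hom addcl X Y\<^esub> M"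
      using M N add by (intro closure_eqI[of _ X Y]) (simp_all add: closure_add add_comm)
    fix P assume P: "P \<in> carrier (Hom addcl X Y)"
    show "M \<otimes>\<^bsub>Hom addcl X Y\<^esub> N \<otimes>\<^bsub>Hom addcl X Y\<^esub> P = M \<otimes>\<^bsub>Hom addcl X Y\<^esub> (N \<otimes>\<^bsub>Hom addcl X Y\<^esub> P)"
      using M N P add by (intro closure_eqI[of _ X Y]) (simp_all add: closure_add add_assoc)
  qed (use zero add in auto)
qed

lemma closure_Comp_closed:
  assumes X: "X \<in> lists (Ob C)" and Y: "Y \<in> lists (Ob C)" and Z: "Z \<in> lists (Ob C)"
    and "M \<in> carrier (Hom addcl X Y)" "N \<in> carrier (Hom addcl Y Z)"
  shows "Comp addcl X Y Z M N \<in> carrier (Hom addcl X Z)"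
  unfolding closure_Comp using assms
  by (intro closure_HomI)
     (auto intro!: hom_sum_closed Comp_closed closure_entry[of M X Y] closure_entry[of N Y Z] simp: lists_nth)

lemma closure_Comp_assoc:
  assumes X: "X \<in> lists (Ob C)" and Y: "Y \<in> lists (Ob C)" and Z: "Z \<in> lists (Ob C)" and W: "W \<in> lists (Ob C)"
    and M: "M \<in> carrier (Hom addcl X Y)" and N: "N \<in> carrier (Hom addcl Y Z)"
    and P: "P \<in> carrier (Hom addcl Z W)"
  shows "Comp addcl X Z W (Comp addcl X Y Z M N) P = Comp addcl X Y W M (Comp addcl Y Z W N P)"
proof (rule closure_eqI)
  note [simp] = lists_nth[OF X] lists_nth[OF Y] lists_nth[OF Z] lists_nth[OF W]
    closure_entry[OF M] closure_entry[OF N] closure_entry[OF P]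
  fix i l assume i [simp]: "i < length X" and l [simp]: "l < length W"
  interpret comm_group "Hom C (X ! i) (W ! l)" by (rule Hom_comm_group) simp_all
  let ?t = "\<lambda>j k. Comp C (X ! i) (Y ! j) (W ! l) (M $$ (i, j)) (Comp C (Y ! j) (Z ! k) (W ! l) (N $$ (j, k)) (P $$ (k, l)))"
  have "Comp addcl X Z W (Comp addcl X Y Z M N) P $$ (i, l)
    = finprod (Hom C (X ! i) (W ! l)) (\<lambda>k. Comp C (X ! i) (Z ! k) (W ! l)
        (finprod (Hom C (X ! i) (Z ! k)) (\<lambda>j. Comp C (X ! i) (Y ! j) (Z ! k) (M $$ (i, j)) (N $$ (j, k))) {..<length Y})
        (P $$ (k, l))) {..<length Z}"
    unfolding closure_Comp by (auto intro!: hom_sum_cong hom_sum_closed Comp_closed)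
  also have "\<dots> = finprod (Hom C (X ! i) (W ! l)) (\<lambda>k. finprod (Hom C (X ! i) (W ! l)) (\<lambda>j. ?t j k) {..<length Y}) {..<length Z}"
  proof (rule hom_sum_cong)
    fix k assume "k \<in> {..<length Z}"
    then have k [simp]: "k < length Z" by simp
    have "Comp C (X ! i) (Z ! k) (W ! l)
        (finprod (Hom C (X ! i) (Z ! k)) (\<lambda>j. Comp C (X ! i) (Y ! j) (Z ! k) (M $$ (i, j)) (N $$ (j, k))) {..<length Y})
        (P $$ (k, l))
      = finprod (Hom C (X ! i) (W ! l)) (\<lambda>j. Comp C (X ! i) (Z ! k) (W ! l)
          (Comp C (X ! i) (Y ! j) (Z ! k) (M $$ (i, j)) (N $$ (j, k))) (P $$ (k, l))) {..<length Y}"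
      by (rule hom_sum_Comp) auto
    also have "\<dots> = finprod (Hom C (X ! i) (W ! l)) (\<lambda>j. ?t j k) {..<length Y}"
      by (rule hom_sum_cong) (auto simp: Comp_assoc)
    finally show "Comp C (X ! i) (Z ! k) (W ! l)
        (finprod (Hom C (X ! i) (Z ! k)) (\<lambda>j. Comp C (X ! i) (Y ! j) (Z ! k) (M $$ (i, j)) (N $$ (j, k))) {..<length Y})
        (P $$ (k, l)) = finprod (Hom C (X ! i) (W ! l)) (\<lambda>j. ?t j k) {..<length Y}" .
  qed (auto intro!: hom_sum_closed Comp_closed)
  also have "\<dots> = finprod (Hom C (X ! i) (W ! l)) (\<lambda>j. finprod (Hom C (X ! i) (W ! l)) (\<lambda>k. ?t j k) {..<length Z}) {..<length Y}"
    by (rule finprod_swap) auto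
  also have "\<dots> = finprod (Hom C (X ! i) (W ! l)) (\<lambda>j. Comp C (X ! i) (Y ! j) (W ! l) (M $$ (i, j))
        (finprod (Hom C (Y ! j) (W ! l)) (\<lambda>k. Comp C (Y ! j) (Z ! k) (W ! l) (N $$ (j, k)) (P $$ (k, l))) {..<length Z}))
        {..<length Y}"
    by (rule hom_sum_cong) (auto intro!: Comp_hom_sum[symmetric] hom_sum_closed Comp_closed)
  also have "\<dots> = Comp addcl X Y W M (Comp addcl Y Z W N P) $$ (i, l)"
    unfolding closure_Comp by (auto intro!: hom_sum_cong[symmetric] hom_sum_closed Comp_closed)
  finally show "Comp addcl X Z W (Comp addcl X Y Z M N) P $$ (i, l)
    = Comp addcl X Y W M (Comp addcl Y Z W N P) $$ (i, l)" .
qed (use assms in \<open>simp_all add: closure_Comp_closed\<close>)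

text \<open>Identities, injections and projections are matrices whose rows contain at most one nonzero
  entry, which is an identity. The next two lemmas evaluate products with such rows on the left,
  which covers the left unit law and the equations of biproducts.\<close>

lemma closure_Comp_unit_row:
  assumes X: "X \<in> lists (Ob C)" and Y: "Y \<in> lists (Ob C)" and Z: "Z \<in> lists (Ob C)"
    and N: "N \<in> carrier (Hom addcl Y Z)" and i: "i < length X" and j: "j < length Y" and k: "k < length Z"
    and "Y ! j = X ! i" "M $$ (i, j) = Ident C (X ! i)"
    and "\<And>j'. \<lbrakk>j' < length Y; j' \<noteq> j\<rbrakk> \<Longrightarrow> M $$ (i, j') = zero_mor C (X ! i) (Y ! j')"
  shows "Comp addcl X Y Z M N $$ (i, k) = N $$ (j, k)"
proof -
  note [simp] = lists_nth[OF X] lists_nth[OF Y] lists_nth[OF Z]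
  have "N $$ (j, k) \<in> carrier (Hom C (X ! i) (Z ! k))" using closure_entry[OF N j k] assms by simp
  moreover have "Comp C (X ! i) (Y ! j') (Z ! k) (M $$ (i, j')) (N $$ (j', k)) = zero_mor C (X ! i) (Z ! k)"
    if "j' < length Y" "j' \<noteq> j" for j'
    using that assms by (simp add: closure_entry[OF N])
  ultimately have "finprod (Hom C (X ! i) (Z ! k))
      (\<lambda>j'. Comp C (X ! i) (Y ! j') (Z ! k) (M $$ (i, j')) (N $$ (j', k))) {..<length Y}
    = Comp C (X ! i) (Y ! j) (Z ! k) (M $$ (i, j)) (N $$ (j, k))"
    using assms by (intro hom_sum_single) auto
  then show ?thesis
    using assms \<open>N $$ (j, k) \<in> _\<close> by (simp add: closure_Comp)
qed

lemma closure_Comp_zero_row: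
  assumes X: "X \<in> lists (Ob C)" and Y: "Y \<in> lists (Ob C)" and Z: "Z \<in> lists (Ob C)"
    and N: "N \<in> carrier (Hom addcl Y Z)" and i: "i < length X" and k: "k < length Z"
    and "\<And>j'. j' < length Y \<Longrightarrow> M $$ (i, j') = zero_mor C (X ! i) (Y ! j')"
  shows "Comp addcl X Y Z M N $$ (i, k) = zero_mor C (X ! i) (Z ! k)"
proof -
  note [simp] = lists_nth[OF X] lists_nth[OF Y] lists_nth[OF Z]
  have "finprod (Hom C (X ! i) (Z ! k))
      (\<lambda>j'. Comp C (X ! i) (Y ! j') (Z ! k) (M $$ (i, j')) (N $$ (j', k))) {..<length Y}
    = zero_mor C (X ! i) (Z ! k)"
    using assms by (intro hom_sum_zero) (auto simp: closure_entry[OF N])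
  then show ?thesis using i k by (simp add: closure_Comp)
qed

lemma lin_category_closure: "lin_category addcl"
proof (rule lin_category.intro)
  fix X assume "X \<in> Ob addcl"
  then have X: "X \<in> lists (Ob C)" by simp
  show Id: "Ident addcl X \<in> carrier (Hom addcl X X)"
    unfolding closure_Ident using X by (intro closure_HomI) (auto simp: lists_nth)
  fix Y assume "Y \<in> Ob addcl"
  then have Y: "Y \<in> lists (Ob C)" by simp
  note [simp] = lists_nth[OF X] lists_nth[OF Y]
  show "comm_group (Hom addcl X Y)" using X Y by (rule closure_comm_group)
  fix M assume M: "M \<in> carrier (Hom addcl X Y)"
  note [simp] = closure_entry[OF M]
  show "Comp addcl X X Y (Ident addcl X) M = M"
    using X Y M Id
    by (intro closure_eqI[of _ X Y] closure_Comp_closed)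
       (auto simp: closure_Ident intro!: closure_Comp_unit_row)
  have IdY: "Ident addcl Y \<in> carrier (Hom addcl Y Y)"
    unfolding closure_Ident using Y by (intro closure_HomI) auto
  show "Comp addcl X Y Y M (Ident addcl Y) = M"
  proof (rule closure_eqI)
    fix i k assume ik: "i < length X" "k < length Y"
    then have "finprod (Hom C (X ! i) (Y ! k))
        (\<lambda>j. Comp C (X ! i) (Y ! j) (Y ! k) (M $$ (i, j)) (Ident addcl Y $$ (j, k))) {..<length Y}
      = Comp C (X ! i) (Y ! k) (Y ! k) (M $$ (i, k)) (Ident addcl Y $$ (k, k))"
      by (intro hom_sum_single) (auto simp: closure_Ident)
    then show "Comp addcl X Y Y M (Ident addcl Y) $$ (i, k) = M $$ (i, k)"
      using ik by (simp add: closure_Comp) (simp add: closure_Ident)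
  qed (use X Y M IdY in \<open>simp_all add: closure_Comp_closed\<close>)
next
  fix X Y Z M M' N
  assume *: "X \<in> Ob addcl" "Y \<in> Ob addcl" "Z \<in> Ob addcl" "M \<in> carrier (Hom addcl X Y)"
    "M' \<in> carrier (Hom addcl X Y)" "N \<in> carrier (Hom addcl Y Z)"
  have XYZ: "X \<in> lists (Ob C)" "Y \<in> lists (Ob C)" "Z \<in> lists (Ob C)" using * by simp_all
  note [simp] = XYZ[THEN lists_nth] *(4-)[THEN closure_entry]
  have entry_sum: "finprod (Hom C (X ! i) (Z ! k)) (\<lambda>j. Comp C (X ! i) (Y ! j) (Z ! k) ((M \<otimes>\<^bsub>Hom addcl X Y\<^esub> M') $$ (i, j)) (N $$ (j, k))) {..<length Y}
      = finprod (Hom C (X ! i) (Z ! k)) (\<lambda>j. Comp C (X ! i) (Y ! j) (Z ! k) (M $$ (i, j)) (N $$ (j, k))) {..<length Y} \<otimes>\<^bsub>Hom C (X ! i) (Z ! k)\<^esub>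
        finprod (Hom C (X ! i) (Z ! k)) (\<lambda>j. Comp C (X ! i) (Y ! j) (Z ! k) (M' $$ (i, j)) (N $$ (j, k))) {..<length Y}"
    if "i < length X" "k < length Z" for i k
  proof -
    have "finprod (Hom C (X ! i) (Z ! k)) (\<lambda>j. Comp C (X ! i) (Y ! j) (Z ! k) ((M \<otimes>\<^bsub>Hom addcl X Y\<^esub> M') $$ (i, j)) (N $$ (j, k))) {..<length Y}
      = finprod (Hom C (X ! i) (Z ! k)) (\<lambda>j. Comp C (X ! i) (Y ! j) (Z ! k) (M $$ (i, j)) (N $$ (j, k)) \<otimes>\<^bsub>Hom C (X ! i) (Z ! k)\<^esub> Comp C (X ! i) (Y ! j) (Z ! k) (M' $$ (i, j)) (N $$ (j, k))) {..<length Y}"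
      using that by (intro hom_sum_cong) (auto simp: closure_add_entry add_Comp)
    also have "\<dots> = finprod (Hom C (X ! i) (Z ! k)) (\<lambda>j. Comp C (X ! i) (Y ! j) (Z ! k) (M $$ (i, j)) (N $$ (j, k))) {..<length Y} \<otimes>\<^bsub>Hom C (X ! i) (Z ! k)\<^esub>
        finprod (Hom C (X ! i) (Z ! k)) (\<lambda>j. Comp C (X ! i) (Y ! j) (Z ! k) (M' $$ (i, j)) (N $$ (j, k))) {..<length Y}"
      using that by (intro hom_sum_add) auto
    finally show ?thesis .
  qed
  interpret XY: comm_group "Hom addcl X Y" using * closure_comm_group by simp
  interpret XZ: comm_group "Hom addcl X Z" using * closure_comm_group by simp
  show "Comp addcl X Y Z (M \<otimes>\<^bsub>Hom addcl X Y\<^esub> M') N =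
      Comp addcl X Y Z M N \<otimes>\<^bsub>Hom addcl X Z\<^esub> Comp addcl X Y Z M' N"
  proof (rule closure_eqI)
    fix i k assume "i < length X" "k < length Z"
    then show "Comp addcl X Y Z (M \<otimes>\<^bsub>Hom addcl X Y\<^esub> M') N $$ (i, k) =
      (Comp addcl X Y Z M N \<otimes>\<^bsub>Hom addcl X Z\<^esub> Comp addcl X Y Z M' N) $$ (i, k)"
      using entry_sum[of i k] by (simp add: closure_Comp closure_add_entry)
  qed (use * in \<open>auto simp: closure_Comp_closed\<close>)
next
  fix X Y Z M N N'
  assume *: "X \<in> Ob addcl" "Y \<in> Ob addcl" "Z \<in> Ob addcl" "M \<in> carrier (Hom addcl X Y)"
    "N \<in> carrier (Hom addcl Y Z)" "N' \<in> carrier (Hom addcl Y Z)"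
  have XYZ: "X \<in> lists (Ob C)" "Y \<in> lists (Ob C)" "Z \<in> lists (Ob C)" using * by simp_all
  note [simp] = XYZ[THEN lists_nth] *(4-)[THEN closure_entry]
  have entry_sum: "finprod (Hom C (X ! i) (Z ! k)) (\<lambda>j. Comp C (X ! i) (Y ! j) (Z ! k) (M $$ (i, j)) ((N \<otimes>\<^bsub>Hom addcl Y Z\<^esub> N') $$ (j, k))) {..<length Y}
      = finprod (Hom C (X ! i) (Z ! k)) (\<lambda>j. Comp C (X ! i) (Y ! j) (Z ! k) (M $$ (i, j)) (N $$ (j, k))) {..<length Y} \<otimes>\<^bsub>Hom C (X ! i) (Z ! k)\<^esub>
        finprod (Hom C (X ! i) (Z ! k)) (\<lambda>j. Comp C (X ! i) (Y ! j) (Z ! k) (M $$ (i, j)) (N' $$ (j, k))) {..<length Y}"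
    if "i < length X" "k < length Z" for i k
  proof -
    have "finprod (Hom C (X ! i) (Z ! k)) (\<lambda>j. Comp C (X ! i) (Y ! j) (Z ! k) (M $$ (i, j)) ((N \<otimes>\<^bsub>Hom addcl Y Z\<^esub> N') $$ (j, k))) {..<length Y}
      = finprod (Hom C (X ! i) (Z ! k)) (\<lambda>j. Comp C (X ! i) (Y ! j) (Z ! k) (M $$ (i, j)) (N $$ (j, k)) \<otimes>\<^bsub>Hom C (X ! i) (Z ! k)\<^esub> Comp C (X ! i) (Y ! j) (Z ! k) (M $$ (i, j)) (N' $$ (j, k))) {..<length Y}"
      using that by (intro hom_sum_cong) (auto simp: closure_add_entry Comp_add)
    also have "\<dots> = finprod (Hom C (X ! i) (Z ! k)) (\<lambda>j. Comp C (X ! i) (Y ! j) (Z ! k) (M $$ (i, j)) (N $$ (j, k))) {..<length Y} \<otimes>\<^bsub>Hom C (X ! i) (Z ! k)\<^esub>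
        finprod (Hom C (X ! i) (Z ! k)) (\<lambda>j. Comp C (X ! i) (Y ! j) (Z ! k) (M $$ (i, j)) (N' $$ (j, k))) {..<length Y}"
      using that by (intro hom_sum_add) auto
    finally show ?thesis .
  qed
  interpret YZ: comm_group "Hom addcl Y Z" using * closure_comm_group by simp
  interpret XZ: comm_group "Hom addcl X Z" using * closure_comm_group by simp
  show "Comp addcl X Y Z M (N \<otimes>\<^bsub>Hom addcl Y Z\<^esub> N') =
      Comp addcl X Y Z M N \<otimes>\<^bsub>Hom addcl X Z\<^esub> Comp addcl X Y Z M N'"
  proof (rule closure_eqI)
    fix i k assume "i < length X" "k < length Z"
    then show "Comp addcl X Y Z M (N \<otimes>\<^bsub>Hom addcl Y Z\<^esub> N') $$ (i, k) =
      (Comp addcl X Y Z M N \<otimes>\<^bsub>Hom addcl X Z\<^esub> Comp addcl X Y Z M N') $$ (i, k)"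
      using entry_sum[of i k] by (simp add: closure_Comp closure_add_entry)
  qed (use * in \<open>auto simp: closure_Comp_closed\<close>)
qed (simp_all add: closure_Comp_closed closure_Comp_assoc)

lemma closure_biproduct:
  assumes X: "X \<in> lists (Ob C)" and Y: "Y \<in> lists (Ob C)"
  shows "\<exists>i1 i2 p1 p2. is_biproduct addcl X Y (X @ Y) i1 i2 p1 p2"
proof -
  let ?P = "X @ Y"
  have P: "?P \<in> lists (Ob C)" using X Y by simp
  note [simp] = lists_nth[OF X] lists_nth[OF Y] lists_nth[OF P, unfolded length_append]
  define i1 where "i1 = mat (length X) (length ?P)
    (\<lambda>(i, j). if j = i then Ident C (X ! i) else zero_mor C (X ! i) (?P ! j))"
  define i2 where "i2 = mat (length Y) (length ?P)
    (\<lambda>(i, j). if j = length X + i then Ident C (Y ! i) else zero_mor C (Y ! i) (?P ! j))"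
  define p1 where "p1 = mat (length ?P) (length X)
    (\<lambda>(i, j). if i = j then Ident C (X ! j) else zero_mor C (?P ! i) (X ! j))"
  define p2 where "p2 = mat (length ?P) (length Y)
    (\<lambda>(i, j). if i = length X + j then Ident C (Y ! j) else zero_mor C (?P ! i) (Y ! j))"
  have nthP: "?P ! i = X ! i" if "i < length X" for i using that by (simp add: nth_append)
  have nthP': "?P ! (length X + i) = Y ! i" for i by simp
  have i1: "i1 \<in> carrier (Hom addcl X ?P)" and i2: "i2 \<in> carrier (Hom addcl Y ?P)"
    and p1: "p1 \<in> carrier (Hom addcl ?P X)" and p2: "p2 \<in> carrier (Hom addcl ?P Y)"
    unfolding i1_def i2_def p1_def p2_def by (rule closure_HomI; auto simp: nthP)+
  have row_i1: "Comp addcl X ?P Z i1 M $$ (i, k) = M $$ (i, k)"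
    if "Z \<in> lists (Ob C)" "M \<in> carrier (Hom addcl ?P Z)" "i < length X" "k < length Z" for Z M i k
    using that X P by (intro closure_Comp_unit_row) (auto simp: i1_def nthP)
  have row_i2: "Comp addcl Y ?P Z i2 M $$ (i, k) = M $$ (length X + i, k)"
    if "Z \<in> lists (Ob C)" "M \<in> carrier (Hom addcl ?P Z)" "i < length Y" "k < length Z" for Z M i k
    using that Y P by (intro closure_Comp_unit_row) (auto simp: i2_def)
  have id: "Ident addcl Z \<in> carrier (Hom addcl Z Z)" and zero: "zero_mor addcl Z W \<in> carrier (Hom addcl Z W)"
    if "Z \<in> lists (Ob C)" "W \<in> lists (Ob C)" for Z W
    using that by (auto simp: closure_Ident closure_zero lists_nth intro!: closure_HomI)
  have "Comp addcl X ?P X i1 p1 = Ident addcl X"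
    by (rule closure_eqI[OF closure_Comp_closed[OF X P X i1 p1] id[OF X X]], simp add: row_i1[OF X p1])
       (simp add: p1_def closure_Ident nthP)
  moreover have "Comp addcl X ?P Y i1 p2 = zero_mor addcl X Y"
    by (rule closure_eqI[OF closure_Comp_closed[OF X P Y i1 p2] zero[OF X Y]], simp add: row_i1[OF Y p2])
       (simp add: p2_def closure_zero nthP)
  moreover have "Comp addcl Y ?P Y i2 p2 = Ident addcl Y"
    by (rule closure_eqI[OF closure_Comp_closed[OF Y P Y i2 p2] id[OF Y Y]], simp add: row_i2[OF Y p2])
       (simp add: p2_def closure_Ident)
  moreover have "Comp addcl Y ?P X i2 p1 = zero_mor addcl Y X"
    by (rule closure_eqI[OF closure_Comp_closed[OF Y P X i2 p1] zero[OF Y X]], simp add: row_i2[OF X p1])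
       (simp add: p1_def closure_zero)
  moreover have "Comp addcl ?P X ?P p1 i1 \<otimes>\<^bsub>Hom addcl ?P ?P\<^esub> Comp addcl ?P Y ?P p2 i2 = Ident addcl ?P"
  proof (rule closure_eqI)
    interpret comm_group "Hom addcl ?P ?P" using P P by (rule closure_comm_group)
    show "Comp addcl ?P X ?P p1 i1 \<otimes>\<^bsub>Hom addcl ?P ?P\<^esub> Comp addcl ?P Y ?P p2 i2 \<in> carrier (Hom addcl ?P ?P)"
      using X Y P i1 i2 p1 p2 by (intro m_closed closure_Comp_closed)
    show "Ident addcl ?P \<in> carrier (Hom addcl ?P ?P)" using id P by blast
    fix i k assume i: "i < length ?P" and k: "k < length ?P"
    show "(Comp addcl ?P X ?P p1 i1 \<otimes>\<^bsub>Hom addcl ?P ?P\<^esub> Comp addcl ?P Y ?P p2 i2) $$ (i, k)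
      = Ident addcl ?P $$ (i, k)"
    proof (cases "i < length X")
      case True
      have "Comp addcl ?P X ?P p1 i1 $$ (i, k) = i1 $$ (i, k)"
        by (rule closure_Comp_unit_row[OF P X P i1 i True k]) (use True in \<open>simp_all add: p1_def nthP\<close>)
      moreover have "Comp addcl ?P Y ?P p2 i2 $$ (i, k) = zero_mor C (?P ! i) (?P ! k)"
        by (rule closure_Comp_zero_row[OF P Y P i2 i k]) (use True in \<open>simp add: p2_def\<close>)
      moreover have "i1 $$ (i, k) \<in> carrier (Hom C (?P ! i) (?P ! k))"
        using closure_entry[OF i1 True k] by (simp only: nthP[OF True])
      moreover have "i1 $$ (i, k) = Ident addcl ?P $$ (i, k)"
        using True i k by (auto simp: i1_def closure_Ident nthP)
      ultimately show ?thesis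
        using i k P by (simp only: closure_add_entry add_zero lists_nth)
    next
      case False
      define i' where "i' = i - length X"
      have i': "i = length X + i'" "i' < length Y"
        using i False by (simp_all add: i'_def)
      have "Comp addcl ?P X ?P p1 i1 $$ (i, k) = zero_mor C (?P ! i) (?P ! k)"
        by (rule closure_Comp_zero_row[OF P X P i1 i k]) (use False i in \<open>simp add: p1_def\<close>)
      moreover have "Comp addcl ?P Y ?P p2 i2 $$ (i, k) = i2 $$ (i', k)"
        by (rule closure_Comp_unit_row[OF P Y P i2 i i'(2) k]) (use i' in \<open>simp_all add: p2_def\<close>)
      moreover have "i2 $$ (i', k) \<in> carrier (Hom C (?P ! i) (?P ! k))"
        using closure_entry[OF i2 i'(2) k] by (simp only: i'(1) nthP')
      moreover have "i2 $$ (i', k) = Ident addcl ?P $$ (i, k)"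
        using i' i k by (auto simp: i2_def closure_Ident)
      ultimately show ?thesis
        using i k P by (simp only: closure_add_entry add_zero lists_nth)
    qed
  qed
  ultimately have "is_biproduct addcl X Y ?P i1 i2 p1 p2"
    using P i1 i2 p1 p2 by (simp add: is_biproduct_def)
  then show ?thesis by blast
qed

lemma biproduct_category_closure: "biproduct_category addcl"
proof (intro biproduct_category.intro biproduct_category_axioms.intro)
  show "lin_category addcl" by (rule lin_category_closure)
  show "\<exists>P i1 i2 p1 p2. is_biproduct addcl X Y P i1 i2 p1 p2" if "X \<in> Ob addcl" "Y \<in> Ob addcl" for X Y
    using closure_biproduct that by (metis closure_Ob)
qed

text \<open>One-element lists embed the given category fully and faithfully into its additive closure.\<close>

lemma closure_single_Hom:
  "carrier (Hom addcl [u] [v]) = (\<lambda>f. mat 1 1 (\<lambda>_. f)) ` carrier (Hom C u v)"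
proof
  show "(\<lambda>f. mat 1 1 (\<lambda>_. f)) ` carrier (Hom C u v) \<subseteq> carrier (Hom addcl [u] [v])"
    by (auto simp: mem_closure_Hom)
  show "carrier (Hom addcl [u] [v]) \<subseteq> (\<lambda>f. mat 1 1 (\<lambda>_. f)) ` carrier (Hom C u v)"
  proof
    fix M assume M: "M \<in> carrier (Hom addcl [u] [v])"
    then have entry: "M $$ (0, 0) \<in> carrier (Hom C u v)" and dim: "M \<in> carrier_mat 1 1"
      by (simp_all add: mem_closure_Hom)
    have "M = mat 1 1 (\<lambda>_. M $$ (0, 0))"
      by (rule eq_matI) (use dim in simp_all)
    then show "M \<in> (\<lambda>f. mat 1 1 (\<lambda>_. f)) ` carrier (Hom C u v)"
      using entry by (rule image_eqI)
  qed
qed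

lemma mat_single_eq_iff: "mat 1 1 (\<lambda>_. f) = mat 1 1 (\<lambda>_. g) \<longleftrightarrow> f = g"
proof
  assume "mat 1 1 (\<lambda>_. f) = mat 1 1 (\<lambda>_. g)"
  then have "mat 1 1 (\<lambda>_. f) $$ (0, 0) = mat 1 1 (\<lambda>_. g) $$ (0, 0)" by (rule arg_cong)
  then show "f = g" by simp
qed simp

lemma closure_single_Comp:
  assumes "u \<in> Ob C" "v \<in> Ob C" "w \<in> Ob C" "f \<in> carrier (Hom C u v)" "g \<in> carrier (Hom C v w)"
  shows "Comp addcl [u] [v] [w] (mat 1 1 (\<lambda>_. f)) (mat 1 1 (\<lambda>_. g)) = mat 1 1 (\<lambda>_. Comp C u v w f g)"
proof -
  have "finprod (Hom C u w) (\<lambda>j. Comp C u ([v] ! j) w (mat 1 1 (\<lambda>_. f) $$ (0, j)) (mat 1 1 (\<lambda>_. g) $$ (j, 0))) {..<1}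
    = Comp C u v w f g"
    using assms hom_sum_single[of u w "{..<1}" 0
        "\<lambda>j. Comp C u ([v] ! j) w (mat 1 1 (\<lambda>_. f) $$ (0, j)) (mat 1 1 (\<lambda>_. g) $$ (j, 0))"]
    by simp
  then show ?thesis by (intro eq_matI) (simp_all add: closure_Comp)
qed

lemma closure_single_Ident: "Ident addcl [u] = mat 1 1 (\<lambda>_. Ident C u)"
  by (intro eq_matI) (simp_all add: closure_Ident)

lemma closure_single_group_hom:
  assumes "u \<in> Ob C" "v \<in> Ob C"
  shows "group_hom (Hom C u v) (Hom addcl [u] [v]) (\<lambda>f. mat 1 1 (\<lambda>_. f))"
proof (intro group_hom.intro group_hom_axioms.intro homI)
  show "group (Hom C u v)" using assms by (rule Hom_group)
  show "group (Hom addcl [u] [v])"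
    using assms by (intro lin_category.Hom_group[OF lin_category_closure]) simp_all
  show "mat 1 1 (\<lambda>_. f) \<in> carrier (Hom addcl [u] [v])" if "f \<in> carrier (Hom C u v)" for f
    using that unfolding closure_single_Hom by (rule imageI)
  show "mat 1 1 (\<lambda>_. f \<otimes>\<^bsub>Hom C u v\<^esub> g) = mat 1 1 (\<lambda>_. f) \<otimes>\<^bsub>Hom addcl [u] [v]\<^esub> mat 1 1 (\<lambda>_. g)" for f g
    by (intro eq_matI) (simp_all add: closure_add)
qed

end


section \<open>The category of a quiver with relations\<close>

lemma path_mult_of: "path_mult (frag_of p) (frag_of q) = frag_of (p @ q)"
  by (simp add: path_mult_def)

lemma path_mult_zero [simp]: "path_mult 0 g = 0" "path_mult f 0 = 0"
  by (simp_all add: path_mult_def frag_extend_eq_0)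

lemma path_mult_diff_left: "path_mult (f - f') g = path_mult f g - path_mult f' g"
  by (simp add: path_mult_def frag_extend_diff)

lemma path_mult_diff_right: "path_mult f (g - g') = path_mult f g - path_mult f g'"
proof -
  have "Poly_Mapping.keys f \<subseteq> UNIV" by simp
  then show ?thesis
  proof (induction f rule: frag_induction)
    case (one p)
    then show ?case by (simp add: path_mult_def frag_extend_diff)
  next
    case (diff a b)
    then show ?case by (simp add: path_mult_diff_left)
  qed simp
qed

lemma path_mult_add_left: "path_mult (f + f') g = path_mult f g + path_mult f' g"
  by (simp add: path_mult_def frag_extend_add)

lemma path_mult_minus: "path_mult (- f) g = - path_mult f g" "path_mult f (- g) = - path_mult f g"
  using path_mult_diff_left[of 0 f g] path_mult_diff_right[of f 0 g] by simp_all

lemma path_mult_add_right: "path_mult f (g + g') = path_mult f g + path_mult f g'"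
  using path_mult_diff_right[of f g "- g'"] by (simp add: path_mult_minus)

text \<open>The product is additive in each argument, so the identity reduces to paths, one argument after
  another.\<close>

lemma path_mult_assoc: "path_mult (path_mult f g) h = path_mult f (path_mult g h)"
proof -
  have pqh: "path_mult (path_mult (frag_of p) (frag_of q)) h
      = path_mult (frag_of p) (path_mult (frag_of q) h)" for p q h
  proof -
    have "Poly_Mapping.keys h \<subseteq> UNIV" by simp
    then show ?thesis
      by (induction h rule: frag_induction) (simp_all add: path_mult_of path_mult_diff_right)
  qed
  have pgh: "path_mult (path_mult (frag_of p) g) h = path_mult (frag_of p) (path_mult g h)" for p
  proof -
    have "Poly_Mapping.keys g \<subseteq> UNIV" by simp
    then show ?thesis
      by (induction g rule: frag_induction) (simp_all add: pqh path_mult_diff_left path_mult_diff_right)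
  qed
  have "Poly_Mapping.keys f \<subseteq> UNIV" by simp
  then show ?thesis
    by (induction f rule: frag_induction) (simp_all add: pgh path_mult_diff_left)
qed

lemma path_mult_Nil: "path_mult (frag_of []) f = f" "path_mult f (frag_of []) = f"
proof -
  show "path_mult (frag_of []) f = f"
    using frag_expansion[of f] by (simp add: path_mult_def)
  show "path_mult f (frag_of []) = f"
    using frag_expansion[of f] by (simp add: path_mult_def)
qed

lemma path_combs_simps [simp]:
  "f \<in> carrier (path_combs Q u v) \<longleftrightarrow> Poly_Mapping.keys f \<subseteq> paths Q u v"
  "f \<otimes>\<^bsub>path_combs Q u v\<^esub> g = f + g" "\<one>\<^bsub>path_combs Q u v\<^esub> = 0"
  by (simp_all add: path_combs_def)

lemma path_combs_inv [simp]: "Poly_Mapping.keys f \<subseteq> paths Q u v \<Longrightarrow> inv\<^bsub>path_combs Q u v\<^esub> f = - f"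
  by (simp add: path_combs_def)

lemma path_combs_comm_group: "comm_group (path_combs Q u v)"
  by (simp add: path_combs_def abelian_free_Abelian_group)

definition path_cat :: "('v, 'e) pre_digraph \<Rightarrow> ('v, 'e path_comb) lincat" where
  "path_cat Q = \<lparr>Ob = verts Q, Hom = path_combs Q, Comp = (\<lambda>u v w. path_mult), Ident = (\<lambda>u. frag_of [])\<rparr>"

lemma path_cat_simps [simp]:
  "Ob (path_cat Q) = verts Q" "Hom (path_cat Q) = path_combs Q"
  "Comp (path_cat Q) u v w = path_mult" "Ident (path_cat Q) u = frag_of []"
  by (simp_all add: path_cat_def)

lemma quiver_cat_eq_quotient: "quiver_cat Q R = quotient_cat (path_cat Q) (rel_ideal Q R)"
  by (simp add: quiver_cat_def quotient_cat_def path_class_def fun_eq_iff)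

lemma Nil_in_paths: "u \<in> verts Q \<Longrightarrow> [] \<in> paths Q u u"
  by (simp add: paths_def pre_digraph.awalk_def pre_digraph.cas.simps)

context wf_digraph
begin

lemma append_in_paths: "\<lbrakk>p \<in> paths G u v; q \<in> paths G v w\<rbrakk> \<Longrightarrow> p @ q \<in> paths G u w"
  by (simp add: paths_def del: awalk_append_iff) (rule awalk_appendI)

lemma path_mult_closed:
  assumes "Poly_Mapping.keys f \<subseteq> paths G u v" "Poly_Mapping.keys g \<subseteq> paths G v w"
  shows "Poly_Mapping.keys (path_mult f g) \<subseteq> paths G u w"
proof -
  have "Poly_Mapping.keys (path_mult f g) \<subseteq>
      (\<Union>p\<in>Poly_Mapping.keys f. \<Union>q\<in>Poly_Mapping.keys g. Poly_Mapping.keys (frag_of (p @ q)))"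
    unfolding path_mult_def by (rule order_trans[OF keys_frag_extend]) (intro UN_mono order_refl keys_frag_extend)
  also have "\<dots> \<subseteq> paths G u w"
    using assms append_in_paths by (auto simp: subset_iff)
  finally show ?thesis .
qed

lemma lin_category_path_cat: "lin_category (path_cat G)"
  by (rule lin_category.intro)
     (simp_all add: path_combs_comm_group path_mult_closed path_mult_assoc path_mult_add_left
       path_mult_add_right path_mult_Nil Nil_in_paths)

text \<open>Extending a generator \<open>p \<cdot> r \<cdot> q\<close> by a path on either side gives another generator; the rest
  is additivity.\<close>

lemma rel_ideal_lin_ideal:
  assumes R: "\<And>s t r. (s, t, r) \<in> R \<Longrightarrow> r \<in> carrier (path_combs G s t)"
  shows "lin_ideal (path_cat G) (rel_ideal G R)"
proof -
  define gens where "gens = (\<lambda>u v. {path_mult (path_mult (frag_of p) r) (frag_of q) | p q r s t.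
          (s, t, r) \<in> R \<and> p \<in> paths G u s \<and> q \<in> paths G t v})"
  have rel: "rel_ideal G R u v = generate (path_combs G u v) (gens u v)" for u v
    by (simp add: rel_ideal_def gens_def)
  have gens_sub: "gens u v \<subseteq> carrier (path_combs G u v)" for u v
  proof
    fix x assume "x \<in> gens u v"
    then obtain p q r s t where x: "x = path_mult (path_mult (frag_of p) r) (frag_of q)"
      and "(s, t, r) \<in> R" "p \<in> paths G u s" "q \<in> paths G t v"
      unfolding gens_def by blast
    then have "Poly_Mapping.keys x \<subseteq> paths G u v"
      using R[of s t r] unfolding x by (intro path_mult_closed[of _ u t] path_mult_closed[of _ u s]) simp_all
    then show "x \<in> carrier (path_combs G u v)" by simp
  qed
  have group: "group (path_combs G u v)" for u v
    by (rule comm_group.axioms(2)[OF path_combs_comm_group])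
  have sub: "subgroup (rel_ideal G R u v) (path_combs G u v)" for u v
    unfolding rel using gens_sub by (rule group.generate_is_subgroup[OF group])
  have closed: "Poly_Mapping.keys f \<subseteq> paths G u v" if "f \<in> rel_ideal G R u v" for f u v
    using subgroup.subset[OF sub] that by fastforce
  have zero: "0 \<in> rel_ideal G R u v" for u v
    using subgroup.one_closed[OF sub] by simp
  have add: "f + g \<in> rel_ideal G R u v" if "f \<in> rel_ideal G R u v" "g \<in> rel_ideal G R u v" for f g u v
    using subgroup.m_closed[OF sub that] by simp
  have neg: "- f \<in> rel_ideal G R u v" if "f \<in> rel_ideal G R u v" for f u v
    using subgroup.m_inv_closed[OF sub that] closed[OF that] by simp
  have diff: "f - g \<in> rel_ideal G R u v" if "f \<in> rel_ideal G R u v" "g \<in> rel_ideal G R u v" for f g u v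
    using add[OF that(1) neg[OF that(2)]] by simp
  have gens_in: "x \<in> rel_ideal G R u v" if "x \<in> gens u v" for x u v
    unfolding rel using that by (rule generate.incl)
  have gen_mult: "path_mult x g \<in> rel_ideal G R u w"
    if x: "x \<in> gens u v" and g: "Poly_Mapping.keys g \<subseteq> paths G v w" for x g u v w
    using g
  proof (induction g rule: frag_induction)
    case (one q')
    obtain p q r s t where xe: "x = path_mult (path_mult (frag_of p) r) (frag_of q)"
      and *: "(s, t, r) \<in> R" "p \<in> paths G u s" "q \<in> paths G t v"
      using x unfolding gens_def by blast
    have "path_mult x (frag_of q') = path_mult (path_mult (frag_of p) r) (frag_of (q @ q'))"
      by (simp add: xe path_mult_assoc flip: path_mult_of)
    then have "path_mult x (frag_of q') \<in> gens u w"
      using append_in_paths[of q t v q' w] one * unfolding gens_def by blast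
    then show ?case by (rule gens_in)
  qed (simp_all add: zero path_mult_diff_right diff)
  have mult_gen: "path_mult g x \<in> rel_ideal G R u w"
    if x: "x \<in> gens v w" and g: "Poly_Mapping.keys g \<subseteq> paths G u v" for x g u v w
    using g
  proof (induction g rule: frag_induction)
    case (one p')
    obtain p q r s t where xe: "x = path_mult (path_mult (frag_of p) r) (frag_of q)"
      and *: "(s, t, r) \<in> R" "p \<in> paths G v s" "q \<in> paths G t w"
      using x unfolding gens_def by blast
    have "path_mult (frag_of p') x = path_mult (path_mult (frag_of (p' @ p)) r) (frag_of q)"
      by (simp add: xe path_mult_assoc flip: path_mult_of)
    then have "path_mult (frag_of p') x \<in> gens u w"
      using append_in_paths[of p' u v p s] one * unfolding gens_def by blast
    then show ?case by (rule gens_in)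
  qed (simp_all add: zero path_mult_diff_left diff)
  show ?thesis
  proof (intro lin_ideal.intro lin_ideal_axioms.intro lin_category_path_cat)
    show "subgroup (rel_ideal G R u v) (Hom (path_cat G) u v)" for u v using sub by simp
    show "Comp (path_cat G) u v w f g \<in> rel_ideal G R u w"
      if f: "f \<in> rel_ideal G R u v" and g: "g \<in> carrier (Hom (path_cat G) v w)" for u v w f g
    proof -
      have g': "Poly_Mapping.keys g \<subseteq> paths G v w" using g by simp
      have "path_mult f g \<in> rel_ideal G R u w"
        using f unfolding rel[of u v]
      proof (induction f rule: generate.induct)
        case (inv h)
        then have "Poly_Mapping.keys h \<subseteq> paths G u v" using gens_sub by fastforce
        then show ?case using gen_mult[OF inv g'] neg by (simp add: path_mult_minus)
      qed (simp_all add: zero gen_mult[OF _ g'] path_mult_add_left add)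
      then show ?thesis by simp
    qed
    show "Comp (path_cat G) u v w f g \<in> rel_ideal G R u w"
      if f: "f \<in> carrier (Hom (path_cat G) u v)" and g: "g \<in> rel_ideal G R v w" for u v w f g
    proof -
      have f': "Poly_Mapping.keys f \<subseteq> paths G u v" using f by simp
      have "path_mult f g \<in> rel_ideal G R u w"
        using g unfolding rel[of v w]
      proof (induction g rule: generate.induct)
        case (inv h)
        then have "Poly_Mapping.keys h \<subseteq> paths G v w" using gens_sub by fastforce
        then show ?case using mult_gen[OF inv f'] neg by (simp add: path_mult_minus)
      qed (simp_all add: zero mult_gen[OF _ f'] path_mult_add_right add)
      then show ?thesis by simp
    qed
  qed
qed

end

lemma carrier_path_combs_single:
  assumes "paths Q u v = {p}"
  shows "carrier (path_combs Q u v) = range (\<lambda>k::int. frag_of p [^]\<^bsub>path_combs Q u v\<^esub> k)"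
proof -
  have pow: "frag_of p [^]\<^bsub>path_combs Q u v\<^esub> k = frag_cmul k (frag_of p)" for k :: int
    using assms by (simp add: path_combs_def)
  show ?thesis
  proof
    show "carrier (path_combs Q u v) \<subseteq> range (\<lambda>k::int. frag_of p [^]\<^bsub>path_combs Q u v\<^esub> k)"
    proof
      fix f assume "f \<in> carrier (path_combs Q u v)"
      then have "Poly_Mapping.keys f \<subseteq> {p}" using assms by simp
      then have "f = frag_cmul (Poly_Mapping.lookup f p) (frag_of p)"
        by (intro poly_mapping_eqI) (auto simp: in_keys_iff subset_iff)
      then show "f \<in> range (\<lambda>k::int. frag_of p [^]\<^bsub>path_combs Q u v\<^esub> k)"
        unfolding pow by blast
    qed
    show "range (\<lambda>k::int. frag_of p [^]\<^bsub>path_combs Q u v\<^esub> k) \<subseteq> carrier (path_combs Q u v)"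
      unfolding pow using assms keys_cmul[of _ "frag_of p"] by auto
  qed
qed


section \<open>The quiver of the snake lemma\<close>

lemma wf_snake_quiver: "wf_digraph snake_quiver"
proof
  show "tail snake_quiver e \<in> verts snake_quiver" "head snake_quiver e \<in> verts snake_quiver" for e
    by (cases e; simp add: snake_quiver_def)+
qed

lemma mem_snake_paths: "p \<in> paths snake_quiver u v \<longleftrightarrow> pre_digraph.cas snake_quiver u p v"
proof -
  have "u \<in> verts snake_quiver" by (cases u) (simp_all add: snake_quiver_def)
  moreover have "set p \<subseteq> arcs snake_quiver"
    using snake_arrow.exhaust by (auto simp: snake_quiver_def)
  ultimately show ?thesis by (simp add: paths_def pre_digraph.awalk_def)
qed

lemma snake_cas_Cons:
  "pre_digraph.cas snake_quiver u (e # es) v \<longleftrightarrow>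
     (case e of E\<alpha> \<Rightarrow> u = Va \<and> pre_digraph.cas snake_quiver Vb es v
      | E\<beta> \<Rightarrow> u = Vb \<and> pre_digraph.cas snake_quiver Vc es v
      | E\<gamma> \<Rightarrow> u = Vc \<and> pre_digraph.cas snake_quiver Vd es v)"
  by (cases e) (auto simp: pre_digraph.cas.simps snake_quiver_def)

lemma snake_cas:
  "pre_digraph.cas snake_quiver Vd p v \<longleftrightarrow> p = [] \<and> v = Vd"
  "pre_digraph.cas snake_quiver Vc p v \<longleftrightarrow> p = [] \<and> v = Vc \<or> p = [E\<gamma>] \<and> v = Vd"
  "pre_digraph.cas snake_quiver Vb p v \<longleftrightarrow>
     p = [] \<and> v = Vb \<or> p = [E\<beta>] \<and> v = Vc \<or> p = [E\<beta>, E\<gamma>] \<and> v = Vd"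
  "pre_digraph.cas snake_quiver Va p v \<longleftrightarrow>
     p = [] \<and> v = Va \<or> p = [E\<alpha>] \<and> v = Vb \<or> p = [E\<alpha>, E\<beta>] \<and> v = Vc \<or> p = [E\<alpha>, E\<beta>, E\<gamma>] \<and> v = Vd"
proof -
  have Nil: "pre_digraph.cas snake_quiver u [] v \<longleftrightarrow> u = v" for u v
    by (simp add: pre_digraph.cas.simps)
  show d: "pre_digraph.cas snake_quiver Vd p v \<longleftrightarrow> p = [] \<and> v = Vd" for p v
    by (cases p) (auto simp: Nil snake_cas_Cons split: snake_arrow.split)
  show c: "pre_digraph.cas snake_quiver Vc p v \<longleftrightarrow> p = [] \<and> v = Vc \<or> p = [E\<gamma>] \<and> v = Vd" for p v
    by (cases p) (auto simp: Nil snake_cas_Cons d split: snake_arrow.split)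
  show b: "pre_digraph.cas snake_quiver Vb p v \<longleftrightarrow>
     p = [] \<and> v = Vb \<or> p = [E\<beta>] \<and> v = Vc \<or> p = [E\<beta>, E\<gamma>] \<and> v = Vd" for p v
    by (cases p) (auto simp: Nil snake_cas_Cons c split: snake_arrow.split)
  show "pre_digraph.cas snake_quiver Va p v \<longleftrightarrow>
     p = [] \<and> v = Va \<or> p = [E\<alpha>] \<and> v = Vb \<or> p = [E\<alpha>, E\<beta>] \<and> v = Vc \<or> p = [E\<alpha>, E\<beta>, E\<gamma>] \<and> v = Vd"
    by (cases p) (auto simp: Nil snake_cas_Cons b split: snake_arrow.split)
qed

interpretation snake_rel: lin_ideal "path_cat snake_quiver" "rel_ideal snake_quiver snake_relations"
  by (rule wf_digraph.rel_ideal_lin_ideal[OF wf_snake_quiver])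
     (auto simp: snake_relations_def mem_snake_paths snake_cas)

interpretation snake_add: biproduct_category snake_add
  using snake_rel.quot.biproduct_category_closure by (simp add: snake_add_def quiver_cat_eq_quotient)

lemma snake_Ob [simp]: "[u] \<in> Ob snake_add" "[] \<in> Ob snake_add"
  by (cases u; simp add: snake_add_def additive_closure_def quiver_cat_def snake_quiver_def)+

lemma verts_snake [simp]: "u \<in> verts snake_quiver"
  by (cases u) (simp_all add: snake_quiver_def)

lemma snake_mor_eq: "snake_mor u p v = mat 1 1 (\<lambda>_. snake_rel.cls u v (frag_of p))"
  by (simp add: snake_mor_def path_class_def)

lemma snake_add_eq: "snake_add = additive_closure snake_rel.quot"
  by (simp add: snake_add_def quiver_cat_eq_quotient)

lemma snake_class_closed:
  "p \<in> paths snake_quiver u v \<Longrightarrow> snake_rel.cls u v (frag_of p) \<in> carrier (Hom snake_rel.quot u v)"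
  using snake_rel.cls_closed[of "frag_of p" u v] by simp

lemma snake_mor_closed [simp]:
  "p \<in> paths snake_quiver u v \<Longrightarrow> snake_mor u p v \<in> carrier (Hom snake_add [u] [v])"
  unfolding snake_mor_eq snake_add_eq snake_rel.quot.closure_single_Hom
  by (intro imageI snake_rel.cls_closed) simp

lemma snake_mor_Comp:
  assumes "p \<in> paths snake_quiver u v" "q \<in> paths snake_quiver v w"
  shows "Comp snake_add [u] [v] [w] (snake_mor u p v) (snake_mor v q w) = snake_mor u (p @ q) w"
proof -
  have "Comp snake_rel.quot u v w (snake_rel.cls u v (frag_of p)) (snake_rel.cls v w (frag_of q))
    = snake_rel.cls u w (frag_of (p @ q))"
    using snake_rel.cls_Comp[of u v w "frag_of p" "frag_of q"] assms by (simp add: path_mult_of)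
  then show ?thesis
    unfolding snake_mor_eq snake_add_eq using snake_class_closed assms
    by (subst snake_rel.quot.closure_single_Comp) simp_all
qed

lemma snake_Ident: "Ident snake_add [u] = snake_mor u [] u"
  by (simp add: snake_mor_eq snake_add_eq snake_rel.quot.closure_single_Ident snake_rel.quot_Ident)

lemma snake_Hom_trivial:
  assumes "paths snake_quiver u v = {}"
  shows "carrier (Hom snake_add [u] [v]) = {zero_mor snake_add [u] [v]}"
proof -
  have "carrier (path_combs snake_quiver u v) = {0}" using assms by auto
  then obtain x where "carrier (Hom snake_add [u] [v]) = {x}"
    by (auto simp: snake_add_eq snake_rel.quot.closure_single_Hom snake_rel.carrier_quot_Hom)
  moreover have "zero_mor snake_add [u] [v] \<in> carrier (Hom snake_add [u] [v])" by simp
  ultimately show ?thesis by simp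
qed

lemma snake_mor_pow:
  assumes "p \<in> paths snake_quiver u v"
  shows "snake_mor u p v [^]\<^bsub>Hom snake_add [u] [v]\<^esub> (k :: int)
    = mat 1 1 (\<lambda>_. snake_rel.cls u v (frag_of p [^]\<^bsub>path_combs snake_quiver u v\<^esub> k))"
proof -
  have normal: "rel_ideal snake_quiver snake_relations u v \<lhd> path_combs snake_quiver u v"
    using snake_rel.ideal_normal[of u v] by simp
  interpret h: group_hom "Hom snake_rel.quot u v" "Hom snake_add [u] [v]" "\<lambda>f. mat 1 1 (\<lambda>_. f)"
    unfolding snake_add_eq by (rule snake_rel.quot.closure_single_group_hom) simp_all
  have "snake_mor u p v [^]\<^bsub>Hom snake_add [u] [v]\<^esub> k
    = mat 1 1 (\<lambda>_. snake_rel.cls u v (frag_of p) [^]\<^bsub>Hom snake_rel.quot u v\<^esub> k)"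
    unfolding snake_mor_eq using assms by (subst h.hom_int_pow) (use snake_class_closed in auto)
  then show ?thesis
    using normal.FactGroup_int_pow[OF normal, of "frag_of p" k] assms
    by (simp add: snake_rel.quot_Hom)
qed

lemma snake_Hom_cyclic:
  assumes "paths snake_quiver u v = {p}"
  shows "carrier (Hom snake_add [u] [v]) = range (\<lambda>k::int. snake_mor u p v [^]\<^bsub>Hom snake_add [u] [v]\<^esub> k)"
  using assms carrier_path_combs_single[OF assms]
  by (simp add: snake_mor_pow) (simp add: snake_add_eq snake_rel.quot.closure_single_Hom snake_rel.carrier_quot_Hom image_image)

text \<open>The relation starts at \<open>a\<close>, so it has no consequences for paths whose source cannot reach \<open>a\<close>.\<close>

lemma snake_mor_pow_inj:
  assumes "p \<in> paths snake_quiver u v" and no_path: "paths snake_quiver u Va = {}"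
  shows "inj (\<lambda>k::int. snake_mor u p v [^]\<^bsub>Hom snake_add [u] [v]\<^esub> k)"
proof (rule injI)
  fix k l :: int
  have pow: "frag_of p [^]\<^bsub>path_combs snake_quiver u v\<^esub> k = frag_cmul k (frag_of p)" for k :: int
    using assms by (simp add: path_combs_def)
  have keys: "Poly_Mapping.keys (frag_cmul k (frag_of p)) \<subseteq> paths snake_quiver u v" for k
    using assms keys_cmul[of k "frag_of p"] by auto
  have rel: "rel_ideal snake_quiver snake_relations u v = {0}"
  proof -
    have "rel_ideal snake_quiver snake_relations u v = generate (path_combs snake_quiver u v) {}"
      unfolding rel_ideal_def using no_path by (intro arg_cong[where f = "generate _"]) (auto simp: snake_relations_def)
    also have "\<dots> = {0}"
      using group.generate_empty[OF comm_group.axioms(2)[OF path_combs_comm_group[of snake_quiver u v]]] by simp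
    finally show ?thesis .
  qed
  assume "snake_mor u p v [^]\<^bsub>Hom snake_add [u] [v]\<^esub> k = snake_mor u p v [^]\<^bsub>Hom snake_add [u] [v]\<^esub> l"
  then have "snake_rel.cls u v (frag_cmul k (frag_of p)) = snake_rel.cls u v (frag_cmul l (frag_of p))"
    using assms by (simp only: snake_mor_pow snake_rel.quot.mat_single_eq_iff pow)
  then have "frag_cmul k (frag_of p) + - frag_cmul l (frag_of p) \<in> {0}"
    using snake_rel.cls_eq_iff[of u v "frag_cmul k (frag_of p)" "frag_cmul l (frag_of p)"] keys rel
    by (simp del: minus_frag_cmul)
  then have "frag_cmul (k - l) (frag_of p) = 0" by (simp add: frag_cmul_diff_distrib del: minus_frag_cmul)
  then show "k = l" by simp
qed

interpretation snake: adel_snake snake_add "[]" "[Va]" "[Vb]" "[Vc]" "[Vd]"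
  "snake_mor Va [E\<alpha>] Vb" "snake_mor Vb [E\<beta>] Vc" "snake_mor Vc [E\<gamma>] Vd"
  by unfold_locales (simp_all add: mem_snake_paths snake_cas)

theorem lemma2p11:
  shows
    "let
       C = snake_add;
       A = Adel C;
       X\<^sub>1 = Adel_Obj [] (zero_mor C [] [Va]) [Va] (snake_mor Va [E\<alpha>, E\<beta>] Vc) [Vc];
       X\<^sub>2 = Adel_Obj [] (zero_mor C [] [Vb]) [Vb] (snake_mor Vb [E\<beta>] Vc) [Vc];
       X\<^sub>3 = Adel_Obj [Va] (snake_mor Va [E\<alpha>] Vb) [Vb] (snake_mor Vb [E\<beta>, E\<gamma>] Vd) [Vd];
       X\<^sub>4 = Adel_Obj [Va] (snake_mor Va [E\<alpha>, E\<beta>] Vc) [Vc] (snake_mor Vc [E\<gamma>] Vd) [Vd];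
       X\<^sub>5 = Adel_Obj [Vb] (snake_mor Vb [E\<beta>] Vc) [Vc] (zero_mor C [Vc] []) [];
       X\<^sub>6 = Adel_Obj [Vb] (snake_mor Vb [E\<beta>, E\<gamma>] Vd) [Vd] (zero_mor C [Vd] []) [];
       f\<^sub>1 = adel_class C X\<^sub>1 X\<^sub>2 (snake_mor Va [E\<alpha>] Vb);
       f\<^sub>2 = adel_class C X\<^sub>2 X\<^sub>3 (Ident C [Vb]);
       \<delta> = adel_class C X\<^sub>3 X\<^sub>4 (snake_mor Vb [E\<beta>] Vc);
       f\<^sub>4 = adel_class C X\<^sub>4 X\<^sub>5 (Ident C [Vc]);
       f\<^sub>5 = adel_class C X\<^sub>5 X\<^sub>6 (snake_mor Vc [E\<gamma>] Vd);
       H = Hom A X\<^sub>3 X\<^sub>4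
     in
       H \<cong> integer_group \<and>
       \<delta> \<in> carrier H \<and> generate H {\<delta>} = carrier H \<and>
       (\<forall>D\<in>carrier H.
          (exact_at A X\<^sub>1 f\<^sub>1 X\<^sub>2 f\<^sub>2 X\<^sub>3 \<and>
           exact_at A X\<^sub>2 f\<^sub>2 X\<^sub>3 D X\<^sub>4 \<and>
           exact_at A X\<^sub>3 D X\<^sub>4 f\<^sub>4 X\<^sub>5 \<and>
           exact_at A X\<^sub>4 f\<^sub>4 X\<^sub>5 f\<^sub>5 X\<^sub>6)
          \<longleftrightarrow> D = \<delta> \<or> D = inv\<^bsub>H\<^esub> \<delta>)"
proof -
  have paths: "paths snake_quiver Vb Va = {}" "paths snake_quiver Vd Vc = {}"
    "paths snake_quiver Vb Vb = {[]}" "paths snake_quiver Vb Vc = {[E\<beta>]}"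
    by (auto simp: mem_snake_paths snake_cas)
  have "inj (\<lambda>k::int. snake_mor Vb [E\<beta>] Vc [^]\<^bsub>Hom snake_add [Vb] [Vc]\<^esub> k)"
    by (rule snake_mor_pow_inj) (simp_all add: paths)
  note group = snake.snake_connecting_group[OF snake_Hom_trivial[OF paths(1)] snake_Hom_trivial[OF paths(2)]
      snake_Hom_cyclic[OF paths(3), folded snake_Ident] snake_Hom_cyclic[OF paths(4)] this]
  have comps:
    "Comp snake_add [Va] [Vb] [Vc] (snake_mor Va [E\<alpha>] Vb) (snake_mor Vb [E\<beta>] Vc) = snake_mor Va [E\<alpha>, E\<beta>] Vc"
    "Comp snake_add [Vb] [Vc] [Vd] (snake_mor Vb [E\<beta>] Vc) (snake_mor Vc [E\<gamma>] Vd) = snake_mor Vb [E\<beta>, E\<gamma>] Vd"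
    by (simp_all add: snake_mor_Comp mem_snake_paths snake_cas)
  show ?thesis
    unfolding Let_def by (intro conjI) (rule group[unfolded snake.X_defs comps])+
qed

end
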